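(* Let $A$ and $B$ be fixed finitely generated abelian groups with $A$ nontrivial. If $|B|=\infty$, then the Diophantine problem for spherical equations in $A\wr B$ is $\mathbf{NP}$-hard: that is, it is $\mathbf{NP}$-hard to decide, given $m\ge 1$ and $c_1,\dots,c_m\in A\wr B$, whether there exist $z_1,\dots,z_m\in A\wr B$ with $\prod_{j=1}^m z_j^{-1}c_jz_j=1$.
   Context: Wreath product: for finitely generated abelian groups $A,B$ (written additively), $A^B$ is the group of finitely supported functions $f\colon B\to A$ under pointwise addition; for $f\in A^B$, $b\in B$ put $f^b(x)=f(b+x)$. Then $A\wr B=B\ltimes A^B$ with multiplication $(\delta_1,f_1)(\delta_2,f_2)=(\delta_1+\delta_2,\,f_1^{\delta_2}+f_2)$. An element $a\in A$ is identified with $(0,f)$, where $f(0)=a$ and $f(x)=0$ for $x\ne 0$; an element $b\in B$ is identified with $(b,0)$. Generators of $A$ and of $B$ together generate $A\wr B$. Representation: the elements $c_j$ are given as words in a fixed finite set of generators of $A$ and $B$ and their inverses, and the size of the input is the total length of the equation. $\mathbf{NP}$-hardness is with respect to polynomial-time many-one reductions. *)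

theory Defs
  imports
    "HOL-Algebra.Generated_Groups"
    "HOL-Computational_Algebra.Polynomial"
begin

section \<open>Turing machines, NP, and polynomial-time many-one reductions\<close>

text \<open>
  Strings over the alphabet \<open>{..<s}\<close> are the elements of \<open>lists {..<s}\<close>.
  A tape is infinite in both directions; it is given by its cell contents (\<open>None\<close> is the
  blank) and the position of the head.  A machine with \<open>k\<close> tapes is given by a finite
  transition relation between pairs (state, symbols under the heads) and
  pairs (new state, for every tape the symbol written and the head movement).  State \<open>0\<close> is
  the start state and state \<open>1\<close> the accepting state.  Finiteness of the relation is what bounds
  the set of states and the tape alphabet; a configuration without applicable transition
  is halting.
\<close>

type_synonym tape = "(int \<Rightarrow> nat option) \<times> int"
type_synonym configuration = "nat \<times> tape list"
type_synonym transitions = "((nat \<times> nat option list) \<times> (nat \<times> (nat option \<times> int) list)) set"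

definition turing_machine :: "nat \<Rightarrow> transitions \<Rightarrow> bool" where
  "turing_machine k \<delta> \<longleftrightarrow> k \<ge> 1 \<and> finite \<delta> \<and>
     (\<forall>((q, rs), (q', acts)) \<in> \<delta>.
        length rs = k \<and> length acts = k \<and> (\<forall>(w, d) \<in> set acts. d \<in> {-1, 0, 1}))"

fun read_tape :: "tape \<Rightarrow> nat option" where
  "read_tape (t, h) = t h"

fun act_tape :: "nat option \<times> int \<Rightarrow> tape \<Rightarrow> tape" where
  "act_tape (w, d) (t, h) = (t(h := w), h + d)"

definition tm_step :: "transitions \<Rightarrow> configuration \<Rightarrow> configuration \<Rightarrow> bool" where
  "tm_step \<delta> c c' \<longleftrightarrow>
     (\<exists>acts. ((fst c, map read_tape (snd c)), (fst c', acts)) \<in> \<delta> \<and>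
             snd c' = map2 act_tape acts (snd c))"

definition tm_halted :: "transitions \<Rightarrow> configuration \<Rightarrow> bool" where
  "tm_halted \<delta> c \<longleftrightarrow> (\<nexists>c'. tm_step \<delta> c c')"

definition string_cells :: "nat list \<Rightarrow> int \<Rightarrow> nat option" where
  "string_cells x i = (if 0 \<le> i \<and> i < int (length x) then Some (x ! nat i) else None)"

definition tm_init :: "nat \<Rightarrow> nat list \<Rightarrow> configuration" where
  "tm_init k x = (0, (string_cells x, 0) # replicate (k - 1) (\<lambda>_. None, 0))"

text \<open>Nondeterministic acceptance: some computation reaches the accepting state within the
  time bound.\<close>

definition in_NP :: "nat \<Rightarrow> nat list set \<Rightarrow> bool" where
  "in_NP s L \<longleftrightarrow> L \<subseteq> lists {..<s} \<and>
     (\<exists>k \<delta> (p :: nat poly). turing_machine k \<delta> \<and>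
        (\<forall>x \<in> lists {..<s}. x \<in> L \<longleftrightarrow>
           (\<exists>n \<le> poly p (length x). \<exists>ts. (tm_step \<delta> ^^ n) (tm_init k x) (1, ts))))"

text \<open>Deterministic machines are those with a single-valued transition relation.  The result is
  read off the last tape, which must be blank elsewhere.\<close>

definition polytime_computable :: "nat \<Rightarrow> (nat list \<Rightarrow> nat list) \<Rightarrow> bool" where
  "polytime_computable s f \<longleftrightarrow>
     (\<exists>k \<delta> (p :: nat poly). turing_machine k \<delta> \<and> single_valued \<delta> \<and>
        (\<forall>x \<in> lists {..<s}. \<exists>n \<le> poly p (length x). \<exists>c.
           (tm_step \<delta> ^^ n) (tm_init k x) c \<and> tm_halted \<delta> c \<and>
           fst (last (snd c)) = string_cells (f x)))"

definition polytime_reducible :: "nat \<Rightarrow> nat list set \<Rightarrow> nat \<Rightarrow> nat list set \<Rightarrow> bool" where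
  "polytime_reducible s L t L' \<longleftrightarrow>
     (\<exists>f. polytime_computable s f \<and>
        (\<forall>x \<in> lists {..<s}. f x \<in> lists {..<t} \<and> (x \<in> L \<longleftrightarrow> f x \<in> L')))"

definition NP_hard :: "nat \<Rightarrow> nat list set \<Rightarrow> bool" where
  "NP_hard t L' \<longleftrightarrow> L' \<subseteq> lists {..<t} \<and>
     (\<forall>s L. in_NP s L \<longrightarrow> polytime_reducible s L t L')"


section \<open>Spherical equations over a group with fixed generators\<close>

text \<open>A letter \<open>(i, False)\<close> stands for the \<open>i\<close>-th generator, \<open>(i, True)\<close> for its inverse.\<close>

type_synonym word = "(nat \<times> bool) list"

fun letter_value :: "('g, 'e) monoid_scheme \<Rightarrow> 'g list \<Rightarrow> nat \<times> bool \<Rightarrow> 'g" where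
  "letter_value G gs (i, e) = (if e then inv\<^bsub>G\<^esub> (gs ! i) else gs ! i)"

definition list_prod :: "('g, 'e) monoid_scheme \<Rightarrow> 'g list \<Rightarrow> 'g" where
  "list_prod G xs = foldr (\<otimes>\<^bsub>G\<^esub>) xs \<one>\<^bsub>G\<^esub>"

definition word_value :: "('g, 'e) monoid_scheme \<Rightarrow> 'g list \<Rightarrow> word \<Rightarrow> 'g" where
  "word_value G gs w = list_prod G (map (letter_value G gs) w)"

definition spherical_solvable :: "('g, 'e) monoid_scheme \<Rightarrow> 'g list \<Rightarrow> bool" where
  "spherical_solvable G cs \<longleftrightarrow>
     (\<exists>zs. length zs = length cs \<and> set zs \<subseteq> carrier G \<and>
        list_prod G (map2 (\<lambda>z c. inv\<^bsub>G\<^esub> z \<otimes>\<^bsub>G\<^esub> c \<otimes>\<^bsub>G\<^esub> z) zs cs) = \<one>\<^bsub>G\<^esub>)"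

text \<open>An equation is written as the string of its coefficient words, each terminated by the
  symbol \<open>0\<close>; the length of this string is the total length of the words plus their number.\<close>

fun letter_code :: "nat \<times> bool \<Rightarrow> nat" where
  "letter_code (i, e) = 2 * i + of_bool e + 1"

definition encode_words :: "word list \<Rightarrow> nat list" where
  "encode_words ws = concat (map (\<lambda>w. map letter_code w @ [0]) ws)"

definition words_over :: "nat \<Rightarrow> word set" where
  "words_over r = lists ({..<r} \<times> UNIV)"

definition spherical_problem :: "('g, 'e) monoid_scheme \<Rightarrow> 'g list \<Rightarrow> nat list set" where
  "spherical_problem G gs =
     {encode_words ws | ws.
        ws \<noteq> [] \<and> set ws \<subseteq> words_over (length gs) \<and>
        spherical_solvable G (map (word_value G gs) ws)}"

abbreviation spherical_alphabet_size :: "'g list \<Rightarrow> nat" where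
  "spherical_alphabet_size gs \<equiv> 2 * length gs + 1"

lemma inj_letter_code: "inj letter_code"
proof (rule injI)
  fix x y assume h: "letter_code x = letter_code y"
  obtain i e j f where "x = (i, e)" "y = (j, f)" by (metis surj_pair)
  with h show "x = y" by (cases e; cases f) (auto, presburger+)
qed

lemma letter_code_pos: "letter_code x \<noteq> 0"
  by (cases x) simp

lemma encode_word_append_eq:
  assumes "map letter_code v @ 0 # xs = map letter_code w @ 0 # ys"
  shows "v = w \<and> xs = ys"
  using assms
proof (induction v arbitrary: w)
  case Nil
  then show ?case by (cases w) (auto simp: letter_code_pos dest: sym)
next
  case (Cons a v)
  then show ?case
    by (cases w) (auto simp: letter_code_pos injD[OF inj_letter_code])
qed

lemma inj_encode_words: "inj encode_words"
proof (rule injI)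
  fix us ws assume "encode_words us = encode_words ws"
  then show "us = ws"
  proof (induction us arbitrary: ws)
    case Nil
    then show ?case by (cases ws) (auto simp: encode_words_def)
  next
    case (Cons u us)
    then obtain w ws' where ws: "ws = w # ws'"
      by (cases ws) (auto simp: encode_words_def)
    from Cons.prems have "map letter_code u @ 0 # encode_words us
        = map letter_code w @ 0 # encode_words ws'"
      by (simp add: ws encode_words_def)
    from encode_word_append_eq[OF this] Cons.IH show ?case by (simp add: ws)
  qed
qed

lemma spherical_problem_alphabet:
  "spherical_problem G gs \<subseteq> lists {..<spherical_alphabet_size gs}"
  by (fastforce simp: spherical_problem_def encode_words_def words_over_def)


section \<open>The restricted wreath product\<close>

definition fin_supp_funs :: "('a, 'm) monoid_scheme \<Rightarrow> ('b, 'n) monoid_scheme \<Rightarrow> ('b \<Rightarrow> 'a) set" where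
  "fin_supp_funs A B =
     {f \<in> carrier B \<rightarrow>\<^sub>E carrier A. finite {x \<in> carrier B. f x \<noteq> \<one>\<^bsub>A\<^esub>}}"

definition wreath :: "('a, 'm) monoid_scheme \<Rightarrow> ('b, 'n) monoid_scheme \<Rightarrow> ('b \<times> ('b \<Rightarrow> 'a)) monoid" where
  "wreath A B =
     \<lparr>carrier = carrier B \<times> fin_supp_funs A B,
      monoid.mult = (\<lambda>(d1, f1) (d2, f2).
        (d1 \<otimes>\<^bsub>B\<^esub> d2, \<lambda>x\<in>carrier B. f1 (d2 \<otimes>\<^bsub>B\<^esub> x) \<otimes>\<^bsub>A\<^esub> f2 x)),
      one = (\<one>\<^bsub>B\<^esub>, \<lambda>x\<in>carrier B. \<one>\<^bsub>A\<^esub>)\<rparr>"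

definition base_embed :: "('a, 'm) monoid_scheme \<Rightarrow> ('b, 'n) monoid_scheme \<Rightarrow> 'a \<Rightarrow> 'b \<times> ('b \<Rightarrow> 'a)" where
  "base_embed A B a = (\<one>\<^bsub>B\<^esub>, \<lambda>x\<in>carrier B. if x = \<one>\<^bsub>B\<^esub> then a else \<one>\<^bsub>A\<^esub>)"

definition top_embed :: "('a, 'm) monoid_scheme \<Rightarrow> ('b, 'n) monoid_scheme \<Rightarrow> 'b \<Rightarrow> 'b \<times> ('b \<Rightarrow> 'a)" where
  "top_embed A B b = (b, \<lambda>x\<in>carrier B. \<one>\<^bsub>A\<^esub>)"

definition wreath_gens ::
  "('a, 'm) monoid_scheme \<Rightarrow> ('b, 'n) monoid_scheme \<Rightarrow> 'a list \<Rightarrow> 'b list \<Rightarrow> ('b \<times> ('b \<Rightarrow> 'a)) list" where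
  "wreath_gens A B gA gB = map (base_embed A B) gA @ map (top_embed A B) gB"

lemma finite_supp_translate:
  assumes "group B" "d \<in> carrier B" "finite {x \<in> carrier B. f x \<noteq> c}"
  shows "finite {x \<in> carrier B. f (d \<otimes>\<^bsub>B\<^esub> x) \<noteq> c}"
proof -
  interpret group B by fact
  have "(\<lambda>x. d \<otimes>\<^bsub>B\<^esub> x) ` {x \<in> carrier B. f (d \<otimes>\<^bsub>B\<^esub> x) \<noteq> c} \<subseteq> {x \<in> carrier B. f x \<noteq> c}"
    using assms(2) by auto
  moreover have "inj_on (\<lambda>x. d \<otimes>\<^bsub>B\<^esub> x) {x \<in> carrier B. f (d \<otimes>\<^bsub>B\<^esub> x) \<noteq> c}"
    using assms(2) by (auto intro!: inj_onI)
  ultimately show ?thesis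
    using assms(3) by (meson finite_imageD finite_subset)
qed

lemma group_wreath:
  assumes "comm_group A" "comm_group B"
  shows "group (wreath A B)"
proof (rule groupI)
  interpret A: comm_group A by fact
  interpret B: comm_group B by fact
  show "\<one>\<^bsub>wreath A B\<^esub> \<in> carrier (wreath A B)"
    by (auto simp: wreath_def fin_supp_funs_def)
  fix x assume x: "x \<in> carrier (wreath A B)"
  obtain d f where df: "x = (d, f)" "d \<in> carrier B" "f \<in> carrier B \<rightarrow>\<^sub>E carrier A"
      "finite {t \<in> carrier B. f t \<noteq> \<one>\<^bsub>A\<^esub>}"
    using x by (auto simp: wreath_def fin_supp_funs_def)
  show "\<one>\<^bsub>wreath A B\<^esub> \<otimes>\<^bsub>wreath A B\<^esub> x = x"
    using df by (auto simp: wreath_def PiE_def extensional_def restrict_def Pi_def fun_eq_iff)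
  have fin: "finite {t \<in> carrier B. f (inv\<^bsub>B\<^esub> d \<otimes>\<^bsub>B\<^esub> t) \<noteq> \<one>\<^bsub>A\<^esub>}"
    using finite_supp_translate[OF B.is_group _ df(4), of "inv\<^bsub>B\<^esub> d"] df(2) by simp
  let ?y = "(inv\<^bsub>B\<^esub> d, \<lambda>t\<in>carrier B. inv\<^bsub>A\<^esub> (f (inv\<^bsub>B\<^esub> d \<otimes>\<^bsub>B\<^esub> t)))"
  have "{t \<in> carrier B. inv\<^bsub>A\<^esub> (f (inv\<^bsub>B\<^esub> d \<otimes>\<^bsub>B\<^esub> t)) \<noteq> \<one>\<^bsub>A\<^esub>}
        \<subseteq> {t \<in> carrier B. f (inv\<^bsub>B\<^esub> d \<otimes>\<^bsub>B\<^esub> t) \<noteq> \<one>\<^bsub>A\<^esub>}"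
    by auto
  then have "finite {t \<in> carrier B. inv\<^bsub>A\<^esub> (f (inv\<^bsub>B\<^esub> d \<otimes>\<^bsub>B\<^esub> t)) \<noteq> \<one>\<^bsub>A\<^esub>}"
    using fin finite_subset by blast
  then have "finite {t \<in> carrier B. (\<lambda>t\<in>carrier B. inv\<^bsub>A\<^esub> (f (inv\<^bsub>B\<^esub> d \<otimes>\<^bsub>B\<^esub> t))) t \<noteq> \<one>\<^bsub>A\<^esub>}"
    by (simp add: restrict_def cong: conj_cong)
  then have "?y \<in> carrier (wreath A B)"
    using df by (auto simp: wreath_def fin_supp_funs_def)
  moreover have "?y \<otimes>\<^bsub>wreath A B\<^esub> x = \<one>\<^bsub>wreath A B\<^esub>"
    using df by (auto simp: wreath_def B.m_assoc[symmetric] fun_eq_iff restrict_def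
        intro!: A.l_inv PiE_mem[OF df(3)])
  ultimately show "\<exists>y\<in>carrier (wreath A B). y \<otimes>\<^bsub>wreath A B\<^esub> x = \<one>\<^bsub>wreath A B\<^esub>"
    by blast
  fix y assume y: "y \<in> carrier (wreath A B)"
  obtain e g where eg: "y = (e, g)" "e \<in> carrier B" "g \<in> carrier B \<rightarrow>\<^sub>E carrier A"
      "finite {t \<in> carrier B. g t \<noteq> \<one>\<^bsub>A\<^esub>}"
    using y by (auto simp: wreath_def fin_supp_funs_def)
  have "{t \<in> carrier B. f (e \<otimes>\<^bsub>B\<^esub> t) \<otimes>\<^bsub>A\<^esub> g t \<noteq> \<one>\<^bsub>A\<^esub>}
        \<subseteq> {t \<in> carrier B. f (e \<otimes>\<^bsub>B\<^esub> t) \<noteq> \<one>\<^bsub>A\<^esub>} \<union> {t \<in> carrier B. g t \<noteq> \<one>\<^bsub>A\<^esub>}"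
    by auto
  then have "finite {t \<in> carrier B. f (e \<otimes>\<^bsub>B\<^esub> t) \<otimes>\<^bsub>A\<^esub> g t \<noteq> \<one>\<^bsub>A\<^esub>}"
    using finite_supp_translate[OF B.is_group eg(2) df(4)] eg(4)
    by (meson finite_UnI finite_subset)
  then have "finite {t \<in> carrier B. (\<lambda>t\<in>carrier B. f (e \<otimes>\<^bsub>B\<^esub> t) \<otimes>\<^bsub>A\<^esub> g t) t \<noteq> \<one>\<^bsub>A\<^esub>}"
    by (simp add: restrict_def cong: conj_cong)
  then show "x \<otimes>\<^bsub>wreath A B\<^esub> y \<in> carrier (wreath A B)"
    using df eg by (auto simp: wreath_def fin_supp_funs_def PiE_mem)
  fix z assume z: "z \<in> carrier (wreath A B)"
  obtain l h where lh: "z = (l, h)" "l \<in> carrier B" "h \<in> carrier B \<rightarrow>\<^sub>E carrier A"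
    using z by (auto simp: wreath_def fin_supp_funs_def)
  show "x \<otimes>\<^bsub>wreath A B\<^esub> y \<otimes>\<^bsub>wreath A B\<^esub> z = x \<otimes>\<^bsub>wreath A B\<^esub> (y \<otimes>\<^bsub>wreath A B\<^esub> z)"
    using df eg lh
    by (auto simp: wreath_def B.m_assoc fun_eq_iff restrict_def
        intro!: A.m_assoc PiE_mem[OF df(3)] PiE_mem[OF eg(3)] PiE_mem[OF lh(3)])
qed

end

theory Submission
  imports Defs "HOL-Algebra.Multiplicative_Group"
begin

text \<open>
  If all coefficients lie in the base group \<open>A\<^sup>B\<close>, conjugation only translates them, and the
  equation asks for translates of finitely supported functions that sum to zero.  Let \<open>a \<in> A\<close> be
  a nontrivial generator and \<open>t \<in> B\<close> a generator of infinite order.  Take one function with value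
  \<open>- a\<close> on a target set of powers of \<open>t\<close>, and functions with value \<open>a\<close> on tiles whose sizes add
  up to that of the target.  Every cell of the target has to be met by some tile, so the count
  forces an exact tiling of the target by translates of the tiles, whatever the order of \<open>a\<close>;
  tiles moved to other cosets of \<open>\<langle>t\<rangle>\<close> are lost and cannot occur.

  Tilings of sets of integers by translates express constraint satisfaction problems whose
  constraints link variables at fixed distances.  A tile contains a run of cells that fits only at
  the slots of the target, one per variable plus spare slots for unused tiles, and the cells by
  which tiles at different slots could collide encode the forbidden pairs of values; single cells
  fill the rest.  The tableau of a nondeterministic computation, read row by row, is such a problem
  with four distances.  As all numbers are written in unary, the equation is emitted by a fixed
  nest of loops over unary counters.
\<close>

section \<open>A while language on tapes\<close>

text \<open>Hardness is proved from the definition, for an arbitrary language in NP, so a machine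
  printing the instance has to be exhibited, and this shapes the construction. The number
  \<open>q\<close> of tile types, the relations \<open>R\<close> and the block length
  \<open>K\<close> depend on the language only. Every number of repetitions, including the number of
  single cells, is arranged as a sum of products of counters and constants, so that no difference of
  input-dependent numbers is ever computed. Tiles are not tied to variables: which tile lands where
  is itself the assignment, and for this there must be exactly as many slots as tiles. The cells for
  binary constraints belong to the target in every block, so a tile never sticks out there and only
  an overlap of two tiles can violate a constraint.\<close>

datatype com =
    Emit nat nat "nat option \<Rightarrow> nat option"
  | Move nat int
  | Seq com com
  | While nat com

type_synonym tapes = "nat \<Rightarrow> tape"

text \<open>The step counts are those of the compiled code, where each round of a loop costs one
  step for the test and one for the jump back.\<close>

inductive exec :: "com \<Rightarrow> tapes \<Rightarrow> nat \<Rightarrow> tapes \<Rightarrow> bool" where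
  Emit: "exec (Emit l out g) T 1
     (case g (read_tape (T l)) of None \<Rightarrow> T | Some c \<Rightarrow> T(out := act_tape (Some c, 1) (T out)))"
| Move: "exec (Move l d) T 1 (T(l := act_tape (read_tape (T l), d) (T l)))"
| Seq: "exec c1 T n T' \<Longrightarrow> exec c2 T' m T'' \<Longrightarrow> exec (Seq c1 c2) T (n + m) T''"
| WhileFalse: "read_tape (T l) = None \<Longrightarrow> exec (While l c) T 1 T"
| WhileTrue: "read_tape (T l) \<noteq> None \<Longrightarrow> exec c T n T' \<Longrightarrow> exec (While l c) T' m T''
     \<Longrightarrow> exec (While l c) T (Suc (n + Suc m)) T''"

fun well_formed :: "nat \<Rightarrow> nat \<Rightarrow> com \<Rightarrow> bool" where
  "well_formed S k (Emit l out g) \<longleftrightarrow> l < k \<and> out < k \<and> (\<forall>r c. g r = Some c \<longrightarrow> c < S)"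
| "well_formed S k (Move l d) \<longleftrightarrow> l < k \<and> d \<in> {-1, 0, 1}"
| "well_formed S k (Seq c1 c2) \<longleftrightarrow> well_formed S k c1 \<and> well_formed S k c2"
| "well_formed S k (While l c) \<longleftrightarrow> l < k \<and> well_formed S k c"

lemma well_formed_mono: "well_formed S k c \<Longrightarrow> k \<le> k' \<Longrightarrow> well_formed S k' c"
  by (induction c) auto

section \<open>Compilation to deterministic Turing machines\<close>

type_synonym instr = "nat option list \<Rightarrow> nat \<times> (nat option \<times> int) list"

definition keep :: "nat option list \<Rightarrow> (nat option \<times> int) list" where
  "keep rs = map (\<lambda>r. (r, 0)) rs"

fun code_size :: "com \<Rightarrow> nat" where
  "code_size (Emit l out g) = 1"
| "code_size (Move l d) = 1"
| "code_size (Seq c1 c2) = code_size c1 + code_size c2"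
| "code_size (While l c) = code_size c + 2"

text \<open>Addresses are absolute and double as machine states; \<open>a\<close> is the address of
  the first instruction, and control leaves at \<open>a + code_size c\<close>. With
  \<open>a = 0\<close> the start state is \<open>0\<close>, and the exit address carries no
  instruction, so the machine halts there.\<close>

fun compile :: "nat \<Rightarrow> com \<Rightarrow> instr list" where
  "compile a (Emit l out g) =
     [\<lambda>rs. (a + 1, case g (rs ! l) of None \<Rightarrow> keep rs | Some c \<Rightarrow> (keep rs)[out := (Some c, 1)])]"
| "compile a (Move l d) = [\<lambda>rs. (a + 1, (keep rs)[l := (rs ! l, d)])]"
| "compile a (Seq c1 c2) = compile a c1 @ compile (a + code_size c1) c2"
| "compile a (While l c) =
     (\<lambda>rs. (if rs ! l = None then a + code_size c + 2 else a + 1, keep rs))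
       # compile (a + 1) c @ [\<lambda>rs. (a, keep rs)]"

lemma length_compile [simp]: "length (compile a c) = code_size c"
  by (induction c arbitrary: a) auto

definition symbols :: "nat \<Rightarrow> nat option set" where
  "symbols S = insert None (Some ` {..<S})"

text \<open>Restricting the symbols read to \<open>symbols S\<close> makes the relation finite; the
  invariant \<open>tape_ok\<close> guarantees that a run never meets another symbol.\<close>

definition code_transitions :: "nat \<Rightarrow> nat \<Rightarrow> instr list \<Rightarrow> transitions" where
  "code_transitions S k P =
     {((q, rs), (P ! q) rs) | q rs. q < length P \<and> length rs = k \<and> set rs \<subseteq> symbols S}"

definition tape_ok :: "nat \<Rightarrow> tape \<Rightarrow> bool" where
  "tape_ok S t \<longleftrightarrow> range (fst t) \<subseteq> symbols S"

lemma read_tape_def': "read_tape t = fst t (snd t)"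
  by (cases t) simp

lemma act_tape_def': "act_tape a t = ((fst t)(snd t := fst a), snd t + snd a)"
  by (cases t; cases a) simp

lemma tape_ok_read: "tape_ok S t \<Longrightarrow> read_tape t \<in> symbols S"
  by (auto simp: tape_ok_def read_tape_def')

lemma tape_ok_act: "tape_ok S t \<Longrightarrow> w \<in> symbols S \<Longrightarrow> tape_ok S (act_tape (w, d) t)"
  by (auto simp: tape_ok_def act_tape_def')

lemma relpowp_one: "R ^^ Suc 0 = (R :: 'c \<Rightarrow> 'c \<Rightarrow> bool)"
  using relpowp_1[of R] by simp

lemma keep_tapes: "map2 act_tape (keep (map read_tape ts)) ts = ts"
  by (auto simp: keep_def act_tape_def' read_tape_def' intro!: nth_equalityI)

lemma keep_update_tapes:
  assumes "l < k"
  shows "map2 act_tape ((keep (map read_tape (map T [0..<k])))[l := a]) (map T [0..<k])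
         = map (T(l := act_tape a (T l))) [0..<k]"
  using assms
  by (intro nth_equalityI)
     (auto simp: keep_def nth_list_update act_tape_def' read_tape_def')

lemma code_step:
  assumes "q < length P" "\<forall>l<k. tape_ok S (T l)"
    "(P ! q) (map read_tape (map T [0..<k])) = (q', acts)"
    "ts = map2 act_tape acts (map T [0..<k])"
  shows "tm_step (code_transitions S k P) (q, map T [0..<k]) (q', ts)"
proof -
  have "set (map read_tape (map T [0..<k])) \<subseteq> symbols S"
    using assms(2) tape_ok_read[of S "T _"] by fastforce
  then show ?thesis
    unfolding tm_step_def code_transitions_def
    using assms by (force simp del: map_map)
qed

definition code_at :: "instr list \<Rightarrow> nat \<Rightarrow> instr list \<Rightarrow> bool" where
  "code_at P a Q \<longleftrightarrow> (\<exists>xs ys. P = xs @ Q @ ys \<and> length xs = a)"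

lemma code_at_append:
  "code_at P a (Q @ R) \<longleftrightarrow> code_at P a Q \<and> code_at P (a + length Q) R" (is "?l \<longleftrightarrow> ?r")
proof
  show "?l \<Longrightarrow> ?r"
    unfolding code_at_def by (metis append.assoc length_append)
  assume ?r
  then obtain xs ys xs' ys' where *: "P = xs @ Q @ ys" "length xs = a"
    "P = xs' @ R @ ys'" "length xs' = a + length Q"
    unfolding code_at_def by blast
  then have "xs' = xs @ Q"
    by (metis append.assoc append_eq_append_conv length_append)
  with * show ?l unfolding code_at_def by (metis append.assoc)
qed

lemma code_at_Cons: "code_at P a (i # Q) \<longleftrightarrow> a < length P \<and> P ! a = i \<and> code_at P (Suc a) Q"
proof -
  have "code_at P a [i] \<longleftrightarrow> a < length P \<and> P ! a = i"
    unfolding code_at_def using id_take_nth_drop[of a P]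
    by (auto simp: nth_append) (metis append_Cons append_Nil length_take min.absorb4)
  then show ?thesis using code_at_append[of P a "[i]" Q] by simp
qed

text \<open>The induction follows the execution, not the command, since a loop runs the same code at
  the same address again. \<open>code_at\<close> lets the code sit inside a larger program, and the
  bound on the tape symbols is carried along.\<close>

lemma exec_compile:
  assumes "exec c T n T'" "well_formed S k c" "code_at P a (compile a c)"
    "\<forall>l<k. tape_ok S (T l)"
  shows "(tm_step (code_transitions S k P) ^^ n) (a, map T [0..<k]) (a + code_size c, map T' [0..<k])
         \<and> (\<forall>l<k. tape_ok S (T' l))"
  using assms
proof (induction arbitrary: a rule: exec.induct)
  case (Emit l out g T)
  let ?rs = "map read_tape (map T [0..<k])"
  from Emit have l: "l < k" "out < k" and a: "a < length P" "P ! a = hd (compile a (Emit l out g))"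
    by (auto simp: code_at_Cons)
  have rl: "?rs ! l = read_tape (T l)" using l by simp
  show ?case
  proof (cases "g (read_tape (T l))")
    case None
    then show ?thesis
      using Emit.prems(3) code_step[OF a(1) Emit.prems(3), of "a + 1" "keep ?rs"] a(2) rl keep_tapes
      by (simp add: relpowp_one del: map_map relpowp.simps)
  next
    case (Some c)
    then have "c < S" using Emit.prems by auto
    with Some show ?thesis
      using Emit.prems(3) l
        code_step[OF a(1) Emit.prems(3), of "a + 1" "(keep ?rs)[out := (Some c, 1)]"] a(2) rl
        keep_update_tapes[OF l(2)] tape_ok_act[of S "T out" "Some c" 1]
      by (intro conjI) (simp_all add: symbols_def relpowp_one del: map_map relpowp.simps map_fun_upd fun_upd_apply,
          simp add: symbols_def)
  qed
next
  case (Move l d T)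
  let ?rs = "map read_tape (map T [0..<k])"
  from Move have l: "l < k" and a: "a < length P" "P ! a = hd (compile a (Move l d))"
    by (auto simp: code_at_Cons)
  have rl: "?rs ! l = read_tape (T l)" using l by simp
  show ?case
    using Move.prems(3) l
      code_step[OF a(1) Move.prems(3), of "a + 1" "(keep ?rs)[l := (read_tape (T l), d)]"] a(2) rl
      keep_update_tapes[OF l] tape_ok_act[of S "T l" "read_tape (T l)" d] tape_ok_read[of S "T l"]
    by (intro conjI) (simp_all add: relpowp_one del: map_map relpowp.simps fun_upd_apply, simp)
next
  case (Seq c1 T n T' c2 m T'')
  then have "code_at P a (compile a c1)" "code_at P (a + code_size c1) (compile (a + code_size c1) c2)"
    by (auto simp: code_at_append)
  then have
    "(tm_step (code_transitions S k P) ^^ n) (a, map T [0..<k]) (a + code_size c1, map T' [0..<k])"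
    "(tm_step (code_transitions S k P) ^^ m) (a + code_size c1, map T' [0..<k])
       (a + code_size c1 + code_size c2, map T'' [0..<k])"
    "\<forall>l<k. tape_ok S (T'' l)"
    using Seq.IH Seq.prems by simp_all
  then show ?case using relpowp_trans by (fastforce simp: add.assoc)
next
  case (WhileFalse T l c)
  let ?rs = "map read_tape (map T [0..<k])"
  from WhileFalse have l: "l < k" and a: "a < length P" "P ! a = hd (compile a (While l c))"
    by (auto simp: code_at_Cons)
  have rl: "?rs ! l = read_tape (T l)" using l by simp
  then show ?case
    using WhileFalse code_step[OF a(1), of k S T "a + code_size c + 2" "keep ?rs"] a(2) keep_tapes
    by (simp add: relpowp_one del: map_map relpowp.simps)
next
  case (WhileTrue T l c n T' m T'')
  let ?rs = "map read_tape (map T [0..<k])"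
  let ?step = "tm_step (code_transitions S k P)"
  from WhileTrue.prems have l: "l < k"
    and a: "a < length P" "P ! a = hd (compile a (While l c))"
    and body: "code_at P (Suc a) (compile (Suc a) c)"
    and b: "Suc a + code_size c < length P" "P ! (Suc a + code_size c) = (\<lambda>rs. (a, keep rs))"
    by (auto simp: code_at_Cons code_at_append)
  have rl: "?rs ! l = read_tape (T l)" using l by simp
  have 1: "?step (a, map T [0..<k]) (Suc a, map T [0..<k])"
    using WhileTrue.hyps WhileTrue.prems code_step[OF a(1), of k S T "Suc a" "keep ?rs"] a(2) rl keep_tapes
    by (simp del: map_map)
  have 2: "(?step ^^ n) (Suc a, map T [0..<k]) (Suc a + code_size c, map T' [0..<k])"
    "\<forall>l<k. tape_ok S (T' l)"
    using WhileTrue.IH(1)[OF _ body] WhileTrue.prems by auto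
  have 3: "?step (Suc a + code_size c, map T' [0..<k]) (a, map T' [0..<k])"
    using code_step[OF b(1) 2(2), of a "keep (map read_tape (map T' [0..<k]))"] b(2) keep_tapes
    by (simp del: map_map)
  have 4: "(?step ^^ m) (a, map T' [0..<k]) (a + code_size (While l c), map T'' [0..<k])"
    "\<forall>l<k. tape_ok S (T'' l)"
    using WhileTrue.IH(2)[OF WhileTrue.prems(1,2) 2(2)] by auto
  have "(?step ^^ Suc m) (Suc a + code_size c, map T' [0..<k]) (a + code_size (While l c), map T'' [0..<k])"
    by (rule relpowp_Suc_I2[OF 3 4(1)])
  then have "(?step ^^ (n + Suc m)) (Suc a, map T [0..<k]) (a + code_size (While l c), map T'' [0..<k])"
    by (rule relpowp_trans[OF 2(1)])
  then show ?case using relpowp_Suc_I2[of ?step, OF 1] 4(2) by blast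
qed

text \<open>\<open>turing_machine\<close> restricts every transition of the relation, also those for
  readings that no run produces, so this is proved from the code and not from executions.\<close>

lemma compile_acts:
  assumes "well_formed S k c" "i < code_size c" "length rs = k" "compile a c ! i = f" "f rs = (q', acts)"
  shows "length acts = k \<and> (\<forall>(w, d) \<in> set acts. d \<in> {-1, 0, 1})"
  using assms
proof (induction c arbitrary: a i)
  case (Emit l out g)
  have "acts = keep rs \<or> (\<exists>c. acts = (keep rs)[out := (Some c, 1)])"
    using Emit by (auto split: option.splits)
  then show ?case
    using Emit(3) set_update_subset_insert[of "keep rs" out] by (fastforce simp: keep_def)
next
  case (Move l d)
  then have "acts = (keep rs)[l := (rs ! l, d)]" by auto
  then show ?case
    using Move(1,3) set_update_subset_insert[of "keep rs" l "(rs ! l, d)"] by (fastforce simp: keep_def)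
next
  case (Seq c1 c2)
  show ?case
  proof (cases "i < code_size c1")
    case True
    then show ?thesis using Seq.prems Seq.IH(1)[of i a] by (simp add: nth_append)
  next
    case False
    then show ?thesis using Seq.prems Seq.IH(2)[of "i - code_size c1" "a + code_size c1"]
      by (simp add: nth_append)
  qed
next
  case (While l c)
  consider "i = 0" | "i > 0" "i < Suc (code_size c)" | "i = Suc (code_size c)"
    using While.prems(2) by (cases i; fastforce)
  then show ?case
  proof cases
    case 1
    then show ?thesis using While.prems by (auto simp: keep_def split: if_splits)
  next
    case 2
    then have i: "i - 1 < code_size c" by simp
    with 2 have "compile a (While l c) ! i = compile (a + 1) c ! (i - 1)"
      by (simp add: nth_append nth_Cons')
    then show ?thesis using While.prems While.IH[OF _ i, of "a + 1"] by simp
  next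
    case 3
    then show ?thesis using While.prems by (auto simp: keep_def nth_append)
  qed
qed

lemma turing_machine_code:
  assumes "well_formed S k c" "k \<ge> 1"
  shows "turing_machine k (code_transitions S k (compile 0 c))"
    and "single_valued (code_transitions S k (compile 0 c))"
proof -
  let ?P = "compile 0 c"
  have "finite {rs. set rs \<subseteq> symbols S \<and> length rs = k}"
    by (rule finite_lists_length_eq) (simp add: symbols_def)
  then have "finite ((\<lambda>(q, rs). ((q, rs), (?P ! q) rs)) ` ({..<length ?P} \<times> {rs. set rs \<subseteq> symbols S \<and> length rs = k}))"
    by blast
  moreover have "code_transitions S k ?P \<subseteq> (\<lambda>(q, rs). ((q, rs), (?P ! q) rs)) ` ({..<length ?P} \<times> {rs. set rs \<subseteq> symbols S \<and> length rs = k})"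
    by (auto simp: code_transitions_def)
  ultimately have "finite (code_transitions S k ?P)" by (rule finite_subset[rotated])
  moreover have "length rs = k \<and> length acts = k \<and> (\<forall>(w, d) \<in> set acts. d \<in> {-1, 0, 1})"
    if "((q, rs), (q', acts)) \<in> code_transitions S k ?P" for q rs q' acts
    using that compile_acts[OF assms(1), of q rs 0 _ q' acts] by (simp add: code_transitions_def)
  ultimately show "turing_machine k (code_transitions S k ?P)"
    unfolding turing_machine_def using assms(2) by blast
  show "single_valued (code_transitions S k ?P)"
  proof (rule single_valuedI)
    have "y = (?P ! fst x) (snd x)" if "(x, y) \<in> code_transitions S k ?P" for x y
      using that by (auto simp: code_transitions_def)
    then show "y = z" if "(x, y) \<in> code_transitions S k ?P" "(x, z) \<in> code_transitions S k ?P" for x y z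
      using that by metis
  qed
qed

section \<open>Functions emitted in polynomial time\<close>

definition rewound :: "nat list \<Rightarrow> tape" where
  "rewound y = (string_cells y, 0)"

definition filled :: "nat list \<Rightarrow> tape" where
  "filled y = (string_cells y, int (length y))"

text \<open>The first move leaves the blank behind the string, on which the loop would stop at once;
  the last one returns from the blank at position \<open>-1\<close> to the first cell.\<close>

definition rewind :: "nat \<Rightarrow> com" where
  "rewind l = Seq (Move l (-1)) (Seq (While l (Move l (-1))) (Move l 1))"

text \<open>The counter tape is rewound at the end, so the loop can be run again, for instance as
  the body of a loop over another tape.\<close>

definition loop :: "nat \<Rightarrow> com \<Rightarrow> com" where
  "loop l c = Seq (While l (Seq c (Move l 1))) (rewind l)"

lemma write_filled: "act_tape (Some c, 1) (filled y) = filled (y @ [c])"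
  by (auto simp: filled_def string_cells_def fun_eq_iff nth_append)

lemma exec_move: "T l = (t, h) \<Longrightarrow> exec (Move l d) T 1 (T(l := (t, h + d)))"
  using exec.Move[of l d T] by simp

lemma exec_rewind_while:
  "exec (While l (Move l (-1))) (T(l := (string_cells w, int i - 1))) (3 * i + 1) (T(l := (string_cells w, -1)))"
  if "i \<le> length w"
  using that
proof (induction i)
  case 0
  have "read_tape ((T(l := (string_cells w, -1))) l) = None" by (simp add: string_cells_def)
  then show ?case using exec.WhileFalse[of "T(l := (string_cells w, -1))" l] by (simp del: fun_upd_apply)
next
  case (Suc i)
  let ?T = "T(l := (string_cells w, int i))"
  have "exec (Move l (-1)) ?T 1 (?T(l := (string_cells w, int i + -1)))"
    by (rule exec_move) simp
  then have 1: "exec (Move l (-1)) ?T 1 (T(l := (string_cells w, int i - 1)))" by simp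
  have "exec (While l (Move l (-1))) ?T (Suc (1 + Suc (3 * i + 1))) (T(l := (string_cells w, -1)))"
  proof (rule exec.WhileTrue[OF _ 1])
    show "read_tape ((T(l := (string_cells w, int i))) l) \<noteq> None"
      using Suc.prems by (simp add: string_cells_def)
    show "exec (While l (Move l (- 1))) (T(l := (string_cells w, int i - 1))) (3 * i + 1) (T(l := (string_cells w, - 1)))"
      using Suc by (simp del: fun_upd_apply)
  qed
  moreover have "Suc (1 + Suc (3 * i + 1)) = 3 * Suc i + 1" "int (Suc i) - 1 = int i" by simp_all
  ultimately show ?case by (simp only:)
qed

lemma exec_rewind:
  assumes "i \<le> length w" "T l = (string_cells w, int i)"
  shows "exec (rewind l) T (3 * i + 3) (T(l := rewound w))"
proof -
  have 1: "exec (Move l (-1)) T 1 (T(l := (string_cells w, int i - 1)))"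
    using exec_move[of T l, OF assms(2), of "-1"] by simp
  have 3: "exec (Move l 1) (T(l := (string_cells w, -1))) 1 (T(l := rewound w))"
    using exec_move[of "T(l := (string_cells w, -1))" l "string_cells w" "-1" 1] by (simp add: rewound_def)
  show ?thesis unfolding rewind_def
    using exec.Seq[OF 1 exec.Seq[OF exec_rewind_while[OF assms(1)] 3]]
    by (simp add: numeral_3_eq_3)
qed

lemma exec_loop_while:
  assumes "l \<noteq> out"
    and "\<And>i y. i < length w \<Longrightarrow> \<exists>n\<le>t. exec c (T(l := (string_cells w, int i), out := filled y)) n
             (T(l := (string_cells w, int i), out := filled (y @ z i)))"
    and "j + d = length w"
  shows "\<exists>n \<le> d * (t + 3) + 1. exec (While l (Seq c (Move l 1)))
     (T(l := (string_cells w, int j), out := filled y)) n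
     (T(l := (string_cells w, int (length w)), out := filled (y @ concat (map z [j..<length w]))))"
  using assms(3)
proof (induction d arbitrary: j y)
  case 0
  then have "read_tape ((T(l := (string_cells w, int j), out := filled y)) l) = None"
    using assms(1) by (simp add: string_cells_def)
  from exec.WhileFalse[of "T(l := (string_cells w, int j), out := filled y)" l, OF this] show ?case
    using 0 by (simp del: fun_upd_apply) blast
next
  case (Suc d)
  let ?T = "\<lambda>j y. T(l := (string_cells w, int j), out := filled y)"
  obtain n where n: "n \<le> t" "exec c (?T j y) n (?T j (y @ z j))"
    using assms(2)[of j y] Suc.prems by auto
  have "exec (Move l 1) (?T j (y @ z j)) 1 ((?T j (y @ z j))(l := (string_cells w, int j + 1)))"
    by (rule exec_move) (use assms(1) in simp)
  also have "(?T j (y @ z j))(l := (string_cells w, int j + 1)) = ?T (Suc j) (y @ z j)"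
    using assms(1) by (auto simp: fun_eq_iff)
  finally have 1: "exec (Seq c (Move l 1)) (?T j y) (n + 1) (?T (Suc j) (y @ z j))"
    using exec.Seq n(2) by blast
  obtain m where m: "m \<le> d * (t + 3) + 1" "exec (While l (Seq c (Move l 1))) (?T (Suc j) (y @ z j)) m
     (?T (length w) ((y @ z j) @ concat (map z [Suc j..<length w])))"
    using Suc.IH[of "Suc j" "y @ z j"] Suc.prems by (simp del: fun_upd_apply) blast
  have "read_tape (?T j y l) \<noteq> None"
    using assms(1) Suc.prems by (simp add: string_cells_def)
  from exec.WhileTrue[OF this 1 m(2)]
  have "exec (While l (Seq c (Move l 1))) (?T j y) (Suc (n + 1 + Suc m))
     (?T (length w) (y @ concat (map z [j..<length w])))"
    using Suc.prems by (simp add: upt_conv_Cons)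
  moreover have "Suc (n + 1 + Suc m) \<le> Suc d * (t + 3) + 1" using n m by simp
  ultimately show ?case by blast
qed

text \<open>Each cell costs the body, three steps for test, move and jump, and three more for the
  way back. The constant \<open>4\<close> is the last test of the loop and the first move, last test
  and last move of \<open>rewind\<close>.\<close>

lemma exec_loop:
  assumes "l \<noteq> out" "T l = rewound w" "T out = filled y"
    and "\<And>i y. i < length w \<Longrightarrow> \<exists>n\<le>t. exec c (T(l := (string_cells w, int i), out := filled y)) n
             (T(l := (string_cells w, int i), out := filled (y @ z i)))"
  shows "\<exists>n \<le> length w * (t + 6) + 4. exec (loop l c) T n
     (T(out := filled (y @ concat (map z [0..<length w]))))"
proof -
  let ?y = "y @ concat (map z [0..<length w])"
  have T: "T(l := (string_cells w, int 0), out := filled y) = T"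
    using assms(2,3) by (auto simp: fun_eq_iff rewound_def)
  obtain n where n: "n \<le> length w * (t + 3) + 1" "exec (While l (Seq c (Move l 1))) T n
     (T(l := (string_cells w, int (length w)), out := filled ?y))"
    using exec_loop_while[OF assms(1,4), where j = 0 and d = "length w" and y = y] unfolding T by auto
  have "exec (rewind l) (T(l := (string_cells w, int (length w)), out := filled ?y)) (3 * length w + 3)
     ((T(l := (string_cells w, int (length w)), out := filled ?y))(l := rewound w))"
    by (rule exec_rewind) (use assms(1) in auto)
  also have "(T(l := (string_cells w, int (length w)), out := filled ?y))(l := rewound w) = T(out := filled ?y)"
    using assms(1,2) by (auto simp: fun_eq_iff)
  finally have "exec (loop l c) T (n + (3 * length w + 3)) (T(out := filled ?y))"
    unfolding loop_def using exec.Seq n(2) by blast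
  moreover have "n + (3 * length w + 3) \<le> length w * (t + 6) + 4"
    using n(1) by (simp add: algebra_simps)
  ultimately show ?thesis by blast
qed

text \<open>Tape \<open>l\<close> holds the string \<open>(fs ! l) x\<close>; tape \<open>0\<close> is the input and \<open>out\<close> the tape being
  written, of which a prefix \<open>y\<close> may be present already.\<close>

definition emittable ::
  "nat \<Rightarrow> nat \<Rightarrow> (nat list \<Rightarrow> nat list) list \<Rightarrow> nat \<Rightarrow> nat set \<Rightarrow> (nat list \<Rightarrow> nat list) \<Rightarrow> bool" where
  "emittable s S fs out U z \<longleftrightarrow>
     (\<exists>c (p :: nat poly). well_formed S (Suc out) c \<and>
        (\<forall>x \<in> lists {..<s}. length (z x) \<le> poly p (length x) \<and> set (z x) \<subseteq> {..<S} \<and>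
           (\<forall>T y. (\<forall>l\<in>U. T l = rewound ((fs ! l) x)) \<longrightarrow> T out = filled y \<longrightarrow>
              (\<exists>n \<le> poly p (length x). exec c T n (T(out := filled (y @ z x)))))))"

lemma emittable_mono: "emittable s S fs out U z \<Longrightarrow> U \<subseteq> V \<Longrightarrow> emittable s S fs out V z"
  unfolding emittable_def by (meson subsetD)

lemma emittable_append:
  assumes "emittable s S fs out U z1" "emittable s S fs out V z2" "out \<notin> U" "out \<notin> V"
  shows "emittable s S fs out (U \<union> V) (\<lambda>x. z1 x @ z2 x)"
proof -
  obtain c1 p1 where 1: "well_formed S (Suc out) c1"
    "\<And>x. x \<in> lists {..<s} \<Longrightarrow> length (z1 x) \<le> poly p1 (length x) \<and> set (z1 x) \<subseteq> {..<S}"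
    "\<And>x T y. x \<in> lists {..<s} \<Longrightarrow> (\<forall>l\<in>U. T l = rewound ((fs ! l) x)) \<Longrightarrow> T out = filled y \<Longrightarrow>
              (\<exists>n \<le> poly p1 (length x). exec c1 T n (T(out := filled (y @ z1 x))))"
    using assms(1) unfolding emittable_def by blast
  obtain c2 p2 where 2: "well_formed S (Suc out) c2"
    "\<And>x. x \<in> lists {..<s} \<Longrightarrow> length (z2 x) \<le> poly p2 (length x) \<and> set (z2 x) \<subseteq> {..<S}"
    "\<And>x T y. x \<in> lists {..<s} \<Longrightarrow> (\<forall>l\<in>V. T l = rewound ((fs ! l) x)) \<Longrightarrow> T out = filled y \<Longrightarrow>
              (\<exists>n \<le> poly p2 (length x). exec c2 T n (T(out := filled (y @ z2 x))))"
    using assms(2) unfolding emittable_def by blast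
  have "\<exists>n \<le> poly (p1 + p2) (length x). exec (Seq c1 c2) T n (T(out := filled (y @ z1 x @ z2 x)))"
    if x: "x \<in> lists {..<s}" "\<forall>l\<in>U \<union> V. T l = rewound ((fs ! l) x)" "T out = filled y" for x T y
  proof -
    obtain n where n: "n \<le> poly p1 (length x)" "exec c1 T n (T(out := filled (y @ z1 x)))"
      using 1(3)[OF x(1), of T y] x(2,3) by blast
    obtain m where m: "m \<le> poly p2 (length x)"
      "exec c2 (T(out := filled (y @ z1 x))) m (T(out := filled (y @ z1 x), out := filled ((y @ z1 x) @ z2 x)))"
      using 2(3)[OF x(1), of "T(out := filled (y @ z1 x))" "y @ z1 x"] x(2) assms(4) by fastforce
    have "exec (Seq c1 c2) T (n + m) (T(out := filled (y @ z1 x @ z2 x)))"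
      using exec.Seq[OF n(2) m(2)] by simp
    moreover have "n + m \<le> poly (p1 + p2) (length x)" using n(1) m(1) by simp
    ultimately show ?thesis by blast
  qed
  moreover have "length (z1 x @ z2 x) \<le> poly (p1 + p2) (length x)" "set (z1 x @ z2 x) \<subseteq> {..<S}"
    if "x \<in> lists {..<s}" for x
    using 1(2)[OF that] 2(2)[OF that] by auto
  moreover have "well_formed S (Suc out) (Seq c1 c2)" using 1(1) 2(1) by simp
  ultimately show ?thesis
    unfolding emittable_def by (intro exI[of _ "Seq c1 c2"] exI[of _ "p1 + p2"]) blast
qed

lemma emittable_symbol:
  assumes "c < S"
  shows "emittable s S fs out {} (\<lambda>x. [c])"
  unfolding emittable_def
proof (intro exI conjI ballI allI impI)
  show "well_formed S (Suc out) (Emit out out (\<lambda>_. Some c))" using assms by simp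
  fix x T y assume "T out = filled y"
  then show "exec (Emit out out (\<lambda>_. Some c)) T 1 (T(out := filled (y @ [c])))"
    using exec.Emit[of out out "\<lambda>_. Some c" T] by (simp add: write_filled)
  show "1 \<le> poly [:1:] (length x)" by simp
next
  fix x :: "nat list"
  show "length [c] \<le> poly [:1:] (length x)" by simp
  show "set [c] \<subseteq> {..<S}" using assms by simp
qed

lemma emittable_Nil: "emittable s S fs out {} (\<lambda>x. [])"
  unfolding emittable_def
proof (intro exI conjI ballI allI impI)
  show "well_formed S (Suc out) (Emit out out (\<lambda>_. None))" by simp
  fix x T y assume "T out = filled y"
  then have "T(out := filled (y @ [])) = T" by auto
  then show "exec (Emit out out (\<lambda>_. None)) T 1 (T(out := filled (y @ [])))"
    using exec.Emit[of out out "\<lambda>_. None" T] by simp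
  show "1 \<le> poly [:1:] (length x)" by simp
next
  fix x :: "nat list"
  show "length [] \<le> poly [:1:] (length x)" "set [] \<subseteq> {..<S}" by simp_all
qed

lemma emittable_const:
  assumes "set w \<subseteq> {..<S}"
  shows "emittable s S fs out {} (\<lambda>x. w)"
  using assms
proof (induction w)
  case Nil
  then show ?case using emittable_Nil by simp
next
  case (Cons c w)
  then show ?case
    using emittable_append[OF emittable_symbol[of c S s fs out] Cons.IH] by simp
qed

text \<open>The body expects the tapes in \<open>U\<close> to be rewound, whereas the head of the
  counter tape \<open>l\<close> travels during the loop; hence \<open>l \<notin> U\<close>. This is
  why nested loops need different counter tapes.\<close>

lemma emittable_repeat:
  assumes "emittable s S fs out U z" "l < out" "l \<notin> U" "out \<notin> U"
    and "\<And>x. x \<in> lists {..<s} \<Longrightarrow> length ((fs ! l) x) \<le> poly q (length x)"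
  shows "emittable s S fs out (insert l U) (\<lambda>x. concat (replicate (length ((fs ! l) x)) (z x)))"
proof -
  obtain c p where 1: "well_formed S (Suc out) c"
    "\<And>x. x \<in> lists {..<s} \<Longrightarrow> length (z x) \<le> poly p (length x) \<and> set (z x) \<subseteq> {..<S}"
    "\<And>x T y. x \<in> lists {..<s} \<Longrightarrow> (\<forall>l\<in>U. T l = rewound ((fs ! l) x)) \<Longrightarrow> T out = filled y \<Longrightarrow>
              (\<exists>n \<le> poly p (length x). exec c T n (T(out := filled (y @ z x))))"
    using assms(1) unfolding emittable_def by blast
  let ?p = "q * (p + [:6:]) + [:4:]"
  have "\<exists>n \<le> poly ?p (length x). exec (loop l c) T n
      (T(out := filled (y @ concat (replicate (length ((fs ! l) x)) (z x)))))"
    if x: "x \<in> lists {..<s}" "\<forall>l\<in>insert l U. T l = rewound ((fs ! l) x)" "T out = filled y" for x T y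
  proof -
    let ?w = "(fs ! l) x"
    have body: "\<exists>n \<le> poly p (length x). exec c (T(l := (string_cells ?w, int i), out := filled y')) n
        (T(l := (string_cells ?w, int i), out := filled (y' @ z x)))" for i y'
    proof -
      let ?T = "T(l := (string_cells ?w, int i), out := filled y')"
      have "\<forall>l\<in>U. ?T l = rewound ((fs ! l) x)" "?T out = filled y'"
        using x assms by auto
      from 1(3)[OF x(1) this] show ?thesis by (simp only: fun_upd_upd)
    qed
    have "\<exists>n \<le> length ?w * (poly p (length x) + 6) + 4. exec (loop l c) T n
       (T(out := filled (y @ concat (map (\<lambda>_. z x) [0..<length ?w]))))"
    proof (rule exec_loop)
      show "l \<noteq> out" "T l = rewound ?w" "T out = filled y" using x assms by auto
    qed (rule body)
    then obtain n where "n \<le> length ?w * (poly p (length x) + 6) + 4"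
      "exec (loop l c) T n (T(out := filled (y @ concat (replicate (length ?w) (z x)))))"
      by (auto simp: map_replicate_const)
    moreover have "length ?w * (poly p (length x) + 6) + 4 \<le> poly ?p (length x)"
      using assms(5)[OF x(1)] by simp
    ultimately show ?thesis using le_trans by blast
  qed
  moreover have "length (concat (replicate (length ((fs ! l) x)) (z x))) \<le> poly ?p (length x)"
    if "x \<in> lists {..<s}" for x
  proof -
    have "length (concat (replicate m (z x))) = m * length (z x)" for m by (induction m) auto
    then have "length (concat (replicate (length ((fs ! l) x)) (z x))) \<le> poly q (length x) * poly p (length x)"
      using mult_le_mono[OF assms(5)[OF that]] 1(2)[OF that] by simp
    also have "\<dots> \<le> poly ?p (length x)" by (simp add: algebra_simps)
    finally show ?thesis .
  qed
  moreover have "well_formed S (Suc out) (loop l c)"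
    using 1(1) assms(2) by (simp add: loop_def rewind_def)
  moreover have "set (concat (replicate (length ((fs ! l) x)) (z x))) \<subseteq> {..<S}"
    if "x \<in> lists {..<s}" for x
    using 1(2)[OF that] by auto
  ultimately show ?thesis
    unfolding emittable_def
    by (intro exI[of _ "loop l c"] exI[of _ ?p]) blast
qed

text \<open>A single \<open>Emit\<close> writes at most one symbol, so the word \<open>g a\<close>
  is written by a fixed sequence of commands: the one numbered \<open>m\<close> writes letter
  \<open>m\<close> of the word, or nothing if the word is shorter.\<close>

fun emit_letters :: "nat \<Rightarrow> nat \<Rightarrow> (nat \<Rightarrow> nat list) \<Rightarrow> nat \<Rightarrow> com" where
  "emit_letters l out g 0 = Emit l out (\<lambda>_. None)"
| "emit_letters l out g (Suc m) = Seq (emit_letters l out g m)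
     (Emit l out (\<lambda>r. case r of None \<Rightarrow> None | Some a \<Rightarrow> if m < length (g a) then Some (g a ! m) else None))"

lemma exec_emit_some:
  assumes "g (read_tape (T l)) = Some c" "T out = filled y"
  shows "exec (Emit l out g) T 1 (T(out := filled (y @ [c])))"
  using exec.Emit[of l out g T] assms by (simp add: write_filled)

lemma exec_emit_none:
  assumes "g (read_tape (T l)) = None"
  shows "exec (Emit l out g) T 1 T"
  using exec.Emit[of l out g T] assms by simp

lemma exec_emit_letters:
  assumes "l \<noteq> out" "read_tape (T l) = Some a" "T out = filled y"
  shows "exec (emit_letters l out g m) T (Suc m) (T(out := filled (y @ take m (g a))))"
proof (induction m)
  case 0
  have "T(out := filled (y @ take 0 (g a))) = T" using assms(3) by auto
  moreover have "exec (Emit l out (\<lambda>_. None)) T 1 T" by (rule exec_emit_none) simp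
  ultimately show ?case by (simp only: emit_letters.simps One_nat_def)
next
  case (Suc m)
  let ?h = "\<lambda>r. case r of None \<Rightarrow> None | Some a \<Rightarrow> if m < length (g a) then Some (g a ! m) else None"
  let ?T = "T(out := filled (y @ take m (g a)))"
  have "exec (Emit l out ?h) ?T 1 (T(out := filled (y @ take (Suc m) (g a))))"
  proof (cases "m < length (g a)")
    case True
    then have "?h (read_tape (?T l)) = Some (g a ! m)" using assms(1,2) by simp
    from exec_emit_some[of ?h ?T l, OF this, of out "y @ take m (g a)"]
    have "exec (Emit l out ?h) ?T 1 (T(out := filled ((y @ take m (g a)) @ [g a ! m])))"
      by (simp only: fun_upd_upd fun_upd_same)
    then show ?thesis
      by (simp only: take_Suc_conv_app_nth[OF True] append_assoc)
  next
    case False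
    then have "?h (read_tape (?T l)) = None" using assms(1,2) by simp
    from exec_emit_none[of ?h ?T l out, OF this] False show ?thesis by simp
  qed
  from exec.Seq[OF Suc this] show ?case by (simp only: emit_letters.simps One_nat_def add_Suc_right add_0_right)
qed

lemma emittable_scan:
  assumes "l < out" "\<And>a. a < S \<Longrightarrow> set (g a) \<subseteq> {..<S}"
    and "\<And>x. x \<in> lists {..<s} \<Longrightarrow> length ((fs ! l) x) \<le> poly q (length x)"
    and "\<And>x. x \<in> lists {..<s} \<Longrightarrow> set ((fs ! l) x) \<subseteq> {..<S}"
  shows "emittable s S fs out {l} (\<lambda>x. concat (map g ((fs ! l) x)))"
proof -
  define m where "m = Max (insert 0 ((\<lambda>a. length (g a)) ` {..<S}))"
  have m: "length (g a) \<le> m" if "a < S" for a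
    unfolding m_def using that by (intro Max_ge) auto
  \<comment> \<open>\<open>well_formed\<close> speaks about all symbols, while \<open>g\<close> is
    controlled only below \<open>S\<close>; elsewhere it is replaced by the empty word.\<close>
  define h where "h = (\<lambda>a. if a < S then g a else [])"
  have h: "length (h a) \<le> m" "set (h a) \<subseteq> {..<S}" for a
    using m assms(2) by (auto simp: h_def)
  define c where "c = emit_letters l out h m"
  have "h a ! i < S" if "i < length (h a)" for a i
    using h(2)[of a] nth_mem[OF that] by auto
  then have "well_formed S (Suc out) (emit_letters l out h i)" for i
    using assms(1) by (induction i) (auto split: option.splits if_splits)
  then have wf: "well_formed S (Suc out) (loop l c)"
    using assms(1) by (simp add: loop_def rewind_def c_def)
  let ?p = "q * [:m + 7:] + [:4:]"
  have "\<exists>n \<le> poly ?p (length x). exec (loop l c) T n (T(out := filled (y @ concat (map g ((fs ! l) x)))))"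
    if x: "x \<in> lists {..<s}" "T l = rewound ((fs ! l) x)" "T out = filled y" for x T y
  proof -
    let ?w = "(fs ! l) x"
    have body: "\<exists>n \<le> Suc m. exec c (T(l := (string_cells ?w, int i), out := filled y')) n
        (T(l := (string_cells ?w, int i), out := filled (y' @ g (?w ! i))))" if "i < length ?w" for i y'
    proof -
      let ?T = "T(l := (string_cells ?w, int i), out := filled y')"
      have "?w ! i < S" using assms(4)[OF x(1)] that nth_mem by fastforce
      moreover have "read_tape (?T l) = Some (?w ! i)"
        using assms(1) that by (simp add: string_cells_def)
      ultimately have "exec c ?T (Suc m) (?T(out := filled (y' @ g (?w ! i))))"
        using exec_emit_letters[of l out ?T "?w ! i" y' h m] assms(1) m
        by (simp add: c_def h_def)
      then show ?thesis by auto
    qed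
    have "\<exists>n \<le> length ?w * (Suc m + 6) + 4. exec (loop l c) T n
       (T(out := filled (y @ concat (map (\<lambda>i. g (?w ! i)) [0..<length ?w]))))"
      by (rule exec_loop) (use x assms body in auto)
    moreover have map_nth: "map (\<lambda>i. g (?w ! i)) [0..<length ?w] = map g ?w"
      by (rule nth_equalityI) auto
    ultimately obtain n where "n \<le> length ?w * (Suc m + 6) + 4"
      "exec (loop l c) T n (T(out := filled (y @ concat (map g ?w))))"
      unfolding map_nth by blast
    moreover have "length ?w * (Suc m + 6) + 4 \<le> poly ?p (length x)"
      using mult_le_mono1[OF assms(3)[OF x(1)], of "m + 7"] by (simp add: algebra_simps)
    ultimately show ?thesis using le_trans by blast
  qed
  moreover have "length (concat (map g ((fs ! l) x))) \<le> poly ?p (length x)"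
    if x: "x \<in> lists {..<s}" for x
  proof -
    have "length (concat (map g w)) \<le> length w * m" if "set w \<subseteq> {..<S}" for w
      using that m by (induction w) (auto intro: add_mono)
    from this[OF assms(4)[OF x]] have "length (concat (map g ((fs ! l) x))) \<le> poly q (length x) * m"
      using mult_le_mono1[OF assms(3)[OF x], of m] by (rule order_trans)
    also have "\<dots> \<le> poly ?p (length x)" by (simp add: algebra_simps)
    finally show ?thesis .
  qed
  moreover have "set (concat (map g ((fs ! l) x))) \<subseteq> {..<S}" if "x \<in> lists {..<s}" for x
    using assms(2) assms(4)[OF that] by fastforce
  ultimately show ?thesis
    unfolding emittable_def using wf
    by (intro exI[of _ "loop l c"] exI[of _ ?p]) blast
qed

section \<open>Computations in stages, one tape per stage\<close>

definition pipeline :: "nat \<Rightarrow> nat \<Rightarrow> (nat list \<Rightarrow> nat list) list \<Rightarrow> bool" where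
  "pipeline s S fs \<longleftrightarrow> fs \<noteq> [] \<and> hd fs = id \<and>
     (\<forall>l. 0 < l \<and> l < length fs \<longrightarrow> emittable s S fs l {..<l} (fs ! l))"

lemma emittable_fs_append:
  assumes "emittable s S fs out U z" "U \<subseteq> {..<length fs}"
  shows "emittable s S (fs @ gs) out U z"
proof -
  have "(\<forall>l\<in>U. T l = rewound (((fs @ gs) ! l) x)) = (\<forall>l\<in>U. T l = rewound ((fs ! l) x))" for T x
    using assms(2) by (auto simp: nth_append)
  then show ?thesis using assms(1) unfolding emittable_def by (simp only:)
qed

lemma pipeline_snoc:
  assumes "pipeline s S fs" "emittable s S fs (length fs) {..<length fs} z"
  shows "pipeline s S (fs @ [z])"
  unfolding pipeline_def
proof (intro conjI allI impI)
  show "fs @ [z] \<noteq> []" "hd (fs @ [z]) = id" using assms(1) by (auto simp: pipeline_def)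
  fix l assume l: "0 < l \<and> l < length (fs @ [z])"
  then have "emittable s S fs l {..<l} ((fs @ [z]) ! l)"
    using assms by (auto simp: pipeline_def nth_append less_Suc_eq)
  then show "emittable s S (fs @ [z]) l {..<l} ((fs @ [z]) ! l)"
    using l by (intro emittable_fs_append) auto
qed

lemma pipeline_bound:
  assumes "pipeline s S fs" "l < length fs" "s \<le> S"
  shows "(\<exists>q. \<forall>x \<in> lists {..<s}. length ((fs ! l) x) \<le> poly q (length x)) \<and>
    (\<forall>x \<in> lists {..<s}. set ((fs ! l) x) \<subseteq> {..<S})"
proof (cases "l = 0")
  case True
  then have "(fs ! l) = id" using assms by (auto simp: pipeline_def hd_conv_nth)
  then show ?thesis using assms(3) by (auto intro!: exI[of _ "[:0, 1:]"])
next
  case False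
  then have "emittable s S fs l {..<l} (fs ! l)" using assms by (simp add: pipeline_def)
  then show ?thesis unfolding emittable_def by blast
qed

lemma exec_pipeline:
  assumes "pipeline s S fs" "m < length fs"
  shows "\<exists>c (p :: nat poly). well_formed S (Suc m) c \<and> (\<forall>x \<in> lists {..<s}. \<forall>T.
     T 0 = rewound x \<and> (\<forall>l. 0 < l \<longrightarrow> T l = filled []) \<longrightarrow>
     (\<exists>n \<le> poly p (length x). exec c T n (\<lambda>l. if l \<le> m then rewound ((fs ! l) x) else T l)))"
  using assms(2)
proof (induction m)
  case 0
  have "exec (Emit 0 0 (\<lambda>_. None)) T 1 (\<lambda>l. if l \<le> 0 then rewound ((fs ! l) x) else T l)"
    if "T 0 = rewound x" for T x
  proof -
    have "(\<lambda>l. if l \<le> 0 then rewound ((fs ! l) x) else T l) = T"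
      using that assms(1) by (auto simp: fun_eq_iff pipeline_def hd_conv_nth)
    then show ?thesis using exec.Emit[of 0 0 "\<lambda>_. None" T] by simp
  qed
  then show ?case
    by (intro exI[of _ "Emit 0 0 (\<lambda>_. None)"] exI[of _ "[:1:]"]) auto
next
  case (Suc m)
  then obtain c p where 1: "well_formed S (Suc m) c"
    "\<And>x T. x \<in> lists {..<s} \<Longrightarrow> T 0 = rewound x \<Longrightarrow> \<forall>l. 0 < l \<longrightarrow> T l = filled [] \<Longrightarrow>
     (\<exists>n \<le> poly p (length x). exec c T n (\<lambda>l. if l \<le> m then rewound ((fs ! l) x) else T l))"
    using Suc_lessD by blast
  obtain c' p' where 2: "well_formed S (Suc (Suc m)) c'"
    "\<And>x. x \<in> lists {..<s} \<Longrightarrow> length ((fs ! Suc m) x) \<le> poly p' (length x)"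
    "\<And>x T y. x \<in> lists {..<s} \<Longrightarrow> (\<forall>l\<in>{..<Suc m}. T l = rewound ((fs ! l) x)) \<Longrightarrow> T (Suc m) = filled y \<Longrightarrow>
              (\<exists>n \<le> poly p' (length x). exec c' T n (T(Suc m := filled (y @ (fs ! Suc m) x))))"
  proof -
    have "emittable s S fs (Suc m) {..<Suc m} (fs ! Suc m)"
      using assms(1) Suc.prems by (simp add: pipeline_def)
    then show ?thesis using that unfolding emittable_def by blast
  qed
  let ?c = "Seq c (Seq c' (rewind (Suc m)))"
  \<comment> \<open>The summand \<open>3 * p' + [:3:]\<close> pays for rewinding the tape that was
    just written.\<close>
  have "\<exists>n \<le> poly (p + p' + 3 * p' + [:3:]) (length x).
      exec ?c T n (\<lambda>l. if l \<le> Suc m then rewound ((fs ! l) x) else T l)"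
    if x: "x \<in> lists {..<s}" "T 0 = rewound x" "\<forall>l. 0 < l \<longrightarrow> T l = filled []" for x T
  proof -
    let ?T1 = "\<lambda>l. if l \<le> m then rewound ((fs ! l) x) else T l"
    let ?w = "(fs ! Suc m) x"
    obtain n where n: "n \<le> poly p (length x)" "exec c T n ?T1" using 1(2) x by blast
    obtain n' where n': "n' \<le> poly p' (length x)" "exec c' ?T1 n' (?T1(Suc m := filled ([] @ ?w)))"
      using 2(3)[OF x(1), of ?T1 "[]"] x(3) by auto
    have "exec (rewind (Suc m)) (?T1(Suc m := filled ([] @ ?w))) (3 * length ?w + 3)
        (?T1(Suc m := filled ([] @ ?w), Suc m := rewound ?w))"
      by (rule exec_rewind) (auto simp: filled_def)
    also have "?T1(Suc m := filled ([] @ ?w), Suc m := rewound ?w) =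
        (\<lambda>l. if l \<le> Suc m then rewound ((fs ! l) x) else T l)"
      by (auto simp: fun_eq_iff le_Suc_eq)
    finally have "exec ?c T (n + (n' + (3 * length ?w + 3))) (\<lambda>l. if l \<le> Suc m then rewound ((fs ! l) x) else T l)"
      using exec.Seq n(2) n'(2) by blast
    moreover have "n + (n' + (3 * length ?w + 3)) \<le> poly (p + p' + 3 * p' + [:3:]) (length x)"
      using n(1) n'(1) 2(2)[OF x(1)] by simp
    ultimately show ?thesis by blast
  qed
  moreover have "well_formed S (Suc (Suc m)) ?c"
    using 1(1) 2(1) by (auto simp: rewind_def intro: well_formed_mono)
  ultimately show ?case by blast
qed

theorem pipeline_computable:
  assumes "pipeline s S fs" "s \<le> S"
  shows "polytime_computable s (last fs)"
proof -
  define m where "m = length fs - 1"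
  have m: "m < length fs" "Suc m = length fs" using assms(1) by (auto simp: pipeline_def m_def)
  obtain c p where c: "well_formed S (Suc m) c"
    "\<And>x T. x \<in> lists {..<s} \<Longrightarrow> T 0 = rewound x \<Longrightarrow> \<forall>l. 0 < l \<longrightarrow> T l = filled [] \<Longrightarrow>
     (\<exists>n \<le> poly p (length x). exec c T n (\<lambda>l. if l \<le> m then rewound ((fs ! l) x) else T l))"
    using exec_pipeline[OF assms(1) m(1)] by blast
  let ?P = "compile 0 c"
  let ?d = "code_transitions S (Suc m) ?P"
  have "\<exists>n \<le> poly p (length x). \<exists>cf. (tm_step ?d ^^ n) (tm_init (Suc m) x) cf \<and> tm_halted ?d cf \<and>
           fst (last (snd cf)) = string_cells (last fs x)" if x: "x \<in> lists {..<s}" for x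
  proof -
    define T where "T = (\<lambda>l::nat. if l = 0 then rewound x else filled [])"
    define T' where "T' = (\<lambda>l. if l \<le> m then rewound ((fs ! l) x) else T l)"
    obtain n where n: "n \<le> poly p (length x)" "exec c T n T'"
      using c(2)[OF x, of T] unfolding T'_def T_def by auto
    have empty: "filled [] = (\<lambda>_. None, 0)" by (auto simp: filled_def string_cells_def)
    have "map T [0..<Suc m] = (string_cells x, 0) # replicate m (\<lambda>_. None, 0)"
      by (rule nth_equalityI) (auto simp: T_def rewound_def empty nth_Cons' simp del: upt_Suc)
    then have init: "tm_init (Suc m) x = (0, map T [0..<Suc m])"
      by (simp add: tm_init_def)
    have "x ! nat i < S" if "0 \<le> i" "i < int (length x)" for i
      using x assms(2) that nth_mem[of "nat i" x] by fastforce
    then have "\<forall>l<Suc m. tape_ok S (T l)"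
      by (auto simp: T_def tape_ok_def symbols_def rewound_def empty string_cells_def)
    moreover have "code_at ?P 0 ?P" by (auto simp: code_at_def)
    ultimately have run: "(tm_step ?d ^^ n) (tm_init (Suc m) x) (code_size c, map T' [0..<Suc m])"
      using exec_compile[OF n(2) c(1)] init by fastforce
    moreover have "tm_halted ?d (code_size c, map T' [0..<Suc m])"
      by (auto simp: tm_halted_def tm_step_def code_transitions_def)
    moreover have "fst (last (map T' [0..<Suc m])) = string_cells (last fs x)"
    proof -
      have "fs \<noteq> []" using m(1) by auto
      then have "last fs = fs ! m" by (simp add: last_conv_nth m_def)
      then show ?thesis by (simp add: T'_def rewound_def)
    qed
    ultimately show ?thesis
      using n(1) by (intro exI[of _ n] exI[of _ "(code_size c, map T' [0..<Suc m])"] conjI)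
        (simp_all only: snd_conv)
  qed
  note run = this
  show ?thesis
    unfolding polytime_computable_def
  proof (rule exI[of _ "Suc m"], rule exI[of _ ?d], rule exI[of _ p], intro conjI ballI)
    show "turing_machine (Suc m) ?d" "single_valued ?d"
      by (rule turing_machine_code[OF c(1)], simp)+
  qed (rule run)
qed

section \<open>Spherical equations in the base group as tilings\<close>

text \<open>By commutativity the product of the cyclic group of one generator and the group
  generated by the others is a subgroup; it contains all generators and is finite as a product of
  two finite sets.\<close>

lemma (in comm_group) finite_generate:
  assumes "finite S" "S \<subseteq> carrier G" "\<And>s. s \<in> S \<Longrightarrow> ord s \<noteq> 0"
  shows "finite (generate G S)"
  using assms
proof (induction S rule: finite_induct)
  case empty
  then show ?case by (simp add: generate_empty)
next
  case (insert s S)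
  have fin: "finite (generate G {s})"
    using generate_pow_card[of s] insert.prems by (metis card.infinite insertI1 insert_subset)
  have sub: "subgroup (generate G {s}) G" "subgroup (generate G S) G"
    using insert.prems by (auto intro!: generate_is_subgroup)
  have "insert s S \<subseteq> generate G {s} <#> generate G S"
  proof
    fix x assume x: "x \<in> insert s S"
    show "x \<in> generate G {s} <#> generate G S"
    proof (cases "x = s")
      case True
      then have "x = s \<otimes> \<one>" using insert.prems by simp
      then show ?thesis
        unfolding set_mult_def by (blast intro: generate.incl generate.one)
    next
      case False
      then have "x \<in> generate G S" "x = \<one> \<otimes> x"
        using insert.prems x by (auto intro: generate.incl)
      then show ?thesis
        unfolding set_mult_def by (blast intro: generate.one)
    qed
  qed
  then have "generate G (insert s S) \<subseteq> generate G {s} <#> generate G S"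
    using mult_subgroups[OF sub] by (rule generate_subgroup_incl)
  moreover have "finite (generate G {s} <#> generate G S)"
    using fin insert.IH insert.prems by (auto simp: set_mult_def)
  ultimately show ?case by (rule finite_subset)
qed

lemma (in comm_group) infinite_order_generator:
  assumes "set gs \<subseteq> carrier G" "generate G (set gs) = carrier G" "infinite (carrier G)"
  obtains i where "i < length gs" "inj (\<lambda>n::int. gs ! i [^] n)"
proof -
  obtain t where t: "t \<in> set gs" "ord t = 0"
    using finite_generate[of "set gs"] assms by auto
  then have "inj (\<lambda>n::int. t [^] n)"
    using assms(1) int_pow_eq[of t] by (auto intro!: injI)
  then show ?thesis using t(1) that by (auto simp: in_set_conv_nth)
qed

lemma (in group) nontrivial_generator:
  assumes "generate G (set gs) = carrier G" "carrier G \<noteq> {\<one>}"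
  obtains i where "i < length gs" "gs ! i \<noteq> \<one>"
proof -
  have "\<not> set gs \<subseteq> {\<one>}"
    using generate_subgroup_incl[of "set gs" "{\<one>}"] triv_subgroup assms by blast
  then obtain x where "x \<in> set gs" "x \<noteq> \<one>" by blast
  then show ?thesis using that by (metis in_set_conv_nth)
qed

text \<open>If two pieces shared a point, deleting it from one of them would leave a cover of
  \<open>T\<close> whose sizes add up to less than \<open>card T\<close>.\<close>

lemma cover_exact:
  fixes Q :: "nat \<Rightarrow> 'c set"
  assumes "finite T" "\<And>j. j < n \<Longrightarrow> finite (Q j)" "T \<subseteq> (\<Union>j<n. Q j)" "(\<Sum>j<n. card (Q j)) = card T"
  shows "T = (\<Union>j<n. Q j)" and "\<And>i j. i < n \<Longrightarrow> j < n \<Longrightarrow> i \<noteq> j \<Longrightarrow> Q i \<inter> Q j = {}"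
proof -
  have fin: "finite (\<Union>j<n. Q j)" using assms(2) by auto
  have le: "card (\<Union>j<n. Q j) \<le> (\<Sum>j<n. card (Q j))" by (rule card_UN_le) simp
  show "T = (\<Union>j<n. Q j)"
    by (rule card_seteq[OF fin assms(3)]) (use le assms(4) in simp)
  fix i j assume ij: "i < n" "j < n" "i \<noteq> j"
  show "Q i \<inter> Q j = {}"
  proof (rule ccontr)
    assume "Q i \<inter> Q j \<noteq> {}"
    then obtain x where x: "x \<in> Q i" "x \<in> Q j" by blast
    define Q' where "Q' = Q(i := Q i - {x})"
    have "T \<subseteq> (\<Union>j<n. Q' j)"
    proof
      fix y assume "y \<in> T"
      then obtain k where "k < n" "y \<in> Q k" using assms(3) by blast
      then have "y \<in> Q' (if y = x then j else k)"
        using x ij by (auto simp: Q'_def)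
      then show "y \<in> (\<Union>j<n. Q' j)" using \<open>k < n\<close> ij by (auto split: if_splits)
    qed
    moreover have "finite (\<Union>j<n. Q' j)" using assms(2) by (auto simp: Q'_def)
    ultimately have "card T \<le> card (\<Union>j<n. Q' j)" by (rule card_mono[rotated])
    also have "\<dots> \<le> (\<Sum>j<n. card (Q' j))" by (rule card_UN_le) simp
    also have "\<dots> < (\<Sum>j<n. card (Q j))"
    proof (rule sum_strict_mono_ex1)
      show "\<forall>k\<in>{..<n}. card (Q' k) \<le> card (Q k)"
        using assms(2) by (auto simp: Q'_def card_Diff_subset intro: card_mono)
      have "card (Q' i) < card (Q i)"
        using card_Diff1_less[of "Q i" x] x(1) ij assms(2)[of i] by (simp add: Q'_def)
      then show "\<exists>a\<in>{..<n}. card (Q' a) < card (Q a)" using ij(1) by blast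
    qed simp
    finally show False using assms(4) by simp
  qed
qed

definition shifted :: "nat set \<Rightarrow> int \<Rightarrow> int set" where
  "shifted P d = (\<lambda>p. int p + d) ` P"

lemma card_shifted: "card (shifted P d) = card P"
  unfolding shifted_def by (rule card_image) (auto intro!: inj_onI)

text \<open>Only covering is demanded, which is what a nonvanishing value yields at each target
  cell. Once the sizes add up, \<open>cover_exact\<close> turns the cover into an exact tiling.
  Shifts are integers because a tile may have to move to the left.\<close>

definition tileable :: "nat set \<Rightarrow> nat set list \<Rightarrow> bool" where
  "tileable T Ps \<longleftrightarrow>
     (\<exists>ds. length ds = length Ps \<and> int ` T \<subseteq> (\<Union>j<length Ps. shifted (Ps ! j) (ds ! j)))"

definition tile_fun :: "('a, 'm) monoid_scheme \<Rightarrow> ('b, 'n) monoid_scheme \<Rightarrow> 'b \<Rightarrow> 'a \<Rightarrow> nat set \<Rightarrow> 'b \<Rightarrow> 'a" where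
  "tile_fun A B t c P = (\<lambda>x\<in>carrier B. if \<exists>i\<in>P. x = t [^]\<^bsub>B\<^esub> i then c else \<one>\<^bsub>A\<^esub>)"

section \<open>Conjugation of elements of the base group\<close>

locale wreath_pair = A: comm_group A + B: comm_group B
  for A :: "('a, 'm) monoid_scheme" and B :: "('b, 'n) monoid_scheme"
begin

abbreviation "W \<equiv> wreath A B"

sublocale W: group W
  by (rule group_wreath[OF A.comm_group_axioms B.comm_group_axioms])

lemma carrier_W: "(d, f) \<in> carrier W \<longleftrightarrow> d \<in> carrier B \<and> f \<in> fin_supp_funs A B"
  by (simp add: wreath_def)

lemma mult_W: "(d1, f1) \<otimes>\<^bsub>W\<^esub> (d2, f2) =
    (d1 \<otimes>\<^bsub>B\<^esub> d2, \<lambda>x\<in>carrier B. f1 (d2 \<otimes>\<^bsub>B\<^esub> x) \<otimes>\<^bsub>A\<^esub> f2 x)"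
  by (simp add: wreath_def)

lemma one_W: "\<one>\<^bsub>W\<^esub> = (\<one>\<^bsub>B\<^esub>, \<lambda>x\<in>carrier B. \<one>\<^bsub>A\<^esub>)"
  by (simp add: wreath_def)

lemma fin_supp_closed: "f \<in> fin_supp_funs A B \<Longrightarrow> x \<in> carrier B \<Longrightarrow> f x \<in> carrier A"
  by (auto simp: fin_supp_funs_def)

lemma translate_fin_supp:
  assumes "f \<in> fin_supp_funs A B" "d \<in> carrier B"
  shows "(\<lambda>x\<in>carrier B. f (d \<otimes>\<^bsub>B\<^esub> x)) \<in> fin_supp_funs A B"
proof -
  have "finite {x \<in> carrier B. f (d \<otimes>\<^bsub>B\<^esub> x) \<noteq> \<one>\<^bsub>A\<^esub>}"
    using assms by (intro finite_supp_translate) (auto simp: fin_supp_funs_def)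
  then have "finite {x \<in> carrier B. (\<lambda>x\<in>carrier B. f (d \<otimes>\<^bsub>B\<^esub> x)) x \<noteq> \<one>\<^bsub>A\<^esub>}"
    by (simp cong: conj_cong)
  then show ?thesis
    using assms(2) fin_supp_closed[OF assms(1)] by (auto simp: fin_supp_funs_def)
qed

text \<open>The function part \<open>g\<close> of the conjugator cancels since \<open>A\<close> is
  commutative; only the translation by \<open>d\<close> remains.\<close>

lemma conj_base:
  assumes "(d, g) \<in> carrier W" "f \<in> fin_supp_funs A B"
  shows "inv\<^bsub>W\<^esub> (d, g) \<otimes>\<^bsub>W\<^esub> (\<one>\<^bsub>B\<^esub>, f) \<otimes>\<^bsub>W\<^esub> (d, g) = (\<one>\<^bsub>B\<^esub>, \<lambda>x\<in>carrier B. f (d \<otimes>\<^bsub>B\<^esub> x))"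
proof -
  let ?f = "\<lambda>x\<in>carrier B. f (d \<otimes>\<^bsub>B\<^esub> x)"
  have c: "(\<one>\<^bsub>B\<^esub>, f) \<in> carrier W" "(\<one>\<^bsub>B\<^esub>, ?f) \<in> carrier W"
    using assms translate_fin_supp by (auto simp: carrier_W)
  have "(\<one>\<^bsub>B\<^esub>, f) \<otimes>\<^bsub>W\<^esub> (d, g) = (d, g) \<otimes>\<^bsub>W\<^esub> (\<one>\<^bsub>B\<^esub>, ?f)"
    using assms by (auto simp: mult_W carrier_W fun_eq_iff restrict_def fin_supp_closed A.m_comm)
  then show ?thesis
    using c assms(1) by (metis W.inv_closed W.inv_solve_left W.m_assoc W.m_closed)
qed

lemma list_prod_base:
  assumes "set fs \<subseteq> fin_supp_funs A B"
  shows "list_prod W (map (\<lambda>f. (\<one>\<^bsub>B\<^esub>, f)) fs) =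
    (\<one>\<^bsub>B\<^esub>, \<lambda>x\<in>carrier B. list_prod A (map (\<lambda>f. f x) fs))"
  using assms
proof (induction fs)
  case (Cons f fs)
  then show ?case by (auto simp: list_prod_def mult_W fun_eq_iff restrict_def)
qed (simp add: list_prod_def one_W)

lemma solvable_base_iff:
  assumes "set fs \<subseteq> fin_supp_funs A B"
  shows "spherical_solvable W (map (\<lambda>f. (\<one>\<^bsub>B\<^esub>, f)) fs) \<longleftrightarrow>
    (\<exists>ds. length ds = length fs \<and> set ds \<subseteq> carrier B \<and>
      (\<forall>x\<in>carrier B. list_prod A (map2 (\<lambda>d f. f (d \<otimes>\<^bsub>B\<^esub> x)) ds fs) = \<one>\<^bsub>A\<^esub>))"
    (is "_ \<longleftrightarrow> ?rhs")
proof -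
  let ?tr = "\<lambda>d f. \<lambda>x\<in>carrier B. f (d \<otimes>\<^bsub>B\<^esub> x)"
  have prod: "list_prod W (map2 (\<lambda>z c. inv\<^bsub>W\<^esub> z \<otimes>\<^bsub>W\<^esub> c \<otimes>\<^bsub>W\<^esub> z) zs (map (\<lambda>f. (\<one>\<^bsub>B\<^esub>, f)) fs))
      = (\<one>\<^bsub>B\<^esub>, \<lambda>x\<in>carrier B. list_prod A (map2 (\<lambda>d f. f (d \<otimes>\<^bsub>B\<^esub> x)) (map fst zs) fs))"
    if zs: "length zs = length fs" "set zs \<subseteq> carrier W" for zs
  proof -
    have "map2 (\<lambda>z c. inv\<^bsub>W\<^esub> z \<otimes>\<^bsub>W\<^esub> c \<otimes>\<^bsub>W\<^esub> z) zs (map (\<lambda>f. (\<one>\<^bsub>B\<^esub>, f)) fs)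
        = map (\<lambda>f. (\<one>\<^bsub>B\<^esub>, f)) (map2 (\<lambda>z f. ?tr (fst z) f) zs fs)"
    proof (rule nth_equalityI)
      fix i assume "i < length (map2 (\<lambda>z c. inv\<^bsub>W\<^esub> z \<otimes>\<^bsub>W\<^esub> c \<otimes>\<^bsub>W\<^esub> z) zs (map (\<lambda>f. (\<one>\<^bsub>B\<^esub>, f)) fs))"
      then have i: "i < length zs" "i < length fs" by auto
      then have "zs ! i \<in> carrier W" "fs ! i \<in> fin_supp_funs A B"
        using zs(2) assms nth_mem by blast+
      then show "map2 (\<lambda>z c. inv\<^bsub>W\<^esub> z \<otimes>\<^bsub>W\<^esub> c \<otimes>\<^bsub>W\<^esub> z) zs (map (\<lambda>f. (\<one>\<^bsub>B\<^esub>, f)) fs) ! i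
          = map (\<lambda>f. (\<one>\<^bsub>B\<^esub>, f)) (map2 (\<lambda>z f. ?tr (fst z) f) zs fs) ! i"
        using i conj_base[of "fst (zs ! i)" "snd (zs ! i)" "fs ! i"] by simp
    qed simp
    moreover have "set (map2 (\<lambda>z f. ?tr (fst z) f) zs fs) \<subseteq> fin_supp_funs A B"
    proof
      fix h assume "h \<in> set (map2 (\<lambda>z f. ?tr (fst z) f) zs fs)"
      then obtain z f where h: "h = ?tr (fst z) f" "(z, f) \<in> set (zip zs fs)" by auto
      then have "z \<in> carrier W" "f \<in> fin_supp_funs A B"
        using zs(2) assms by (meson set_zip_leftD set_zip_rightD subsetD)+
      then show "h \<in> fin_supp_funs A B"
        using translate_fin_supp[of f "fst z"] h(1) carrier_W[of "fst z" "snd z"] by simp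
    qed
    ultimately have "list_prod W (map2 (\<lambda>z c. inv\<^bsub>W\<^esub> z \<otimes>\<^bsub>W\<^esub> c \<otimes>\<^bsub>W\<^esub> z) zs (map (\<lambda>f. (\<one>\<^bsub>B\<^esub>, f)) fs))
        = (\<one>\<^bsub>B\<^esub>, \<lambda>x\<in>carrier B. list_prod A (map (\<lambda>f. f x) (map2 (\<lambda>z f. ?tr (fst z) f) zs fs)))"
      using list_prod_base by (simp only:)
    also have "(\<lambda>x\<in>carrier B. list_prod A (map (\<lambda>f. f x) (map2 (\<lambda>z f. ?tr (fst z) f) zs fs)))
        = (\<lambda>x\<in>carrier B. list_prod A (map2 (\<lambda>d f. f (d \<otimes>\<^bsub>B\<^esub> x)) (map fst zs) fs))"
    proof (rule restrict_ext)
      fix x assume "x \<in> carrier B"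
      then have "map (\<lambda>f. f x) (map2 (\<lambda>z f. ?tr (fst z) f) zs fs)
        = map2 (\<lambda>d f. f (d \<otimes>\<^bsub>B\<^esub> x)) (map fst zs) fs"
        using zs(1) by (intro nth_equalityI) auto
      then show "list_prod A (map (\<lambda>f. f x) (map2 (\<lambda>z f. ?tr (fst z) f) zs fs))
        = list_prod A (map2 (\<lambda>d f. f (d \<otimes>\<^bsub>B\<^esub> x)) (map fst zs) fs)"
        by (simp only:)
    qed
    finally show ?thesis .
  qed
  show ?thesis
  proof
    assume "spherical_solvable W (map (\<lambda>f. (\<one>\<^bsub>B\<^esub>, f)) fs)"
    then obtain zs where zs: "length zs = length fs" "set zs \<subseteq> carrier W"
      "list_prod W (map2 (\<lambda>z c. inv\<^bsub>W\<^esub> z \<otimes>\<^bsub>W\<^esub> c \<otimes>\<^bsub>W\<^esub> z) zs (map (\<lambda>f. (\<one>\<^bsub>B\<^esub>, f)) fs)) = \<one>\<^bsub>W\<^esub>"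
      by (auto simp: spherical_solvable_def)
    from zs(3) have "\<forall>x\<in>carrier B. list_prod A (map2 (\<lambda>d f. f (d \<otimes>\<^bsub>B\<^esub> x)) (map fst zs) fs) = \<one>\<^bsub>A\<^esub>"
      unfolding prod[OF zs(1,2)] one_W prod.inject by (metis (no_types, lifting) restrict_apply')
    moreover have "fst ` carrier W = carrier B"
      using W.one_closed by (force simp: wreath_def one_W)
    then have "set (map fst zs) \<subseteq> carrier B" using zs(2) by auto
    ultimately show ?rhs
      using zs(1) by (intro exI[of _ "map fst zs"]) simp
  next
    assume ?rhs
    then obtain ds where ds: "length ds = length fs" "set ds \<subseteq> carrier B"
      "\<And>x. x \<in> carrier B \<Longrightarrow> list_prod A (map2 (\<lambda>d f. f (d \<otimes>\<^bsub>B\<^esub> x)) ds fs) = \<one>\<^bsub>A\<^esub>"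
      by blast
    \<comment> \<open>Any function part would do for the conjugators, so the trivial one is
      taken.\<close>
    define zs where "zs = map (\<lambda>d. (d, snd \<one>\<^bsub>W\<^esub>)) ds"
    have zs: "length zs = length fs" "set zs \<subseteq> carrier W" "map fst zs = ds"
      using ds(1,2) W.one_closed by (auto simp: zs_def carrier_W one_W comp_def)
    have "list_prod W (map2 (\<lambda>z c. inv\<^bsub>W\<^esub> z \<otimes>\<^bsub>W\<^esub> c \<otimes>\<^bsub>W\<^esub> z) zs (map (\<lambda>f. (\<one>\<^bsub>B\<^esub>, f)) fs)) = \<one>\<^bsub>W\<^esub>"
      unfolding prod[OF zs(1,2)] one_W zs(3) by (auto intro!: restrict_ext ds(3))
    then show "spherical_solvable W (map (\<lambda>f. (\<one>\<^bsub>B\<^esub>, f)) fs)"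
      using zs(1,2) by (auto simp: spherical_solvable_def)
  qed
qed

lemma tile_fun_fin_supp:
  assumes "finite P" "t \<in> carrier B" "c \<in> carrier A"
  shows "tile_fun A B t c P \<in> fin_supp_funs A B"
proof -
  have "{x \<in> carrier B. tile_fun A B t c P x \<noteq> \<one>\<^bsub>A\<^esub>} \<subseteq> (\<lambda>i. t [^]\<^bsub>B\<^esub> i) ` P"
    by (auto simp: tile_fun_def split: if_splits)
  then have "finite {x \<in> carrier B. tile_fun A B t c P x \<noteq> \<one>\<^bsub>A\<^esub>}"
    using assms(1) finite_surj by blast
  then show ?thesis using assms by (auto simp: fin_supp_funs_def tile_fun_def)
qed

lemma list_prod_one: "set ys \<subseteq> {\<one>\<^bsub>A\<^esub>} \<Longrightarrow> list_prod A ys = \<one>\<^bsub>A\<^esub>"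
  by (induction ys) (auto simp: list_prod_def)

lemma list_prod_single:
  assumes "j < length ys" "ys ! j = c" "c \<in> carrier A" "\<And>i. i < length ys \<Longrightarrow> i \<noteq> j \<Longrightarrow> ys ! i = \<one>\<^bsub>A\<^esub>"
  shows "list_prod A ys = c"
  using assms
proof (induction ys arbitrary: j)
  case (Cons y ys)
  show ?case
  proof (cases j)
    case 0
    have "list_prod A ys = \<one>\<^bsub>A\<^esub>"
    proof (rule list_prod_one, rule subsetI, rule singleton_iff[THEN iffD2])
      fix z assume "z \<in> set ys"
      then obtain i where "i < length ys" "z = ys ! i" by (auto simp: in_set_conv_nth)
      then show "z = \<one>\<^bsub>A\<^esub>" using Cons.prems(4)[of "Suc i"] 0 by simp
    qed
    then show ?thesis using Cons.prems 0 by (simp add: list_prod_def)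
  next
    case (Suc k)
    have "list_prod A ys = c"
      using Cons.prems(1-3) Cons.prems(4)[of "Suc _"] Suc by (intro Cons.IH[of k]) auto
    moreover have "y = \<one>\<^bsub>A\<^esub>" using Cons.prems(4)[of 0] Suc by simp
    ultimately show ?thesis using Cons.prems(3) by (simp add: list_prod_def)
  qed
qed simp

text \<open>From a solution, a target cell missed by every tile would keep the nontrivial value of
  the target function. Conversely, in an exact tiling each target cell receives exactly one factor
  \<open>a\<close>, which cancels the inverse of \<open>a\<close>, and no other cell receives
  any.\<close>

theorem solvable_iff_tileable:
  assumes a: "a \<in> carrier A" "a \<noteq> \<one>\<^bsub>A\<^esub>" and t: "t \<in> carrier B" "inj (\<lambda>n::int. t [^]\<^bsub>B\<^esub> n)"
    and fin: "finite T" "\<And>P. P \<in> set Ps \<Longrightarrow> finite P"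
    and size: "(\<Sum>P\<leftarrow>Ps. card P) = card T"
  shows "spherical_solvable W (map (\<lambda>f. (\<one>\<^bsub>B\<^esub>, f)) (tile_fun A B t (inv\<^bsub>A\<^esub> a) T # map (tile_fun A B t a) Ps))
    \<longleftrightarrow> tileable T Ps"
proof -
  let ?n = "length Ps"
  let ?pow = "\<lambda>n::int. t [^]\<^bsub>B\<^esub> n"
  let ?F = "tile_fun A B t (inv\<^bsub>A\<^esub> a) T"
  have supp: "set (?F # map (tile_fun A B t a) Ps) \<subseteq> fin_supp_funs A B"
    using tile_fun_fin_supp a t fin by auto
  have pow_closed: "?pow n \<in> carrier B" for n using t(1) by simp
  have pow_nat: "t [^]\<^bsub>B\<^esub> (i::nat) = ?pow (int i)" for i by (simp add: int_pow_int)
  have pow_inj: "?pow m = ?pow n \<longleftrightarrow> m = n" for m n using t(2) by (auto dest: injD)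
  have prod_Cons: "list_prod A (map2 (\<lambda>d f. f (d \<otimes>\<^bsub>B\<^esub> x)) (d # ds) (?F # map (tile_fun A B t a) Ps))
     = ?F (d \<otimes>\<^bsub>B\<^esub> x) \<otimes>\<^bsub>A\<^esub> list_prod A (map2 (\<lambda>d P. tile_fun A B t a P (d \<otimes>\<^bsub>B\<^esub> x)) ds Ps)" for d ds x
    by (simp add: list_prod_def zip_map2 comp_def case_prod_unfold)
  show ?thesis
    unfolding solvable_base_iff[OF supp]
  proof
    assume "\<exists>ds. length ds = length (?F # map (tile_fun A B t a) Ps) \<and> set ds \<subseteq> carrier B \<and>
      (\<forall>x\<in>carrier B. list_prod A (map2 (\<lambda>d f. f (d \<otimes>\<^bsub>B\<^esub> x)) ds (?F # map (tile_fun A B t a) Ps)) = \<one>\<^bsub>A\<^esub>)"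
    then obtain ds' where ds': "length ds' = Suc ?n" "set ds' \<subseteq> carrier B"
      "\<forall>x\<in>carrier B. list_prod A (map2 (\<lambda>d f. f (d \<otimes>\<^bsub>B\<^esub> x)) ds' (?F # map (tile_fun A B t a) Ps)) = \<one>\<^bsub>A\<^esub>"
      unfolding length_Cons length_map by blast
    then obtain d0 ds where dds: "ds' = d0 # ds" by (cases ds') auto
    have len: "length ds = ?n" and d: "d0 \<in> carrier B" "set ds \<subseteq> carrier B"
      and eq: "\<And>x. x \<in> carrier B \<Longrightarrow> ?F (d0 \<otimes>\<^bsub>B\<^esub> x) \<otimes>\<^bsub>A\<^esub>
         list_prod A (map2 (\<lambda>d P. tile_fun A B t a P (d \<otimes>\<^bsub>B\<^esub> x)) ds Ps) = \<one>\<^bsub>A\<^esub>"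
      using ds'(1,2) ds'(3)[unfolded dds prod_Cons] by (simp_all add: dds)
    \<comment> \<open>The displacement of a tile relative to the target, as an exponent of
      \<open>t\<close>. It must not depend on the cell considered, hence the choice. For a tile in
      another coset the chosen value is arbitrary, but such a tile is never called upon.\<close>
    define es where "es = map (\<lambda>d. SOME n. d \<otimes>\<^bsub>B\<^esub> inv\<^bsub>B\<^esub> d0 = ?pow (- n)) ds"
    have "int ` T \<subseteq> (\<Union>j<?n. shifted (Ps ! j) (es ! j))"
    proof (rule image_subsetI)
      fix i assume i: "i \<in> T"
      \<comment> \<open>The argument at which the target function, translated by \<open>d0\<close>,
        is evaluated at cell \<open>i\<close>.\<close>
      let ?x = "inv\<^bsub>B\<^esub> d0 \<otimes>\<^bsub>B\<^esub> ?pow (int i)"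
      have x: "?x \<in> carrier B" "d0 \<otimes>\<^bsub>B\<^esub> ?x = ?pow (int i)"
        using d(1) pow_closed by (auto simp: B.m_assoc[symmetric])
      have "?F (d0 \<otimes>\<^bsub>B\<^esub> ?x) = inv\<^bsub>A\<^esub> a"
        using i pow_closed unfolding x(2) by (auto simp: tile_fun_def pow_nat)
      then have "list_prod A (map2 (\<lambda>d P. tile_fun A B t a P (d \<otimes>\<^bsub>B\<^esub> ?x)) ds Ps) \<noteq> \<one>\<^bsub>A\<^esub>"
        using eq[OF x(1)] a by auto
      then obtain y where "y \<in> set (map2 (\<lambda>d P. tile_fun A B t a P (d \<otimes>\<^bsub>B\<^esub> ?x)) ds Ps)" "y \<noteq> \<one>\<^bsub>A\<^esub>"
        using list_prod_one by blast
      then obtain j where j: "j < ?n" "tile_fun A B t a (Ps ! j) (ds ! j \<otimes>\<^bsub>B\<^esub> ?x) \<noteq> \<one>\<^bsub>A\<^esub>"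
        using len by (auto simp: set_zip)
      have dj: "ds ! j \<in> carrier B" using j(1) len d(2) nth_mem by fastforce
      then have cl: "ds ! j \<otimes>\<^bsub>B\<^esub> ?x \<in> carrier B" using x(1) by simp
      obtain p where p: "p \<in> Ps ! j" "ds ! j \<otimes>\<^bsub>B\<^esub> ?x = ?pow (int p)"
        using j(2) cl by (auto simp: tile_fun_def pow_nat split: if_splits)
      have "ds ! j \<otimes>\<^bsub>B\<^esub> inv\<^bsub>B\<^esub> d0 = ds ! j \<otimes>\<^bsub>B\<^esub> ?x \<otimes>\<^bsub>B\<^esub> ?pow (- int i)"
        using dj d(1) pow_closed t(1) by (simp add: B.m_assoc B.int_pow_mult[symmetric])
      also have "\<dots> = ?pow (- (int i - int p))"
        using t(1) by (simp add: p(2) B.int_pow_mult[symmetric])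
      finally have *: "ds ! j \<otimes>\<^bsub>B\<^esub> inv\<^bsub>B\<^esub> d0 = ?pow (- (int i - int p))" .
      from someI[of "\<lambda>n. ds ! j \<otimes>\<^bsub>B\<^esub> inv\<^bsub>B\<^esub> d0 = ?pow (- n)", OF this]
      have "ds ! j \<otimes>\<^bsub>B\<^esub> inv\<^bsub>B\<^esub> d0 = ?pow (- (es ! j))"
        using j(1) len by (simp add: es_def)
      then have "es ! j = int i - int p" using * pow_inj by simp
      then have "int i \<in> shifted (Ps ! j) (es ! j)" using p(1) by (auto simp: shifted_def)
      then show "int i \<in> (\<Union>j<?n. shifted (Ps ! j) (es ! j))" using j(1) by blast
    qed
    moreover have "length es = ?n" using len by (simp add: es_def)
    ultimately show "tileable T Ps" unfolding tileable_def by blast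
  next
    assume "tileable T Ps"
    then obtain es where len: "length es = ?n" and cov: "int ` T \<subseteq> (\<Union>j<?n. shifted (Ps ! j) (es ! j))"
      unfolding tileable_def by blast
    have finP: "finite (shifted (Ps ! j) (es ! j))" if "j < ?n" for j
      using fin(2) that by (simp add: shifted_def)
    have "(\<Sum>j<?n. card (shifted (Ps ! j) (es ! j))) = card T"
      using size by (simp add: card_shifted sum_list_sum_nth atLeast0LessThan)
    also have "\<dots> = card (int ` T)" by (simp add: card_image)
    finally have cards: "(\<Sum>j<?n. card (shifted (Ps ! j) (es ! j))) = card (int ` T)" .
    note exact = cover_exact[OF _ finP cov cards]
    \<comment> \<open>Translation by \<open>d\<close> precomposes with \<open>d\<close> and so moves
      the support by the inverse of \<open>d\<close>; hence the sign.\<close>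
    let ?ds = "map (\<lambda>e. ?pow (- e)) es"
    have mem: "tile_fun A B t a (Ps ! j) (?ds ! j \<otimes>\<^bsub>B\<^esub> x) =
        (if \<exists>i\<in>shifted (Ps ! j) (es ! j). x = ?pow i then a else \<one>\<^bsub>A\<^esub>)"
      if "x \<in> carrier B" "j < ?n" for x j
    proof -
      have "?pow (- (es ! j)) \<otimes>\<^bsub>B\<^esub> x = ?pow (int p) \<longleftrightarrow> x = ?pow (int p + es ! j)" for p
      proof -
        have "?pow (- (es ! j)) \<otimes>\<^bsub>B\<^esub> x = ?pow (int p) \<longleftrightarrow> x = ?pow (es ! j) \<otimes>\<^bsub>B\<^esub> ?pow (int p)"
          using that(1) pow_closed t(1) B.inv_solve_left[of x "?pow (es ! j)" "?pow (int p)"]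
          by (metis B.int_pow_neg B.inv_solve_left)
        then show ?thesis using t(1) by (simp add: B.int_pow_mult[symmetric] add.commute)
      qed
      then show ?thesis using that len pow_closed by (auto simp: tile_fun_def shifted_def pow_nat)
    qed
    have "?F (\<one>\<^bsub>B\<^esub> \<otimes>\<^bsub>B\<^esub> x) \<otimes>\<^bsub>A\<^esub> list_prod A (map2 (\<lambda>d P. tile_fun A B t a P (d \<otimes>\<^bsub>B\<^esub> x)) ?ds Ps) = \<one>\<^bsub>A\<^esub>"
      if x: "x \<in> carrier B" for x
    proof (cases "\<exists>i\<in>int ` T. x = ?pow i")
      case True
      then obtain i where i: "i \<in> int ` T" "x = ?pow i" by blast
      then obtain j where j: "j < ?n" "i \<in> shifted (Ps ! j) (es ! j)" using cov by blast
      have "list_prod A (map2 (\<lambda>d P. tile_fun A B t a P (d \<otimes>\<^bsub>B\<^esub> x)) ?ds Ps) = a"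
      proof (rule list_prod_single[of j])
        show "map2 (\<lambda>d P. tile_fun A B t a P (d \<otimes>\<^bsub>B\<^esub> x)) ?ds Ps ! j = a"
          using j len mem[OF x j(1)] i(2) by auto
        fix k assume k: "k < length (map2 (\<lambda>d P. tile_fun A B t a P (d \<otimes>\<^bsub>B\<^esub> x)) ?ds Ps)" "k \<noteq> j"
        then have "i \<notin> shifted (Ps ! k) (es ! k)" using exact(2)[of k j] j len fin(1) by auto
        then show "map2 (\<lambda>d P. tile_fun A B t a P (d \<otimes>\<^bsub>B\<^esub> x)) ?ds Ps ! k = \<one>\<^bsub>A\<^esub>"
          using k len mem[OF x, of k] i(2) pow_inj by auto
      qed (use j len a in auto)
      moreover have "?F (\<one>\<^bsub>B\<^esub> \<otimes>\<^bsub>B\<^esub> x) = inv\<^bsub>A\<^esub> a"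
        using x i by (auto simp: tile_fun_def pow_nat)
      ultimately show ?thesis using a by simp
    next
      case False
      have "list_prod A (map2 (\<lambda>d P. tile_fun A B t a P (d \<otimes>\<^bsub>B\<^esub> x)) ?ds Ps) = \<one>\<^bsub>A\<^esub>"
      proof (rule list_prod_one, rule subsetI, rule singleton_iff[THEN iffD2])
        fix y assume "y \<in> set (map2 (\<lambda>d P. tile_fun A B t a P (d \<otimes>\<^bsub>B\<^esub> x)) ?ds Ps)"
        then obtain k where k: "k < ?n" "y = tile_fun A B t a (Ps ! k) (?ds ! k \<otimes>\<^bsub>B\<^esub> x)"
          using len by (auto simp: set_zip)
        have "\<not> (\<exists>i\<in>shifted (Ps ! k) (es ! k). x = ?pow i)"
          using False exact(1) fin(1) k(1) by blast
        then show "y = \<one>\<^bsub>A\<^esub>" using mem[OF x k(1)] k(2) by simp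
      qed
      moreover have "?F (\<one>\<^bsub>B\<^esub> \<otimes>\<^bsub>B\<^esub> x) = \<one>\<^bsub>A\<^esub>"
        using x False by (auto simp: tile_fun_def pow_nat)
      ultimately show ?thesis by simp
    qed
    then have "\<forall>x\<in>carrier B. list_prod A (map2 (\<lambda>d f. f (d \<otimes>\<^bsub>B\<^esub> x)) (\<one>\<^bsub>B\<^esub> # ?ds)
        (?F # map (tile_fun A B t a) Ps)) = \<one>\<^bsub>A\<^esub>"
      unfolding prod_Cons by blast
    moreover have "length (\<one>\<^bsub>B\<^esub> # ?ds) = length (?F # map (tile_fun A B t a) Ps)"
      "set (\<one>\<^bsub>B\<^esub> # ?ds) \<subseteq> carrier B"
      using len pow_closed by auto
    ultimately show "\<exists>ds. length ds = length (?F # map (tile_fun A B t a) Ps) \<and> set ds \<subseteq> carrier B \<and>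
      (\<forall>x\<in>carrier B. list_prod A (map2 (\<lambda>d f. f (d \<otimes>\<^bsub>B\<^esub> x)) ds (?F # map (tile_fun A B t a) Ps)) = \<one>\<^bsub>A\<^esub>)"
      by blast
  qed
qed

end

section \<open>Words that spell out tiles\<close>

definition ones :: "bool list \<Rightarrow> nat set" where
  "ones bs = {i. i < length bs \<and> bs ! i}"

lemma finite_ones [simp]: "finite (ones bs)"
  by (simp add: ones_def)

lemma ones_Nil: "ones [] = {}"
  by (simp add: ones_def)

lemma ones_Cons: "ones (b # bs) = (if b then {0} else {}) \<union> Suc ` ones bs"
proof -
  have "i \<in> ones (b # bs) \<longleftrightarrow> i \<in> (if b then {0} else {}) \<union> Suc ` ones bs" for i
    by (cases i) (auto simp: ones_def)
  then show ?thesis by blast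
qed

text \<open>A walk along the axis spanned by generator \<open>j\<close>, placing generator \<open>i\<close> (inverted if \<open>e\<close>
  holds) at the marked positions, and back.\<close>

definition tile_word :: "nat \<Rightarrow> bool \<Rightarrow> nat \<Rightarrow> bool list \<Rightarrow> word" where
  "tile_word i e j bs =
     concat (map (\<lambda>b. (if b then [(i, e)] else []) @ [(j, False)]) bs) @ replicate (length bs) (j, True)"

text \<open>Since the closing letters are all equal, one of them can be split off at the end. The
  word of the remaining bits then stands conjugated by the axis generator, which shifts its tile by
  one cell.\<close>

lemma tile_word_Cons:
  "tile_word i e j (b # bs) =
     (if b then [(i, e)] else []) @ [(j, False)] @ tile_word i e j bs @ [(j, True)]"
  by (simp add: tile_word_def replicate_append_same)

lemma tile_word_over: "i < r \<Longrightarrow> j < r \<Longrightarrow> tile_word i e j bs \<in> words_over r"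
  by (auto simp: tile_word_def words_over_def split: if_splits)

context wreath_pair
begin

lemma list_prod_append_W:
  assumes "set xs \<subseteq> carrier W" "set ys \<subseteq> carrier W"
  shows "list_prod W (xs @ ys) = list_prod W xs \<otimes>\<^bsub>W\<^esub> list_prod W ys \<and> list_prod W xs \<in> carrier W"
proof -
  have cl: "set zs \<subseteq> carrier W \<Longrightarrow> list_prod W zs \<in> carrier W" for zs
    by (induction zs) (auto simp: list_prod_def)
  show ?thesis
    using assms(1)
  proof (induction xs)
    case Nil
    then show ?case using cl[OF assms(2)] by (simp add: list_prod_def)
  next
    case (Cons x xs)
    then show ?case using cl[OF assms(2)] by (auto simp: list_prod_def W.m_assoc)
  qed
qed

lemma base_embed_closed: "c \<in> carrier A \<Longrightarrow> base_embed A B c \<in> carrier W"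
proof -
  assume c: "c \<in> carrier A"
  have "finite {x \<in> carrier B. (\<lambda>x\<in>carrier B. if x = \<one>\<^bsub>B\<^esub> then c else \<one>\<^bsub>A\<^esub>) x \<noteq> \<one>\<^bsub>A\<^esub>}"
    by (rule finite_subset[of _ "{\<one>\<^bsub>B\<^esub>}"]) (auto split: if_splits)
  then show ?thesis using c by (auto simp: base_embed_def carrier_W fin_supp_funs_def)
qed

lemma top_embed_closed: "d \<in> carrier B \<Longrightarrow> top_embed A B d \<in> carrier W"
  using W.one_closed by (simp add: top_embed_def carrier_W one_W)

lemma base_embed_inv:
  assumes "c \<in> carrier A"
  shows "inv\<^bsub>W\<^esub> base_embed A B c = base_embed A B (inv\<^bsub>A\<^esub> c)"
proof (rule W.inv_equality)
  show "base_embed A B (inv\<^bsub>A\<^esub> c) \<otimes>\<^bsub>W\<^esub> base_embed A B c = \<one>\<^bsub>W\<^esub>"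
    using assms by (auto simp: base_embed_def mult_W one_W fun_eq_iff restrict_def)
qed (use assms base_embed_closed in auto)

lemma top_embed_inv:
  assumes "d \<in> carrier B"
  shows "inv\<^bsub>W\<^esub> top_embed A B d = top_embed A B (inv\<^bsub>B\<^esub> d)"
proof (rule W.inv_equality)
  show "top_embed A B (inv\<^bsub>B\<^esub> d) \<otimes>\<^bsub>W\<^esub> top_embed A B d = \<one>\<^bsub>W\<^esub>"
    using assms by (auto simp: top_embed_def mult_W one_W fun_eq_iff restrict_def)
qed (use assms top_embed_closed in auto)

lemma top_conj:
  assumes "f \<in> fin_supp_funs A B" "d \<in> carrier B"
  shows "top_embed A B d \<otimes>\<^bsub>W\<^esub> ((\<one>\<^bsub>B\<^esub>, f) \<otimes>\<^bsub>W\<^esub> top_embed A B (inv\<^bsub>B\<^esub> d)) =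
    (\<one>\<^bsub>B\<^esub>, \<lambda>x\<in>carrier B. f (inv\<^bsub>B\<^esub> d \<otimes>\<^bsub>B\<^esub> x))"
  using assms by (auto simp: top_embed_def mult_W fun_eq_iff restrict_def fin_supp_closed)

lemma base_mult:
  assumes "f \<in> fin_supp_funs A B" "c \<in> carrier A"
  shows "base_embed A B c \<otimes>\<^bsub>W\<^esub> (\<one>\<^bsub>B\<^esub>, f) =
    (\<one>\<^bsub>B\<^esub>, \<lambda>x\<in>carrier B. if x = \<one>\<^bsub>B\<^esub> then c \<otimes>\<^bsub>A\<^esub> f x else f x)"
  using assms by (auto simp: base_embed_def mult_W fun_eq_iff restrict_def fin_supp_closed)

lemma tile_fun_Cons:
  assumes t: "t \<in> carrier B" "inj (\<lambda>n::int. t [^]\<^bsub>B\<^esub> n)" and c: "c \<in> carrier A" and fin: "finite P"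
  shows "top_embed A B t \<otimes>\<^bsub>W\<^esub> ((\<one>\<^bsub>B\<^esub>, tile_fun A B t c P) \<otimes>\<^bsub>W\<^esub> top_embed A B (inv\<^bsub>B\<^esub> t)) =
      (\<one>\<^bsub>B\<^esub>, tile_fun A B t c (Suc ` P))"
    and "base_embed A B c \<otimes>\<^bsub>W\<^esub> (\<one>\<^bsub>B\<^esub>, tile_fun A B t c (Suc ` P)) = (\<one>\<^bsub>B\<^esub>, tile_fun A B t c (insert 0 (Suc ` P)))"
proof -
  have *: "inv\<^bsub>B\<^esub> t \<otimes>\<^bsub>B\<^esub> x = t [^]\<^bsub>B\<^esub> i \<longleftrightarrow> x = t [^]\<^bsub>B\<^esub> Suc i" if "x \<in> carrier B" for x and i :: nat
    using that t(1) B.inv_solve_left'[of "t [^]\<^bsub>B\<^esub> i" t x] by (auto simp: B.m_comm)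
  show "top_embed A B t \<otimes>\<^bsub>W\<^esub> ((\<one>\<^bsub>B\<^esub>, tile_fun A B t c P) \<otimes>\<^bsub>W\<^esub> top_embed A B (inv\<^bsub>B\<^esub> t)) =
      (\<one>\<^bsub>B\<^esub>, tile_fun A B t c (Suc ` P))"
    unfolding top_conj[OF tile_fun_fin_supp[OF fin t(1) c] t(1)]
    using * t(1) by (auto simp: tile_fun_def fun_eq_iff restrict_def simp del: nat_pow_Suc)
  \<comment> \<open>Cell \<open>0\<close> is not yet occupied after the shift, so the new letter
    contributes \<open>c\<close> there and not a multiple of it.\<close>
  have "\<one>\<^bsub>B\<^esub> \<noteq> t [^]\<^bsub>B\<^esub> Suc i" for i
  proof
    assume "\<one>\<^bsub>B\<^esub> = t [^]\<^bsub>B\<^esub> Suc i"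
    then have "t [^]\<^bsub>B\<^esub> (0::int) = t [^]\<^bsub>B\<^esub> int (Suc i)" by (simp only: int_pow_int int_pow_0)
    from injD[OF t(2) this] show False by simp
  qed
  then show "base_embed A B c \<otimes>\<^bsub>W\<^esub> (\<one>\<^bsub>B\<^esub>, tile_fun A B t c (Suc ` P)) = (\<one>\<^bsub>B\<^esub>, tile_fun A B t c (insert 0 (Suc ` P)))"
    unfolding base_mult[OF tile_fun_fin_supp[OF finite_imageI[OF fin] t(1) c] c]
    using c by (auto simp: tile_fun_def fun_eq_iff restrict_def simp del: nat_pow_Suc)
qed

lemma word_value_tile_word:
  assumes gens: "set gA \<subseteq> carrier A" "set gB \<subseteq> carrier B" "i < length gA" "j < length gB"
    and inj: "inj (\<lambda>n::int. (gB ! j) [^]\<^bsub>B\<^esub> n)"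
  shows "word_value W (wreath_gens A B gA gB) (tile_word i e (length gA + j) bs) =
    (\<one>\<^bsub>B\<^esub>, tile_fun A B (gB ! j) (if e then inv\<^bsub>A\<^esub> (gA ! i) else gA ! i) (ones bs))"
proof -
  let ?t = "gB ! j" let ?c = "if e then inv\<^bsub>A\<^esub> (gA ! i) else gA ! i"
  let ?lv = "letter_value W (wreath_gens A B gA gB)"
  have ac: "gA ! i \<in> carrier A" and t: "?t \<in> carrier B" using gens nth_mem by blast+
  then have c: "?c \<in> carrier A" by simp
  have lv: "?lv (i, e) = base_embed A B ?c" "?lv (length gA + j, False) = top_embed A B ?t"
    "?lv (length gA + j, True) = top_embed A B (inv\<^bsub>B\<^esub> ?t)"
    using gens ac t by (auto simp: wreath_gens_def nth_append base_embed_inv top_embed_inv)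
  have cl: "set (map ?lv (tile_word i e (length gA + j) bs)) \<subseteq> carrier W" for bs
    using lv base_embed_closed[OF c] top_embed_closed[OF t] top_embed_closed[of "inv\<^bsub>B\<^esub> ?t"] t
    by (auto simp: tile_word_def split: if_splits)
  show ?thesis
  proof (induction bs)
    case Nil
    then show ?case
      by (simp add: word_value_def tile_word_def list_prod_def one_W ones_Nil tile_fun_def restrict_def)
  next
    case (Cons b bs)
    let ?w = "tile_word i e (length gA + j) bs"
    have t': "top_embed A B (inv\<^bsub>B\<^esub> ?t) \<in> carrier W" "top_embed A B ?t \<in> carrier W"
      using top_embed_closed t by auto
    have "list_prod W (map ?lv (?w @ [(length gA + j, True)])) =
        (\<one>\<^bsub>B\<^esub>, tile_fun A B ?t ?c (ones bs)) \<otimes>\<^bsub>W\<^esub> top_embed A B (inv\<^bsub>B\<^esub> ?t)"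
      using list_prod_append_W[OF cl[of bs], of "[top_embed A B (inv\<^bsub>B\<^esub> ?t)]"] Cons.IH t' lv(3)
      by (simp add: word_value_def list_prod_def)
    then have "list_prod W (map ?lv ((length gA + j, False) # ?w @ [(length gA + j, True)])) =
        (\<one>\<^bsub>B\<^esub>, tile_fun A B ?t ?c (Suc ` ones bs))"
      using tile_fun_Cons(1)[OF t inj c finite_ones[of bs]] lv(2) by (simp add: list_prod_def)
    then show ?case
      using tile_fun_Cons(2)[OF t inj c finite_ones[of bs]] lv(1)
      by (simp add: word_value_def tile_word_Cons ones_Cons list_prod_def)
  qed
qed

theorem spherical_problem_tiles:
  assumes gens: "set gA \<subseteq> carrier A" "set gB \<subseteq> carrier B" "i < length gA" "j < length gB"
    and a: "gA ! i \<noteq> \<one>\<^bsub>A\<^esub>" and inj: "inj (\<lambda>n::int. (gB ! j) [^]\<^bsub>B\<^esub> n)"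
    and size: "(\<Sum>b\<leftarrow>bss. card (ones b)) = card (ones tb)"
  shows "encode_words (tile_word i True (length gA + j) tb # map (tile_word i False (length gA + j)) bss)
      \<in> spherical_problem W (wreath_gens A B gA gB) \<longleftrightarrow> tileable (ones tb) (map ones bss)"
proof -
  let ?gs = "wreath_gens A B gA gB"
  let ?ws = "tile_word i True (length gA + j) tb # map (tile_word i False (length gA + j)) bss"
  have len: "length ?gs = length gA + length gB" by (simp add: wreath_gens_def)
  have over: "set ?ws \<subseteq> words_over (length ?gs)"
    unfolding len using gens(3,4) by (auto intro!: tile_word_over)
  have ac: "gA ! i \<in> carrier A" and t: "gB ! j \<in> carrier B" using gens nth_mem by blast+
  have "encode_words ?ws \<in> spherical_problem W ?gs \<longleftrightarrow>
      spherical_solvable W (map (word_value W ?gs) ?ws)"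
  proof
    assume "encode_words ?ws \<in> spherical_problem W ?gs"
    then obtain ws where "encode_words ?ws = encode_words ws" "spherical_solvable W (map (word_value W ?gs) ws)"
      unfolding spherical_problem_def by blast
    then show "spherical_solvable W (map (word_value W ?gs) ?ws)"
      using injD[OF inj_encode_words] by metis
  next
    assume "spherical_solvable W (map (word_value W ?gs) ?ws)"
    then show "encode_words ?ws \<in> spherical_problem W ?gs"
      using over unfolding spherical_problem_def by blast
  qed
  also have "map (word_value W ?gs) ?ws = map (\<lambda>f. (\<one>\<^bsub>B\<^esub>, f))
      (tile_fun A B (gB ! j) (inv\<^bsub>A\<^esub> (gA ! i)) (ones tb) # map (tile_fun A B (gB ! j) (gA ! i)) (map ones bss))"
    by (simp add: word_value_tile_word[OF gens inj])
  also have "spherical_solvable W \<dots> \<longleftrightarrow> tileable (ones tb) (map ones bss)"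
    by (rule solvable_iff_tileable[OF ac a t inj]) (use size in \<open>auto simp: comp_def\<close>)
  finally show ?thesis .
qed

end

section \<open>Constraint satisfaction as a tiling problem\<close>

lemma div_mod_add_small:
  fixes e i K :: nat
  assumes "e mod K + i < K"
  shows "(e + i) mod K = e mod K + i" "(e + i) div K = e div K"
proof -
  have eq: "e + i = e div K * K + (e mod K + i)" by simp
  show "(e + i) mod K = e mod K + i" by (metis assms eq mod_less mod_mult_self3)
  show "(e + i) div K = e div K" using assms
    by (subst eq) (metis Euclidean_Rings.div_eq_0_iff add.right_neutral div_mult_self3 less_nat_zero_code not_less_zero)
qed

definition block_set :: "nat \<Rightarrow> nat \<Rightarrow> (nat \<Rightarrow> nat \<Rightarrow> bool) \<Rightarrow> nat set" where
  "block_set K n Q = {i. i < n * K \<and> Q (i div K) (i mod K)}"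

lemma finite_block_set [simp]: "finite (block_set K n Q)"
  by (simp add: block_set_def)

lemma block_set_iff:
  assumes "p < K"
  shows "m * K + p \<in> block_set K n Q \<longleftrightarrow> m < n \<and> Q m p"
proof -
  have "m * K + p < n * K \<longleftrightarrow> m < n"
  proof
    assume "m < n"
    then have "Suc m * K \<le> n * K" by (intro mult_le_mono1) simp
    then show "m * K + p < n * K" using assms by simp
  next
    assume "m * K + p < n * K"
    then have "m * K < n * K" by linarith
    then show "m < n" by (rule mult_less_cancel2[THEN iffD1, THEN conjunct2])
  qed
  then show ?thesis using assms by (simp add: block_set_def)
qed

text \<open>Variables \<open>n < N\<close> with values below \<open>q\<close>, unary constraints \<open>Al n\<close> and binary constraints
  \<open>R c\<close> between variables at distance \<open>\<Delta> c\<close>, for \<open>1 \<le> c \<le> r\<close>.\<close>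

locale csp =
  fixes q r D :: nat and \<Delta> :: "nat \<Rightarrow> nat" and R :: "nat \<Rightarrow> nat \<Rightarrow> nat \<Rightarrow> bool"
    and N :: nat and Al :: "nat \<Rightarrow> nat \<Rightarrow> bool"
  assumes q_pos: "0 < q" and \<Delta>: "\<And>c. 1 \<le> c \<Longrightarrow> c \<le> r \<Longrightarrow> 1 \<le> \<Delta> c \<and> \<Delta> c \<le> D"
begin

definition satisfies :: "(nat \<Rightarrow> nat) \<Rightarrow> bool" where
  "satisfies s \<longleftrightarrow> (\<forall>n<N. s n < q \<and> Al n (s n) \<and>
     (\<forall>c. 1 \<le> c \<longrightarrow> c \<le> r \<longrightarrow> n + \<Delta> c < N \<longrightarrow> R c (s n) (s (n + \<Delta> c))))"

text \<open>A block consists of \<open>Lc\<close> run cells, an empty cell at position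
  \<open>Lc\<close>, \<open>Lp\<close> cells for constraints (\<open>q\<close> unary ones, then
  \<open>X\<close>) and an empty cell at position \<open>K - 1\<close>. A run of
  \<open>Lc = Lp + 1\<close> cells does not fit between the two empty cells. The binary constraints
  use \<open>r * q\<close> of the \<open>X\<close> cells.\<close>

definition "X = r * q + r + 1"
definition "Lp = q + X"
definition "Lc = Lp + 1"
definition "K = Lc + Lp + 2"

text \<open>Index \<open>c = 0\<close> gives the cells of the unary constraints; the indices from
  \<open>1\<close> to \<open>r\<close> give those of the binary ones.\<close>

definition px :: "nat \<Rightarrow> nat \<Rightarrow> nat" where
  "px c v = Lc + 1 + c * q + v"

text \<open>A tile consists of a run of \<open>Lc\<close> cells, longer than every other run occurring in the target,
  and of isolated cells encoding its type.  The cell \<open>px c v\<close> of the block of variable \<open>n\<close>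
  is covered by the tile at \<open>n\<close> if its type does not admit \<open>v\<close> at \<open>n - \<Delta> c\<close>, and by the tile
  at \<open>n - \<Delta> c\<close> if that has type \<open>v\<close>.\<close>

definition tile_at :: "nat \<Rightarrow> nat \<Rightarrow> nat \<Rightarrow> bool" where
  "tile_at \<tau> m p \<longleftrightarrow> m = 0 \<and> (p < Lc \<or> p = px 0 \<tau>) \<or>
     (\<exists>c v. 1 \<le> c \<and> c \<le> r \<and> v < q \<and> p = px c v \<and> (m = 0 \<and> \<not> R c v \<tau> \<or> m = \<Delta> c \<and> v = \<tau>))"

definition tile :: "nat \<Rightarrow> nat set" where
  "tile \<tau> = block_set K (Suc D) (tile_at \<tau>)"

text \<open>Behind the \<open>N\<close> blocks of the variables there is room for the unused copies of the tiles.\<close>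

definition "M = (q - 1) * N"
definition "n_blocks = N + D + Suc D * M"

text \<open>The blocks that have the run, that is, the slots. The \<open>D\<close> blocks after the
  variables and after each spare slot receive the outlying cells of the tiles. Spare slots lie
  \<open>Suc D\<close> apart, and the first one is more than \<open>D\<close> beyond the last
  variable, so no constraint distance links a spare slot to another slot.\<close>

definition core :: "nat \<Rightarrow> bool" where
  "core m \<longleftrightarrow> m < N \<or> (N + D \<le> m \<and> (m - (N + D)) mod Suc D = 0)"

definition target_at :: "nat \<Rightarrow> nat \<Rightarrow> bool" where
  "target_at m p \<longleftrightarrow> p < Lc \<and> core m \<or>
     Lc < p \<and> p \<le> Lc + q \<and> (if m < N then Al m (p - Lc - 1) else core m) \<or>
     Lc + q < p \<and> p \<le> Lc + Lp"

definition target :: "nat set" where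
  "target = block_set K n_blocks target_at"

lemma px_less: "c \<le> r \<Longrightarrow> v < q \<Longrightarrow> px c v < K"
  and px_gt: "Lc < px c v"
  and px_area: "1 \<le> c \<Longrightarrow> c \<le> r \<Longrightarrow> v < q \<Longrightarrow> Lc + q < px c v \<and> px c v \<le> Lc + Lp"
proof -
  have *: "c * q \<le> r * q" if "c \<le> r" using that by (rule mult_le_mono1)
  show "px c v < K" if "c \<le> r" "v < q" using *[OF that(1)] that(2) unfolding px_def K_def Lp_def X_def by linarith
  show "Lc < px c v" by (simp add: px_def)
  assume c: "1 \<le> c" "c \<le> r" "v < q"
  have "1 * q \<le> c * q" using c(1) by (rule mult_le_mono1)
  then show "Lc + q < px c v \<and> px c v \<le> Lc + Lp" using c *[OF c(2)] unfolding px_def Lp_def X_def by linarith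
qed

lemma px_inj: "px c v = px c' v' \<Longrightarrow> v < q \<Longrightarrow> v' < q \<Longrightarrow> c = c' \<and> v = v'"
proof -
  assume "px c v = px c' v'" and v: "v < q" "v' < q"
  then have "c * q + v = c' * q + v'" by (simp add: px_def)
  then have "(c * q + v) div q = (c' * q + v') div q" "(c * q + v) mod q = (c' * q + v') mod q" by simp_all
  then show "c = c' \<and> v = v'" using v by simp
qed

lemma core_slots: "{m. m < n_blocks \<and> core m} = {..<N} \<union> (\<lambda>g. N + D + Suc D * g) ` {..<M}"
proof (intro equalityI subsetI)
  fix m assume "m \<in> {m. m < n_blocks \<and> core m}"
  then have m: "m < n_blocks" "core m" by auto
  show "m \<in> {..<N} \<union> (\<lambda>g. N + D + Suc D * g) ` {..<M}"
  proof (cases "m < N")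
    case False
    then have ge: "N + D \<le> m" and "(m - (N + D)) mod Suc D = 0" using m(2) by (auto simp: core_def)
    then obtain g where "m - (N + D) = Suc D * g" by (metis mod_0_imp_dvd dvdE)
    then have g: "m = N + D + Suc D * g" using ge by simp
    moreover have "Suc D * g < Suc D * M" using m(1) g by (simp add: n_blocks_def)
    then have "g < M" by (rule mult_less_cancel1[THEN iffD1, THEN conjunct2])
    ultimately show ?thesis by blast
  qed simp
next
  fix m assume "m \<in> {..<N} \<union> (\<lambda>g. N + D + Suc D * g) ` {..<M}"
  then show "m \<in> {m. m < n_blocks \<and> core m}"
  proof
    assume "m \<in> (\<lambda>g. N + D + Suc D * g) ` {..<M}"
    then obtain g where g: "g < M" "m = N + D + Suc D * g" by auto
    then have "Suc D * g < Suc D * M" by (intro mult_strict_left_mono) auto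
    then show ?thesis using g(2) by (simp add: core_def n_blocks_def del: mult_Suc)
  qed (simp add: core_def n_blocks_def)
qed

text \<open>This equals the number of tiles, so an injective placement fills all slots and in
  particular gives every variable a value.\<close>

lemma card_core_slots: "card {m. m < n_blocks \<and> core m} = q * N"
proof -
  have "inj_on (\<lambda>g. N + D + Suc D * g) {..<M}" by (auto intro!: inj_onI simp del: mult_Suc)
  then have "card ((\<lambda>g. N + D + Suc D * g) ` {..<M}) = M" by (simp add: card_image del: mult_Suc)
  moreover have "{..<N} \<inter> (\<lambda>g. N + D + Suc D * g) ` {..<M} = {}" by auto
  ultimately have "card {m. m < n_blocks \<and> core m} = N + M"
    unfolding core_slots by (subst card_Un_disjoint) (auto simp del: mult_Suc)
  also have "\<dots> = q * N" unfolding M_def using q_pos by (metis Suc_diff_1 mult_Suc)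
  finally show ?thesis .
qed

text \<open>Any run of \<open>Lc\<close> cells of the target that does not start at a block meets position \<open>Lc\<close>
  or \<open>K - 1\<close> of some block, where the target has no cell.\<close>

lemma run_in_target:
  assumes "\<And>i. i < Lc \<Longrightarrow> d + int i \<in> int ` target"
  obtains m where "m < n_blocks" "core m" "d = int (m * K)"
proof -
  have Lc: "0 < Lc" by (simp add: Lc_def)
  then obtain e where e: "d = int e" using assms[of 0] by auto
  have run: "e + i \<in> target" if "i < Lc" for i
    using assms[OF that] e by (auto simp flip: of_nat_add)
  have gap: "\<not> target_at m Lc" "\<not> target_at m (K - 1)" for m
    by (auto simp: target_at_def K_def Lp_def)
  have K: "0 < K" by (simp add: K_def)
  have "e mod K = 0"
  proof (rule ccontr)
    assume nz: "e mod K \<noteq> 0"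
    define i where "i = (if e mod K \<le> Lc then Lc else K - 1) - e mod K"
    have "e mod K < K" using K by simp
    then have i: "i < Lc" "e mod K + i = (if e mod K \<le> Lc then Lc else K - 1)"
      using nz by (auto simp: i_def K_def Lc_def)
    then have "e mod K + i < K" by (auto simp: K_def)
    then have "(e + i) mod K = (if e mod K \<le> Lc then Lc else K - 1)"
      using div_mod_add_small(1) i(2) by simp
    then show False using run[OF i(1)] gap by (auto simp: target_def block_set_def split: if_splits)
  qed
  then have e': "e = e div K * K + 0" by (metis add.right_neutral div_mult_mod_eq)
  have "e \<in> target" using run[OF Lc] by simp
  then have "e div K < n_blocks" "target_at (e div K) 0"
    unfolding target_def using block_set_iff[OF K, of "e div K"] e' by metis+
  then have "core (e div K)" by (auto simp: target_at_def)
  moreover have "d = int (e div K * K)" using e e' by (metis add.right_neutral)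
  ultimately show ?thesis using that \<open>e div K < n_blocks\<close> by blast
qed

lemma shifted_tile_iff:
  "x \<in> shifted (tile \<tau>) (int (m * K)) \<longleftrightarrow>
    (\<exists>\<delta> p. \<delta> \<le> D \<and> p < K \<and> tile_at \<tau> \<delta> p \<and> x = int ((m + \<delta>) * K + p))"
proof -
  have K: "0 < K" by (simp add: K_def)
  have "i \<in> tile \<tau> \<longleftrightarrow> (\<exists>\<delta> p. \<delta> \<le> D \<and> p < K \<and> tile_at \<tau> \<delta> p \<and> i = \<delta> * K + p)" for i
  proof
    assume "i \<in> tile \<tau>"
    then have "i div K < Suc D" "tile_at \<tau> (i div K) (i mod K)"
      unfolding tile_def block_set_def using less_mult_imp_div_less by blast+
    then show "\<exists>\<delta> p. \<delta> \<le> D \<and> p < K \<and> tile_at \<tau> \<delta> p \<and> i = \<delta> * K + p"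
      using K by (metis div_mult_mod_eq less_Suc_eq_le mod_less_divisor)
  next
    assume "\<exists>\<delta> p. \<delta> \<le> D \<and> p < K \<and> tile_at \<tau> \<delta> p \<and> i = \<delta> * K + p"
    then show "i \<in> tile \<tau>" using block_set_iff by (auto simp: tile_def)
  qed
  moreover have "int (\<delta> * K + p) + int (m * K) = int ((m + \<delta>) * K + p)" for \<delta> p
    by (simp add: add_mult_distrib)
  ultimately show ?thesis
    unfolding shifted_def image_iff Bex_def by metis
qed

lemma block_position_unique:
  "m * K + p = m' * K + p' \<Longrightarrow> p < K \<Longrightarrow> p' < K \<Longrightarrow> m = m' \<and> p = p'"
proof -
  assume eq: "m * K + p = m' * K + p'" and p: "p < K" "p' < K"
  from arg_cong[OF eq, of "\<lambda>x. x div K"] arg_cong[OF eq, of "\<lambda>x. x mod K"] p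
  show "m = m' \<and> p = p'" by simp
qed

text \<open>Every type comes in \<open>N\<close> copies, enough for any assignment; index
  \<open>j\<close> is the copy of type \<open>j mod q\<close> supplied for variable
  \<open>j div q\<close>.\<close>

definition tiles :: "nat set list" where
  "tiles = map (\<lambda>j. tile (j mod q)) [0..<N * q]"

lemma satisfies_imp_packing:
  assumes s: "satisfies s"
  obtains slot where
    "\<And>j. j < N * q \<Longrightarrow> shifted (tile (j mod q)) (int (slot j * K)) \<subseteq> int ` target"
    "\<And>j k. j < N * q \<Longrightarrow> k < N * q \<Longrightarrow> j \<noteq> k \<Longrightarrow>
       shifted (tile (j mod q)) (int (slot j * K)) \<inter> shifted (tile (k mod q)) (int (slot k * K)) = {}"
proof -
  \<comment> \<open>Numbers the pairs of a variable and an unchosen type without gaps: for each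
    variable there are \<open>q - 1\<close> such types, and those above \<open>s n\<close> move down
    by one.\<close>
  define idx where "idx j = (let n = j div q; \<tau> = j mod q in n * (q - 1) + (if \<tau> < s n then \<tau> else \<tau> - 1))" for j
  \<comment> \<open>A copy of the chosen type goes to its variable, any other copy to the spare slot
    given by its number.\<close>
  define slot where "slot j = (if j mod q = s (j div q) then j div q else N + D + Suc D * idx j)" for j
  have dm: "j div q < N" "j mod q < q" if "j < N * q" for j
    using that q_pos by (simp_all add: less_mult_imp_div_less)
  have sq: "s n < q" "Al n (s n)" if "n < N" for n using s that by (auto simp: satisfies_def)
  have low: "(if \<tau> < s n then \<tau> else \<tau> - 1) < q - 1" if "\<tau> < q" "n < N" "\<tau> \<noteq> s n" for \<tau> n
    using that sq(1)[OF that(2)] by auto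
  have idx: "idx j < M" if "j < N * q" "j mod q \<noteq> s (j div q)" for j
  proof -
    have "idx j < Suc (j div q) * (q - 1)"
      using low[OF dm(2)[OF that(1)] dm(1)[OF that(1)] that(2)] by (simp add: idx_def Let_def)
    also have "\<dots> \<le> N * (q - 1)" using dm(1)[OF that(1)] by (intro mult_le_mono1) simp
    finally show ?thesis by (simp add: M_def mult.commute)
  qed
  have idx_inj: "j = k" if "j < N * q" "j mod q \<noteq> s (j div q)" "k < N * q" "k mod q \<noteq> s (k div q)" "idx j = idx k" for j k
  proof -
    let ?f = "\<lambda>j. if j mod q < s (j div q) then j mod q else j mod q - 1"
    have lt: "?f j < q - 1" "?f k < q - 1" using low dm that by simp_all
    have eq: "j div q * (q - 1) + ?f j = k div q * (q - 1) + ?f k"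
      using that(5) by (simp add: idx_def Let_def)
    from arg_cong[OF eq, of "\<lambda>x. x div (q - 1)"] lt have 1: "j div q = k div q" by simp
    with eq have "?f j = ?f k" by simp
    then have "j mod q = k mod q" using 1 that(2,4) by (auto split: if_splits)
    with 1 show "j = k" by (metis div_mult_mod_eq)
  qed
  have core: "slot j < n_blocks \<and> core (slot j)" if "j < N * q" for j
  proof -
    have "slot j \<in> {..<N} \<union> (\<lambda>g. N + D + Suc D * g) ` {..<M}"
      using idx[OF that] dm(1)[OF that] by (auto simp: slot_def simp del: mult_Suc)
    then show ?thesis unfolding core_slots[symmetric] by simp
  qed
  have board: "slot j < N \<longleftrightarrow> j mod q = s (j div q)" if "j < N * q" for j
    using dm(1)[OF that] by (auto simp: slot_def)
  have slot_inj: "j = k" if "j < N * q" "k < N * q" "slot j = slot k" for j k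
  proof (cases "slot j < N")
    case True
    then have b: "j mod q = s (j div q)" "k mod q = s (k div q)"
      using board[OF that(1)] board[OF that(2)] that(3) by simp_all
    then have "j div q = k div q" using that(3) by (simp add: slot_def)
    with b show ?thesis by (metis div_mult_mod_eq)
  next
    case False
    then have "j mod q \<noteq> s (j div q)" "k mod q \<noteq> s (k div q)"
      using board[OF that(1)] board[OF that(2)] that(3) by simp_all
    then show ?thesis using idx_inj that by (auto simp: slot_def simp del: mult_Suc)
  qed
  have room: "slot j + \<delta> < n_blocks" if j: "j < N * q" and "\<delta> \<le> D" for j \<delta>
  proof (cases "j mod q = s (j div q)")
    case True
    then show ?thesis using dm(1)[OF j] that(2) by (simp add: slot_def n_blocks_def)
  next
    case False
    have "Suc D * Suc (idx j) \<le> Suc D * M" using idx[OF j False] by (intro mult_le_mono2) simp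
    then show ?thesis using False that(2) by (simp add: slot_def n_blocks_def)
  qed
  \<comment> \<open>Two slots at a constraint distance are both variables: \<open>slot k\<close>
    cannot be spare, since \<open>slot j\<close> would then be at least \<open>N\<close>, hence
    spare as well, and the difference \<open>\<Delta> c\<close> would be a positive multiple of
    \<open>Suc D\<close> not exceeding \<open>D\<close>.\<close>
  have apart: "R c (j mod q) (k mod q)"
    if j: "j < N * q" and k: "k < N * q" and c: "1 \<le> c" "c \<le> r" and eq: "slot k = slot j + \<Delta> c" for j k c
  proof (cases "slot k < N")
    case True
    then have "slot j < N" using eq by simp
    then have "j mod q = s (slot j)" "k mod q = s (slot k)"
      using True board[OF j] board[OF k] by (auto simp: slot_def)
    then show ?thesis using s \<open>slot j < N\<close> True c eq by (auto simp: satisfies_def)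
  next
    case False
    then have ge: "N + D \<le> slot k" using board[OF k] by (auto simp: slot_def)
    then have "\<not> slot j < N" using eq \<Delta>[OF c] by auto
    then have mod: "slot j = N + D + Suc D * idx j" "slot k = N + D + Suc D * idx k"
      using False board j k by (auto simp: slot_def simp del: mult_Suc)
    then have "Suc D * idx k = Suc D * idx j + \<Delta> c" using eq by simp
    then have "(Suc D * idx j + \<Delta> c) mod Suc D = 0" by (metis mod_mult_self1_is_0)
    then have "\<Delta> c = 0" using \<Delta>[OF c] by (simp del: mult_Suc)
    then show ?thesis using \<Delta>[OF c] by simp
  qed
  show ?thesis
  proof (rule that[of slot])
    fix j assume j: "j < N * q"
    show "shifted (tile (j mod q)) (int (slot j * K)) \<subseteq> int ` target"
    proof
      fix x assume "x \<in> shifted (tile (j mod q)) (int (slot j * K))"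
      then obtain \<delta> p where d: "\<delta> \<le> D" "p < K" "tile_at (j mod q) \<delta> p" "x = int ((slot j + \<delta>) * K + p)"
        unfolding shifted_tile_iff by blast
      have "target_at (slot j + \<delta>) p"
        using d(3) unfolding tile_at_def
      proof (elim disjE conjE exE)
        assume "\<delta> = 0" "p < Lc"
        then show ?thesis using core[OF j] by (simp add: target_at_def)
      next
        assume p: "\<delta> = 0" "p = px 0 (j mod q)"
        have "Al (slot j) (j mod q)" if "slot j < N"
          using that board[OF j] sq(2) by (simp add: slot_def)
        then show ?thesis using p core[OF j] dm(2)[OF j] by (simp add: target_at_def px_def)
      qed (use px_area in \<open>auto simp: target_at_def\<close>)
      then have "(slot j + \<delta>) * K + p \<in> target"
        unfolding target_def block_set_iff[OF d(2)] using room[OF j d(1)] by simp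
      then show "x \<in> int ` target" unfolding d(4) by (rule imageI)
    qed
  next
    fix j k assume jk: "j < N * q" "k < N * q" "j \<noteq> k"
    have main: False
      if a: "tile_at (j mod q) \<delta> p" "tile_at (k mod q) \<delta>' p" "slot j + \<delta> = slot k + \<delta>'" for \<delta> \<delta>' p
    proof -
      have ne: "\<not> (\<delta> = \<delta>')" using a(3) slot_inj jk by auto
      \<comment> \<open>Runs and unary cells occur only in the own block of a tile, so a collision
        at different offsets happens in a cell of a binary constraint. There one offset is
        \<open>0\<close> and the other is \<open>\<Delta> c\<close>, and the types violate
        \<open>R c\<close>.\<close>
      have lo: "\<delta>' = 0" if "tile_at \<tau> \<delta>' p" "p < Lc + 1 + q" for \<delta>' \<tau>
        using that px_area by (fastforce simp: tile_at_def)
      have "\<not> p < Lc + 1 + q" using lo a(1,2) ne by metis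
      then have hi: "\<exists>c v. 1 \<le> c \<and> c \<le> r \<and> v < q \<and> p = px c v \<and> (\<delta>' = 0 \<and> \<not> R c v \<tau> \<or> \<delta>' = \<Delta> c \<and> v = \<tau>)"
        if "tile_at \<tau> \<delta>' p" "\<tau> < q" for \<delta>' \<tau>
        using that by (auto simp: tile_at_def px_def)
      obtain c v where c: "1 \<le> c" "c \<le> r" "v < q" "p = px c v"
        and 1: "\<delta> = 0 \<and> \<not> R c v (j mod q) \<or> \<delta> = \<Delta> c \<and> v = j mod q"
        using hi[OF a(1)] dm(2)[OF jk(1)] by blast
      have 2: "\<delta>' = 0 \<and> \<not> R c v (k mod q) \<or> \<delta>' = \<Delta> c \<and> v = k mod q"
        using hi[OF a(2)] dm(2)[OF jk(2)] c px_inj by metis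
      show False
        using 1 2 ne a(3) apart[OF jk(1,2) c(1,2)] apart[OF jk(2,1) c(1,2)] by auto
    qed
    show "shifted (tile (j mod q)) (int (slot j * K)) \<inter> shifted (tile (k mod q)) (int (slot k * K)) = {}"
    proof (rule ccontr)
      assume "\<not> ?thesis"
      then obtain x where x: "x \<in> shifted (tile (j mod q)) (int (slot j * K))"
        "x \<in> shifted (tile (k mod q)) (int (slot k * K))" by blast
      then obtain \<delta> p \<delta>' p' where d: "p < K" "tile_at (j mod q) \<delta> p" "x = int ((slot j + \<delta>) * K + p)"
        "p' < K" "tile_at (k mod q) \<delta>' p'" "x = int ((slot k + \<delta>') * K + p')"
        unfolding shifted_tile_iff by blast
      then have "(slot j + \<delta>) * K + p = (slot k + \<delta>') * K + p'" by (metis of_nat_eq_iff)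
      from block_position_unique[OF this d(1,4)] main d(2,5) show False by blast
    qed
  qed
qed

text \<open>The run forces each tile onto a slot, disjointness makes the slots different, and by
  counting every slot is taken. The value of a variable is the type of the tile in its
  block.\<close>

lemma packing_imp_satisfies:
  assumes sub: "\<And>j. j < N * q \<Longrightarrow> shifted (tile (j mod q)) (ds j) \<subseteq> int ` target"
    and disj: "\<And>j k. j < N * q \<Longrightarrow> k < N * q \<Longrightarrow> j \<noteq> k \<Longrightarrow>
       shifted (tile (j mod q)) (ds j) \<inter> shifted (tile (k mod q)) (ds k) = {}"
  shows "\<exists>s. satisfies s"
proof -
  have K: "0 < K" "Lc < K" by (simp_all add: K_def)
  have corecell: "i \<in> tile \<tau>" if "i < Lc" for i \<tau>
    using block_set_iff[of i K 0] that K(2) by (simp add: tile_def tile_at_def)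
  have "\<exists>m. m < n_blocks \<and> core m \<and> ds j = int (m * K)" if j: "j < N * q" for j
  proof -
    have "ds j + int i \<in> int ` target" if "i < Lc" for i
      using sub[OF j] corecell[OF that] by (force simp: shifted_def add.commute)
    then obtain m where "m < n_blocks" "core m" "ds j = int (m * K)" by (rule run_in_target)
    then show ?thesis by blast
  qed
  then obtain slot where slot: "\<And>j. j < N * q \<Longrightarrow> slot j < n_blocks \<and> core (slot j) \<and> ds j = int (slot j * K)"
    by metis
  have inj: "inj_on slot {..<N * q}"
  proof (rule inj_onI, rule ccontr)
    fix j k assume jk: "j \<in> {..<N * q}" "k \<in> {..<N * q}" "slot j = slot k" "j \<noteq> k"
    then have "ds j = ds k" using slot by simp
    moreover have "ds j \<in> shifted (tile (j mod q)) (ds j)" "ds k \<in> shifted (tile (k mod q)) (ds k)"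
      using corecell[of 0] by (force simp: shifted_def Lc_def)+
    ultimately show False using disj jk by fastforce
  qed
  have "slot ` {..<N * q} = {m. m < n_blocks \<and> core m}"
  proof (rule card_subset_eq)
    show "card (slot ` {..<N * q}) = card {m. m < n_blocks \<and> core m}"
      using inj by (simp add: card_core_slots card_image mult.commute)
  qed (use slot in auto)
  then have "slot ` {..<N * q} = {..<N} \<union> (\<lambda>g. N + D + Suc D * g) ` {..<M}"
    using core_slots by (rule trans)
  then have "\<exists>j. j < N * q \<and> slot j = n" if "n < N" for n
    using that by (metis UnI1 imageE lessThan_iff)
  then obtain J where J: "\<And>n. n < N \<Longrightarrow> J n < N * q \<and> slot (J n) = n" by metis
  define s where "s n = J n mod q" for n
  have placed: "ds (J n) = int (n * K)" if "n < N" for n using slot J that by metis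
  have "satisfies s"
    unfolding satisfies_def
  proof (intro allI impI conjI)
    fix n assume n: "n < N"
    show sn: "s n < q" using q_pos by (simp add: s_def)
    have p: "px 0 (s n) < K" using px_less[of 0] sn by simp
    have "int (n * K + px 0 (s n)) \<in> shifted (tile (s n)) (int (n * K))"
      unfolding shifted_tile_iff using p by (intro exI[of _ 0] exI[of _ "px 0 (s n)"]) (simp add: tile_at_def)
    then have "int (n * K + px 0 (s n)) \<in> int ` target"
      using sub[of "J n"] J[OF n] unfolding placed[OF n] s_def by blast
    then have "n * K + px 0 (s n) \<in> target" by (metis imageE of_nat_eq_iff)
    then have "target_at n (px 0 (s n))" unfolding target_def block_set_iff[OF p] by simp
    then show "Al n (s n)" using n sn by (simp add: target_at_def px_def)
    fix c assume c: "1 \<le> c" "c \<le> r" and n': "n + \<Delta> c < N"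
    show "R c (s n) (s (n + \<Delta> c))"
    proof (rule ccontr)
      assume nR: "\<not> R c (s n) (s (n + \<Delta> c))"
      have p: "px c (s n) < K" using px_less c sn by simp
      \<comment> \<open>The cell at which the two tiles collide: the earlier one announces its value
        there, and the later one occupies it because its type does not tolerate that value.\<close>
      let ?x = "int ((n + \<Delta> c) * K + px c (s n))"
      have "?x \<in> shifted (tile (s n)) (int (n * K))"
        unfolding shifted_tile_iff using p c sn \<Delta>[OF c]
        by (intro exI[of _ "\<Delta> c"] exI[of _ "px c (s n)"]) (auto simp: tile_at_def)
      moreover have "?x \<in> shifted (tile (s (n + \<Delta> c))) (int ((n + \<Delta> c) * K))"
        unfolding shifted_tile_iff using p c sn nR
        by (intro exI[of _ 0] exI[of _ "px c (s n)"]) (auto simp: tile_at_def)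
      moreover have "J n \<noteq> J (n + \<Delta> c)" using J[OF n] J[OF n'] \<Delta>[OF c] by auto
      ultimately show False
        using disj[of "J n" "J (n + \<Delta> c)"] J[OF n] J[OF n'] placed[OF n] placed[OF n'] by (auto simp: s_def)
    qed
  qed
  then show ?thesis by blast
qed

text \<open>The single cells can fill whatever the tiles leave free, and the size condition makes
  their number right; what remains is to pack the tiles disjointly into the target.\<close>

theorem satisfiable_iff_tileable:
  assumes size: "(\<Sum>P\<leftarrow>tiles. card P) + F = card target"
  shows "tileable target (tiles @ replicate F {0}) \<longleftrightarrow> (\<exists>s. satisfies s)"
proof
  let ?L = "tiles @ replicate F {0}"
  let ?n = "length ?L"
  have len: "length tiles = N * q" and nth: "\<And>j. j < N * q \<Longrightarrow> tiles ! j = tile (j mod q)"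
    by (simp_all add: tiles_def)
  have sum: "(\<Sum>j<N * q. card (tile (j mod q))) = (\<Sum>P\<leftarrow>tiles. card P)"
    by (simp add: tiles_def comp_def interv_sum_list_conv_sum_set_nat atLeast0LessThan)
  {
    assume "tileable target ?L"
    then obtain ds where ds: "length ds = ?n" "int ` target \<subseteq> (\<Union>j<?n. shifted (?L ! j) (ds ! j))"
      unfolding tileable_def by blast
    have fin: "finite (shifted (?L ! j) (ds ! j))" if "j < ?n" for j
    proof -
      have "\<forall>P\<in>set ?L. finite P" by (auto simp: tiles_def tile_def)
      then have "finite (?L ! j)" using nth_mem[OF that] by blast
      then show ?thesis by (simp add: shifted_def)
    qed
    have "(\<Sum>j<?n. card (shifted (?L ! j) (ds ! j))) = (\<Sum>P\<leftarrow>?L. card P)"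
      unfolding card_shifted sum_list_sum_nth length_map atLeast0LessThan
      by (intro sum.cong refl) (simp only: nth_map lessThan_iff)
    also have "\<dots> = card (int ` target)" using size by (simp add: card_image sum_list_replicate)
    finally have cards: "(\<Sum>j<?n. card (shifted (?L ! j) (ds ! j))) = card (int ` target)" .
    have "finite (int ` target)" by (simp add: target_def)
    note exact = cover_exact[OF this fin ds(2) cards]
    have union: "int ` target = (\<Union>j<?n. shifted (?L ! j) (ds ! j))" by (rule exact(1))
    have lt: "j < ?n" "?L ! j = tile (j mod q)" if "j < N * q" for j
      using that len nth by (simp_all add: nth_append)
    show "\<exists>s. satisfies s"
    proof (rule packing_imp_satisfies[of "\<lambda>j. ds ! j"])
      fix j assume j: "j < N * q"
      show "shifted (tile (j mod q)) (ds ! j) \<subseteq> int ` target"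
        unfolding union lt(2)[OF j, symmetric] using lt(1)[OF j] by blast
      fix k assume k: "k < N * q" "j \<noteq> k"
      show "shifted (tile (j mod q)) (ds ! j) \<inter> shifted (tile (k mod q)) (ds ! k) = {}"
        using exact(2)[OF _ lt(1)[OF j] lt(1)[OF k(1)] k(2)] unfolding lt(2)[OF j] lt(2)[OF k(1)] by blast
    qed
  next
    assume "\<exists>s. satisfies s"
    then obtain s where "satisfies s" by blast
    then obtain slot where sub: "\<And>j. j < N * q \<Longrightarrow> shifted (tile (j mod q)) (int (slot j * K)) \<subseteq> int ` target"
      and disj: "\<And>j k. j < N * q \<Longrightarrow> k < N * q \<Longrightarrow> j \<noteq> k \<Longrightarrow>
       shifted (tile (j mod q)) (int (slot j * K)) \<inter> shifted (tile (k mod q)) (int (slot k * K)) = {}"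
      by (rule satisfies_imp_packing) blast
    define U where "U = (\<Union>j<N * q. shifted (tile (j mod q)) (int (slot j * K)))"
    have fin: "finite (shifted (tile \<tau>) d)" for \<tau> d by (simp add: shifted_def tile_def)
    have "card U = (\<Sum>j<N * q. card (tile (j mod q)))"
      unfolding U_def using fin disj by (subst card_UN_disjoint) (auto simp: card_shifted)
    moreover have "U \<subseteq> int ` target" "finite (int ` target)"
      using sub by (auto simp: U_def target_def)
    ultimately have "card (int ` target - U) = F"
      using size sum by (subst card_Diff_subset) (auto simp: card_image finite_subset)
    moreover obtain xs where xs: "set xs = int ` target - U" "distinct xs"
      using finite_distinct_list[of "int ` target - U"] \<open>finite (int ` target)\<close> by auto
    ultimately have lx: "length xs = F" using distinct_card by fastforce
    define ds where "ds = map (\<lambda>j. int (slot j * K)) [0..<N * q] @ xs"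
    have "x \<in> (\<Union>j<?n. shifted (?L ! j) (ds ! j))" if x: "x \<in> int ` target" for x
    proof (cases "x \<in> U")
      case True
      then obtain j where "j < N * q" "x \<in> shifted (tile (j mod q)) (int (slot j * K))"
        by (auto simp: U_def)
      then show ?thesis using len nth by (intro UN_I[of j]) (auto simp: ds_def nth_append)
    next
      case False
      then obtain i where "i < F" "x = xs ! i" using x xs(1) lx by (metis DiffI in_set_conv_nth)
      then show ?thesis using len lx
        by (intro UN_I[of "N * q + i"]) (auto simp: ds_def nth_append shifted_def)
    qed
    then show "tileable target ?L"
      unfolding tileable_def by (intro exI[of _ ds]) (auto simp: ds_def len lx)
  }
qed

end

section \<open>Counting cells and fillers\<close>

lemma card_block_set: "card (block_set K n Q) = (\<Sum>m<n. card {p. p < K \<and> Q m p})"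
proof (cases "K = 0")
  case True
  then show ?thesis by (simp add: block_set_def)
next
  case False
  let ?S = "SIGMA m:{..<n}. {p. p < K \<and> Q m p}"
  have "bij_betw (\<lambda>(m, p). m * K + p) ?S (block_set K n Q)"
  proof (rule bij_betwI[where g = "\<lambda>i. (i div K, i mod K)"])
    show "(\<lambda>(m, p). m * K + p) \<in> ?S \<rightarrow> block_set K n Q" by (auto simp: block_set_iff)
    show "(\<lambda>i. (i div K, i mod K)) \<in> block_set K n Q \<rightarrow> ?S"
      using False by (auto simp: block_set_def less_mult_imp_div_less)
  qed auto
  then have "card (block_set K n Q) = card ?S" by (simp add: bij_betw_same_card)
  also have "\<dots> = (\<Sum>m<n. card {p. p < K \<and> Q m p})" by (rule card_SigmaI) auto
  finally show ?thesis .
qed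

context csp
begin

text \<open>The part of a tile in its own block. The other blocks hold just one mark for each of the
  \<open>r\<close> constraints.\<close>

definition own_cells :: "nat \<Rightarrow> nat set" where
  "own_cells \<tau> = {..<Lc} \<union> {px 0 \<tau>} \<union> {px c v | c v. 1 \<le> c \<and> c \<le> r \<and> v < q \<and> \<not> R c v \<tau>}"

text \<open>The surplus of \<open>r + 1\<close> cells in \<open>X\<close> ensures that no tile is larger than the cells of a slot
  without its unary part, so the subtraction does not truncate.\<close>

definition "C0 = q * Lc + q * X + (q - 1) * q - (\<Sum>\<tau><q. card (own_cells \<tau>) + r)"

text \<open>The size of the target minus that of the tiles, in a form that loops can print:
  \<open>C0\<close> is a constant of the language, and all other terms are products with
  \<open>N\<close> or \<open>D\<close> or sums over the variables.\<close>

definition "n_fillers = (\<Sum>n<N. card {v. v < q \<and> Al n v}) + N * C0 + N * ((q - 1) * X * D) + D * X"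

lemma px_pairs: "{px c v | c v. 1 \<le> c \<and> c \<le> r \<and> v < q \<and> P c v} \<subseteq> (\<lambda>(c, v). px c v) ` ({1..r} \<times> {..<q})"
  by auto

lemma finite_own_cells [simp]: "finite (own_cells \<tau>)"
  unfolding own_cells_def using finite_subset[OF px_pairs] by simp

lemma card_own_cells: "card (own_cells \<tau>) + r \<le> Lc + X"
proof -
  have "own_cells \<tau> \<subseteq> {..<Lc} \<union> {px 0 \<tau>} \<union> (\<lambda>(c, v). px c v) ` ({1..r} \<times> {..<q})"
    unfolding own_cells_def using px_pairs by (intro Un_mono) auto
  then have "card (own_cells \<tau>) \<le> card ({..<Lc} \<union> {px 0 \<tau>} \<union> (\<lambda>(c, v). px c v) ` ({1..r} \<times> {..<q}))"
    by (rule card_mono[rotated]) simp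
  also have "\<dots> \<le> card {..<Lc} + card {px 0 \<tau>} + card ((\<lambda>(c, v). px c v) ` ({1..r} \<times> {..<q}))"
    by (meson add_mono card_Un_le le_refl le_trans)
  also have "\<dots> \<le> Lc + 1 + r * q"
    using card_image_le[of "{1..r} \<times> {..<q}" "\<lambda>(c, v). px c v"] by simp
  finally show ?thesis by (simp add: X_def)
qed

text \<open>Constraint \<open>c\<close> adds the mark \<open>px c \<tau>\<close> in block
  \<open>\<Delta> c\<close>. Marks that fall into the same block are different cells by injectivity
  of \<open>px\<close>.\<close>

lemma card_tile:
  assumes "\<tau> < q"
  shows "card (tile \<tau>) = card (own_cells \<tau>) + r"
proof -
  let ?S = "\<lambda>m. {p. p < K \<and> tile_at \<tau> m p}"
  let ?E = "\<lambda>m. {c. 1 \<le> c \<and> c \<le> r \<and> \<Delta> c = m}"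
  have S: "?S m = (if m = 0 then own_cells \<tau> else (\<lambda>c. px c \<tau>) ` ?E m)" for m
  proof (cases "m = 0")
    case True
    have nz: "\<Delta> c \<noteq> 0" "0 \<noteq> \<Delta> c" if "Suc 0 \<le> c" "c \<le> r" for c using \<Delta>[of c] that by simp_all
    moreover have "p < K" if "p < Lc" for p using that by (simp add: K_def)
    ultimately show ?thesis
      using True px_less assms by (auto simp: tile_at_def own_cells_def nz)
  next
    case False
    then show ?thesis using px_less assms by (auto simp: tile_at_def)
  qed
  have inj: "inj_on (\<lambda>c. px c \<tau>) A" for A using px_inj assms by (auto intro!: inj_onI)
  have "card (tile \<tau>) = (\<Sum>m<Suc D. card (?S m))" unfolding tile_def by (rule card_block_set)
  also have "\<dots> = card (own_cells \<tau>) + (\<Sum>m<D. card (?E (Suc m)))"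
    unfolding S by (simp add: sum.lessThan_Suc_shift card_image[OF inj] del: sum.lessThan_Suc)
  also have "(\<Sum>m<D. card (?E (Suc m))) = card (\<Union>m<D. ?E (Suc m))"
    by (rule card_UN_disjoint[symmetric]) auto
  also have "(\<Union>m<D. ?E (Suc m)) = {1..r}"
  proof (intro equalityI subsetI)
    fix c assume "c \<in> {1..r}"
    then have "1 \<le> c" "c \<le> r" by auto
    then show "c \<in> (\<Union>m<D. ?E (Suc m))"
      using \<Delta>[of c] by (intro UN_I[of "\<Delta> c - 1"]) auto
  qed auto
  finally show ?thesis by simp
qed

lemma card_target_block:
  "card {p. p < K \<and> target_at m p} =
     (if m < N then Lc + card {v. v < q \<and> Al m v} else if core m then Lc + q else 0) + X"
proof -
  let ?V = "{v. v < q \<and> (if m < N then Al m v else core m)}"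
  let ?A = "if core m then {..<Lc} else {}"
  have eq: "{p. p < K \<and> target_at m p} = ?A \<union> (\<lambda>v. Lc + 1 + v) ` ?V \<union> {Lc + q + 1..Lc + Lp}"
    (is "?l = ?r")
  proof (intro equalityI subsetI)
    fix p assume p: "p \<in> ?l"
    show "p \<in> ?r"
    proof (cases "Lc < p \<and> p \<le> Lc + q")
      case True
      then have "p = Lc + 1 + (p - Lc - 1)" "p - Lc - 1 < q" by auto
      moreover have "p - Lc - 1 \<in> ?V" using p True \<open>p - Lc - 1 < q\<close>
        by (auto simp: target_at_def split: if_splits)
      ultimately show ?thesis by blast
    qed (use p in \<open>auto simp: target_at_def\<close>)
  next
    fix p assume "p \<in> ?r"
    then show "p \<in> ?l" by (auto simp: target_at_def K_def Lp_def split: if_splits)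
  qed
  have 1: "card (?A \<union> (\<lambda>v. Lc + 1 + v) ` ?V) = card ?A + card ((\<lambda>v. Lc + 1 + v) ` ?V)"
    by (rule card_Un_disjoint) auto
  have 2: "card (?A \<union> (\<lambda>v. Lc + 1 + v) ` ?V \<union> {Lc + q + 1..Lc + Lp}) =
      card (?A \<union> (\<lambda>v. Lc + 1 + v) ` ?V) + card {Lc + q + 1..Lc + Lp}"
    by (rule card_Un_disjoint) (auto split: if_splits)
  have 3: "card ((\<lambda>v. Lc + 1 + v) ` ?V) = card ?V"
    by (rule card_image) (rule inj_onI, simp only: add_left_cancel)
  have 4: "card {Lc + q + 1..Lc + Lp} = X" by (simp add: Lp_def)
  have 5: "m < N \<Longrightarrow> core m" by (simp add: core_def)
  have 6: "card ?A = (if core m then Lc else 0)" by simp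
  have 7: "card ?V = (if m < N then card {v. v < q \<and> Al m v} else if core m then q else 0)"
    by simp
  show ?thesis
    unfolding eq 1 2 3 4 6 7 using 5 by (cases "m < N"; cases "core m") simp_all
qed

theorem size_tiles: "(\<Sum>P\<leftarrow>tiles. card P) + n_fillers = card target"
proof -
  let ?al = "\<lambda>n. card {v. v < q \<and> Al n v}"
  let ?w = "\<Sum>\<tau><q. card (own_cells \<tau>) + r"
  have "(\<Sum>P\<leftarrow>tiles. card P) = (\<Sum>j<N * q. card (tile (j mod q)))"
    by (simp add: tiles_def comp_def interv_sum_list_conv_sum_set_nat atLeast0LessThan)
  also have "\<dots> = (\<Sum>j<N * q. card (own_cells (j mod q)) + r)"
    using q_pos by (intro sum.cong refl card_tile) simp
  also have "\<dots> = (\<Sum>m<N. \<Sum>j\<in>{m * q..<m * q + q}. card (own_cells (j mod q)) + r)"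
    by (rule sum.nat_group[symmetric])
  also have "\<dots> = (\<Sum>m<N. ?w)"
  proof (rule sum.cong[OF refl])
    fix m
    have "(\<Sum>j\<in>{0 + m * q..<q + m * q}. card (own_cells (j mod q)) + r) =
        (\<Sum>t\<in>{0..<q}. card (own_cells ((t + m * q) mod q)) + r)"
      by (rule sum.shift_bounds_nat_ivl)
    also have "\<dots> = ?w" unfolding atLeast0LessThan by (rule sum.cong) auto
    finally show "(\<Sum>j\<in>{m * q..<m * q + q}. card (own_cells (j mod q)) + r) = ?w"
      by (simp only: add.commute add_0_left)
  qed
  also have "\<dots> = N * ?w" by (simp only: sum_constant card_lessThan of_nat_id)
  finally have tiles: "(\<Sum>P\<leftarrow>tiles. card P) = N * ?w" .
  have "card target = (\<Sum>m<n_blocks. (if m < N then Lc + ?al m else if core m then Lc + q else 0) + X)"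
    unfolding target_def card_block_set card_target_block ..
  also have "\<dots> = (\<Sum>m<n_blocks. if m < N then Lc + ?al m else if core m then Lc + q else 0) + n_blocks * X"
    by (simp add: sum.distrib)
  also have "(\<Sum>m<n_blocks. if m < N then Lc + ?al m else if core m then Lc + q else 0) =
      (\<Sum>m\<in>{m. m < n_blocks \<and> core m}. if m < N then Lc + ?al m else Lc + q)"
    by (rule sum.mono_neutral_cong_right) (auto simp: core_def)
  also have "\<dots> = (\<Sum>m<N. Lc + ?al m) + (\<Sum>m\<in>(\<lambda>g. N + D + Suc D * g) ` {..<M}. Lc + q)"
    unfolding core_slots
    by (subst sum.union_disjoint) (auto simp del: mult_Suc sum_constant intro!: arg_cong2[where f = "(+)"] sum.cong)
  also have "(\<Sum>m\<in>(\<lambda>g. N + D + Suc D * g) ` {..<M}. Lc + q) = M * (Lc + q)"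
    by (subst sum.reindex) (auto intro!: inj_onI simp del: mult_Suc)
  finally have target: "card target = N * Lc + (\<Sum>m<N. ?al m) + M * (Lc + q) + n_blocks * X"
    by (simp add: sum.distrib)
  have "?w \<le> (\<Sum>\<tau><q. Lc + X)" by (intro sum_mono card_own_cells)
  then have "?w \<le> q * Lc + q * X + (q - 1) * q" by (simp add: distrib_left)
  then have C0: "C0 + ?w = q * Lc + q * X + (q - 1) * q"
    unfolding C0_def by (rule le_add_diff_inverse2)
  \<comment> \<open>Writing \<open>q = Suc k\<close> removes the truncated subtraction
    \<open>q - 1\<close> before the arithmetic.\<close>
  define k where "k = q - 1"
  have "q = Suc k" using q_pos by (simp add: k_def)
  then have C0': "C0 + ?w = Suc k * Lc + Suc k * X + k * q" using C0 by (metis k_def)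
  have "N * ?w + n_fillers = (\<Sum>m<N. ?al m) + N * (C0 + ?w) + N * (k * X * D) + D * X"
    unfolding n_fillers_def k_def[symmetric] by (simp only: distrib_left add_ac)
  also have "\<dots> = card target"
    unfolding C0' target n_blocks_def M_def k_def[symmetric] by (simp add: algebra_simps)
  finally show ?thesis using tiles by simp
qed

end

section \<open>Computation tableaux as constraint satisfaction problems\<close>

type_synonym transition = "(nat \<times> nat option list) \<times> (nat \<times> (nat option \<times> int) list)"

abbreviation (input) source :: "transition \<Rightarrow> nat" where "source d \<equiv> fst (fst d)"
abbreviation (input) reads :: "transition \<Rightarrow> nat option list" where "reads d \<equiv> snd (fst d)"
abbreviation (input) goal :: "transition \<Rightarrow> nat" where "goal d \<equiv> fst (snd d)"
abbreviation (input) acts :: "transition \<Rightarrow> (nat option \<times> int) list" where "acts d \<equiv> snd (snd d)"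

text \<open>A cell of the tableau carries the transition applied to its configuration and, for every
  tape, the symbol and whether the head is there.  Every row begins with a border cell.\<close>

datatype cell = Border | Cell transition "(nat option \<times> bool) list"

fun row_compatible :: "cell \<Rightarrow> cell \<Rightarrow> bool" where
  "row_compatible (Cell d _) (Cell d' _) = (d = d')"
| "row_compatible _ _ = True"

text \<open>Compatibility of a cell with the cell in the next row and \<open>m\<close> columns to the right.  When
  the rows are concatenated, a border cell is related in this way to the first proper cell of the
  next row and to the last cell of its own row; no head may be there.\<close>

fun step_compatible :: "int \<Rightarrow> cell \<Rightarrow> cell \<Rightarrow> bool" where
  "step_compatible m (Cell d ys) (Cell d' ys') =
     ((\<forall>l<length ys. snd (acts d ! l) = m \<longrightarrow> snd (ys ! l) = snd (ys' ! l)) \<and>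
      (m = 0 \<longrightarrow> source d' = goal d \<and>
         (\<forall>l<length ys. fst (ys' ! l) = (if snd (ys ! l) then fst (acts d ! l) else fst (ys ! l)))))"
| "step_compatible m Border (Cell d' ys') = (\<forall>l<length ys'. \<not> snd (ys' ! l))"
| "step_compatible m _ Border = True"

text \<open>Constraint \<open>1\<close> relates neighbours in a row; constraints \<open>2\<close>, \<open>3\<close>, \<open>4\<close> relate a cell to
  the cells below it, one column to the left, straight below, and one column to the right.\<close>

definition compatible :: "nat \<Rightarrow> cell \<Rightarrow> cell \<Rightarrow> bool" where
  "compatible c = (if c = 1 then row_compatible else step_compatible (int c - 3))"

text \<open>Distances in the concatenation of rows of length \<open>w\<close>: the cells below,
  diagonally and straight, are \<open>w - 1\<close>, \<open>w\<close> and \<open>w + 1\<close>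
  further on.\<close>

definition distance :: "nat \<Rightarrow> nat \<Rightarrow> nat" where
  "distance w c = (if c = 1 then 1 else w + c - 3)"

lemma map2_act_nth:
  assumes "length as = length ts" "l < length ts"
  shows "map2 act_tape as ts ! l = ((fst (ts ! l))(snd (ts ! l) := fst (as ! l)), snd (ts ! l) + snd (as ! l))"
  using assms by (cases "ts ! l"; cases "as ! l") simp

text \<open>The computation is preceded by a step out of a fresh state \<open>q0\<close>, which is the only one
  possible there, and may idle in the accepting state \<open>1\<close>; so all accepting computations can be
  taken to have the same length.\<close>

locale tableau =
  fixes k :: nat and E :: transitions and \<Gamma> :: "nat option set" and q0 :: nat
  assumes k_pos: "1 \<le> k" and finite_E: "finite E" and finite_\<Gamma>: "finite \<Gamma>" and None_\<Gamma>: "None \<in> \<Gamma>"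
    and wf: "\<And>d. d \<in> E \<Longrightarrow> length (reads d) = k \<and> length (acts d) = k \<and>
      (\<forall>l<k. fst (acts d ! l) \<in> \<Gamma> \<and> snd (acts d ! l) \<in> {-1, 0, 1})"
    and start: "\<And>d. source d = q0 \<Longrightarrow> d \<in> E \<longleftrightarrow> d = ((q0, replicate k None), (0, replicate k (None, 1)))"
    and idle: "\<And>rs. length rs = k \<Longrightarrow> set rs \<subseteq> \<Gamma> \<Longrightarrow> \<exists>d \<in> E. fst d = (1, rs)"
begin

text \<open>Where a head is marked, the symbol must be the one that the transition reads. Together
  with the agreement of transitions along a row this makes the transition applicable, by conditions
  local to a cell or to neighbours.\<close>

definition cells :: "cell set" where
  "cells = insert Border {Cell d ys | d ys. d \<in> E \<and> length ys = k \<and> fst ` set ys \<subseteq> \<Gamma> \<and>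
     (\<forall>l<k. snd (ys ! l) \<longrightarrow> fst (ys ! l) = reads d ! l)}"

lemma finite_cells: "finite cells"
proof -
  have fin: "finite {ys :: (nat option \<times> bool) list. set ys \<subseteq> \<Gamma> \<times> UNIV \<and> length ys = k}"
    using finite_\<Gamma> by (intro finite_lists_length_eq) simp
  have "cells \<subseteq> insert Border ((\<lambda>(d, ys). Cell d ys) `
      (E \<times> {ys. set ys \<subseteq> \<Gamma> \<times> UNIV \<and> length ys = k}))"
    by (fastforce simp: cells_def)
  then show ?thesis using fin finite_E by (meson finite_SigmaI finite_imageI finite_insert finite_subset)
qed

text \<open>The values of the constraint problem are indices into this list; repetitions in it do no
  harm.\<close>

definition cell_list :: "cell list" where
  "cell_list = (SOME cs. set cs = cells)"

lemma set_cell_list: "set cell_list = cells"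
  unfolding cell_list_def using finite_list[OF finite_cells] by (rule someI_ex)

text \<open>As the transition in row \<open>0\<close> is forced, each cell of that row admits a
  single content, determined by one input symbol and the presence of the heads. A scan of the input
  can therefore print the row.\<close>

definition init_cell :: "nat option \<Rightarrow> bool \<Rightarrow> cell" where
  "init_cell a h = Cell ((q0, replicate k None), (0, replicate k (None, 1))) ((a, h) # replicate (k - 1) (None, h))"

text \<open>One border column and the positions from \<open>- (P + 1)\<close> to
  \<open>P + length x + 1\<close>: the input, the range of the heads, and a column on either side
  that no head occupies from row \<open>1\<close> on.\<close>

definition width :: "nat list \<Rightarrow> nat \<Rightarrow> nat" where
  "width x P = 2 * P + length x + 4"

text \<open>In row \<open>0\<close> the heads are at position \<open>-1\<close>, in column \<open>P + 1\<close>: they are moved onto the input by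
  the step out of \<open>q0\<close>, and reach no position outside \<open>{- P..P}\<close> in the \<open>P\<close> steps after that.\<close>

definition position :: "nat \<Rightarrow> nat \<Rightarrow> int" where
  "position P j = int j - int (P + 2)"

text \<open>Acceptance is read off the source of the transition in the last row, so that row carries
  a transition too, although it is not followed by another row; idling steps provide one for every
  reading.\<close>

definition admitted :: "nat list \<Rightarrow> nat \<Rightarrow> nat \<Rightarrow> nat \<Rightarrow> cell \<Rightarrow> bool" where
  "admitted x P i j c \<longleftrightarrow>
     (if j = 0 then c = Border
      else if i = 0 then c = init_cell (string_cells x (position P j)) (position P j = -1)
      else c \<noteq> Border \<and> (i = Suc P \<longrightarrow> (\<forall>d ys. c = Cell d ys \<longrightarrow> source d = 1)))"

definition start_config :: "nat list \<Rightarrow> configuration" where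
  "start_config x = (q0, (string_cells x, -1) # replicate (k - 1) (\<lambda>_. None, -1))"

lemma start_config_tapes:
  "length (snd (start_config x)) = k"
  "l < k \<Longrightarrow> snd (start_config x) ! l = (if l = 0 then string_cells x else (\<lambda>_. None), -1)"
  using k_pos by (auto simp: start_config_def nth_Cons')

lemma init_cell_nth:
  "l < k \<Longrightarrow> ((a, h) # replicate (k - 1) (None, h)) ! l = (if l = 0 then a else None, h)"
  by (auto simp: nth_Cons')

text \<open>Pairs are compared by their indices in the concatenated rows, so constraints across row
  boundaries are included. The border cells keep these from excluding correct tableaux.\<close>

definition tableau_solution :: "nat list \<Rightarrow> nat \<Rightarrow> (nat \<Rightarrow> nat \<Rightarrow> cell) \<Rightarrow> bool" where
  "tableau_solution x P t \<longleftrightarrow>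
     (\<forall>i j. i < P + 2 \<longrightarrow> j < width x P \<longrightarrow> t i j \<in> cells \<and> admitted x P i j (t i j) \<and>
        (\<forall>c i' j'. 1 \<le> c \<longrightarrow> c \<le> 4 \<longrightarrow> i' < P + 2 \<longrightarrow> j' < width x P \<longrightarrow>
           i' * width x P + j' = i * width x P + j + distance (width x P) c \<longrightarrow>
           compatible c (t i j) (t i' j')))"

lemma tableau_solution_iff:
  fixes x P
  defines "w \<equiv> width x P"
  shows "(\<exists>t. tableau_solution x P t) \<longleftrightarrow>
    (\<exists>s. \<forall>n<(P + 2) * w. s n < length cell_list \<and> admitted x P (n div w) (n mod w) (cell_list ! s n) \<and>
      (\<forall>c. 1 \<le> c \<longrightarrow> c \<le> 4 \<longrightarrow> n + distance w c < (P + 2) * w \<longrightarrow>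
         compatible c (cell_list ! s n) (cell_list ! s (n + distance w c))))"
    (is "_ \<longleftrightarrow> (\<exists>s. ?sol s)")
proof
  have w: "0 < w" by (simp add: w_def width_def)
  have dm: "n div w < P + 2" "n mod w < w" if "n < (P + 2) * w" for n
    using that w by (auto simp: less_mult_imp_div_less)
  {
    assume "\<exists>t. tableau_solution x P t"
    then obtain t where t: "tableau_solution x P t" by blast
    have "\<exists>v<length cell_list. cell_list ! v = t i j" if "i < P + 2" "j < w" for i j
    proof -
      have "t i j \<in> set cell_list"
        using that t by (auto simp: tableau_solution_def w_def set_cell_list)
      then show ?thesis by (auto simp: in_set_conv_nth)
    qed
    then obtain S where S: "\<And>i j. i < P + 2 \<Longrightarrow> j < w \<Longrightarrow> S i j < length cell_list \<and> cell_list ! S i j = t i j"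
      by metis
    define s where "s n = S (n div w) (n mod w)" for n
    show "\<exists>s. ?sol s"
    proof (intro exI[of _ s] allI impI conjI)
      fix n assume n: "n < (P + 2) * w"
      show "s n < length cell_list" "admitted x P (n div w) (n mod w) (cell_list ! s n)"
        using S[OF dm[OF n]] t dm[OF n] by (auto simp: s_def tableau_solution_def w_def)
      fix c :: nat assume c: "1 \<le> c" "c \<le> 4" and n': "n + distance w c < (P + 2) * w"
      let ?n = "n + distance w c"
      have "?n div w * w + ?n mod w = n div w * w + n mod w + distance w c" by simp
      then have "compatible c (t (n div w) (n mod w)) (t (?n div w) (?n mod w))"
        using t c dm[OF n] dm[OF n'] unfolding tableau_solution_def w_def[symmetric] by blast
      then show "compatible c (cell_list ! s n) (cell_list ! s ?n)"
        using S[OF dm[OF n]] S[OF dm[OF n']] by (simp add: s_def)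
    qed
  next
    assume "\<exists>s. ?sol s"
    then obtain s where s: "\<And>n. n < (P + 2) * w \<Longrightarrow> s n < length cell_list \<and> admitted x P (n div w) (n mod w) (cell_list ! s n) \<and>
      (\<forall>c. 1 \<le> c \<longrightarrow> c \<le> 4 \<longrightarrow> n + distance w c < (P + 2) * w \<longrightarrow>
         compatible c (cell_list ! s n) (cell_list ! s (n + distance w c)))"
      by blast
    have lt: "i * w + j < (P + 2) * w" if "i < P + 2" "j < w" for i j
    proof -
      have "i * w + j < Suc i * w" using that by simp
      also have "\<dots> \<le> (P + 2) * w" using that by (intro mult_le_mono1) simp
      finally show ?thesis .
    qed
    show "\<exists>t. tableau_solution x P t"
      unfolding tableau_solution_def w_def[symmetric]
    proof (intro exI[of _ "\<lambda>i j. cell_list ! s (i * w + j)"] allI impI conjI)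
      fix i j assume ij: "i < P + 2" "j < w"
      note sn = s[OF lt[OF ij]]
      show "cell_list ! s (i * w + j) \<in> cells"
        using sn nth_mem set_cell_list by metis
      show "admitted x P i j (cell_list ! s (i * w + j))"
        using sn ij by simp
      fix c i' j' assume c: "1 \<le> c" "c \<le> 4" "i' < P + 2" "j' < w" "i' * w + j' = i * w + j + distance w c"
      then show "compatible c (cell_list ! s (i * w + j)) (cell_list ! s (i' * w + j'))"
        using sn lt[OF c(3,4)] by simp
    qed
  }
qed

end

section \<open>Tableaux and accepting runs\<close>

context tableau
begin

lemma compatibleD:
  assumes "tableau_solution x P t" "i < P + 2" "j < width x P" "i' < P + 2" "j' < width x P" "1 \<le> c" "c \<le> 4"
    "i' * width x P + j' = i * width x P + j + distance (width x P) c"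
  shows "compatible c (t i j) (t i' j')"
  using assms unfolding tableau_solution_def by blast

lemma admittedD:
  assumes "tableau_solution x P t" "i < P + 2" "j < width x P"
  shows "admitted x P i j (t i j)"
  using assms unfolding tableau_solution_def by blast

lemma step_compatibleD:
  assumes "tableau_solution x P t" "Suc i < P + 2" "j < width x P" "j' < width x P"
    "int j' = int j + m" "m \<in> {-1, 0, 1}"
  shows "step_compatible m (t i j) (t (Suc i) j')"
proof -
  let ?w = "width x P"
  define c where "c = nat (m + 3)"
  have c: "1 < c" "c \<le> 4" "int c - 3 = m" using assms(6) by (auto simp: c_def)
  have "i < P + 2" "1 \<le> c" using assms(2) c(1) by auto
  moreover have "Suc i * ?w + j' = i * ?w + j + distance ?w c"
  proof -
    have "distance ?w c = ?w + c - 3" "2 < ?w + c" using c(1) by (auto simp: distance_def width_def)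
    then have "int (distance ?w c) = int ?w + m" using c by simp
    then have "int (Suc i * ?w + j') = int (i * ?w + j + distance ?w c)" using assms(5) by simp
    then show ?thesis by (rule of_nat_eq_iff[THEN iffD1])
  qed
  ultimately have "compatible c (t i j) (t (Suc i) j')"
    using assms(1-4) c(2) unfolding tableau_solution_def by blast
  then show ?thesis using c by (simp add: compatible_def)
qed

lemma tableau_cell:
  assumes "tableau_solution x P t" "i < P + 2" "1 \<le> j" "j < width x P"
  shows "\<exists>d ys. t i j = Cell d ys \<and> d \<in> E \<and> length ys = k \<and>
    (\<forall>l<k. snd (ys ! l) \<longrightarrow> fst (ys ! l) = reads d ! l)"
proof -
  have "t i j \<in> cells" "admitted x P i j (t i j)"
    using assms by (auto simp: tableau_solution_def)
  moreover from this have "t i j \<noteq> Border"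
    using assms(3) by (auto simp: admitted_def init_cell_def split: if_splits)
  ultimately show ?thesis by (auto simp: cells_def)
qed

definition row_describes :: "nat list \<Rightarrow> nat \<Rightarrow> (nat \<Rightarrow> nat \<Rightarrow> cell) \<Rightarrow> nat \<Rightarrow> transition \<Rightarrow> tape list \<Rightarrow> bool" where
  "row_describes x P t i d ts \<longleftrightarrow> length ts = k \<and>
     (\<forall>l<k. - 1 - int i \<le> snd (ts ! l) \<and> snd (ts ! l) \<le> int i - 1) \<and>
     (\<forall>j. 1 \<le> j \<longrightarrow> j < width x P \<longrightarrow>
        t i j = Cell d (map (\<lambda>l. (fst (ts ! l) (position P j), position P j = snd (ts ! l))) [0..<k]))"

text \<open>The constraint straight below fixes state and symbols. The head of each tape is fixed by
  the constraint in the direction in which the transition moves it, read from the cell that the head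
  would come from.\<close>

lemma row_describes_step:
  assumes sol: "tableau_solution x P t" and i: "i \<le> P" and row: "row_describes x P t i d ts"
  shows "tm_step E (source d, ts) (goal d, map2 act_tape (acts d) ts) \<and>
    (\<exists>d'. source d' = goal d \<and> row_describes x P t (Suc i) d' (map2 act_tape (acts d) ts))"
proof -
  let ?w = "width x P"
  let ?ys = "\<lambda>ts j. map (\<lambda>l. (fst (ts ! l) (position P j), position P j = snd (ts ! l))) [0..<k]"
  let ?ts' = "map2 act_tape (acts d) ts"
  have w: "2 \<le> ?w" by (simp add: width_def)
  have len: "length ts = k"
    and head: "\<And>l. l < k \<Longrightarrow> - 1 - int i \<le> snd (ts ! l) \<and> snd (ts ! l) \<le> int i - 1"
    and cell: "\<And>j. 1 \<le> j \<Longrightarrow> j < ?w \<Longrightarrow> t i j = Cell d (?ys ts j)"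
    using row by (auto simp: row_describes_def)
  have "t i 1 = Cell d (?ys ts 1)" using cell[of 1] w by simp
  then have dE: "d \<in> E" using tableau_cell[OF sol, of i 1] i w by auto
  note d = wf[OF dE]
  have read: "fst (ts ! l) (snd (ts ! l)) = reads d ! l" if l: "l < k" for l
  proof -
    define j where "j = nat (snd (ts ! l) + int (P + 2))"
    have j: "position P j = snd (ts ! l)" "1 \<le> j" "j < ?w"
      using head[OF l] i by (auto simp: j_def position_def width_def)
    then show ?thesis
      using tableau_cell[OF sol, of i j] cell[of j] i l by auto
  qed
  have "map read_tape ts = reads d"
  proof (rule nth_equalityI)
    fix l assume "l < length (map read_tape ts)"
    then show "map read_tape ts ! l = reads d ! l"
      using read[of l] len by (cases "ts ! l") simp
  qed (use len d in simp)
  then have step: "tm_step E (source d, ts) (goal d, ?ts')"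
    unfolding tm_step_def using dE by (intro exI[of _ "acts d"]) simp
  have len': "length ?ts' = k" using len d by simp
  have ts': "?ts' ! l = ((fst (ts ! l))(snd (ts ! l) := fst (acts d ! l)), snd (ts ! l) + snd (acts d ! l))"
    if "l < k" for l using map2_act_nth[of "acts d" ts l] len d that by simp
  have move: "snd (acts d ! l) \<in> {-1, 0, 1}" if "l < k" for l using d that by blast
  have Border: "t i' 0 = Border" if "i' < P + 2" for i'
  proof -
    have "admitted x P i' 0 (t i' 0)" using sol that w by (auto simp: tableau_solution_def)
    then show ?thesis by (simp add: admitted_def)
  qed
  have next_cell: "\<exists>d' ys'. t (Suc i) j = Cell d' ys' \<and> source d' = goal d \<and> ys' = ?ys ?ts' j"
    if j: "1 \<le> j" "j < ?w" for j
  proof -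
    obtain d' ys' where c: "t (Suc i) j = Cell d' ys'" "length ys' = k"
      using tableau_cell[OF sol, of "Suc i" j] i j by auto
    have sc: "step_compatible 0 (Cell d (?ys ts j)) (Cell d' ys')"
      using step_compatibleD[OF sol, of i j j 0] cell[OF j] c i j by simp
    have "ys' ! l = (fst (?ts' ! l) (position P j), position P j = snd (?ts' ! l))" if l: "l < k" for l
    proof (rule prod_eqI)
      show "fst (ys' ! l) = fst (fst (?ts' ! l) (position P j), position P j = snd (?ts' ! l))"
        using sc l by (simp add: ts')
      let ?m = "snd (acts d ! l)"
      \<comment> \<open>The column a head in column \<open>j\<close> would come from is proper, is
        the border, or lies beyond the right end. In the last two cases a border cell has to exclude
        the head.\<close>
      consider "1 \<le> int j - ?m" "int j - ?m < ?w" | "int j - ?m = 0" | "int j - ?m = ?w"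
        using j move[OF l] by fastforce
      then have "snd (ys' ! l) \<longleftrightarrow> position P j = snd (ts ! l) + ?m"
      proof cases
        case 1
        define j0 where "j0 = nat (int j - ?m)"
        have j0: "1 \<le> j0" "j0 < ?w" "int j = int j0 + ?m" using 1 by (auto simp: j0_def)
        have "step_compatible ?m (Cell d (?ys ts j0)) (Cell d' ys')"
          using step_compatibleD[OF sol, of i j0 j ?m] cell[OF j0(1,2)] c i j j0 move[OF l] by simp
        then have "position P j0 = snd (ts ! l) \<longleftrightarrow> snd (ys' ! l)" using l by auto
        then show ?thesis using j0(3) by (auto simp: position_def)
      next
        case 2
        then have m: "?m = 1" "j = 1" using j move[OF l] by auto
        have "step_compatible 1 Border (Cell d' ys')"
          using step_compatibleD[OF sol, of i 0 j 1] Border[of i] c i j m w by simp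
        then have "\<not> snd (ys' ! l)" using l c(2) by simp
        moreover have "position P j \<noteq> snd (ts ! l) + ?m" using head[OF l] i m by (simp add: position_def)
        ultimately show ?thesis by simp
      next
        case 3
        then have m: "?m = -1" "Suc j = ?w" using j move[OF l] by auto
        \<comment> \<open>The border cell of the same row is \<open>w - 1\<close> places before the
          last cell, so constraint \<open>2\<close> links the two and forbids a head there.\<close>
        have "compatible 2 (t (Suc i) 0) (t (Suc i) j)"
        proof -
          have "distance ?w 2 = ?w - 1" by (simp add: distance_def)
          then have "Suc i * ?w + j = Suc i * ?w + 0 + distance ?w 2" using m(2) by simp
          then show ?thesis using i j w by (intro compatibleD[OF sol]) auto
        qed
        then have "\<not> snd (ys' ! l)" using l c Border[of "Suc i"] i by (simp add: compatible_def)
        moreover have "position P j \<noteq> snd (ts ! l) + ?m"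
          using head[OF l] i m by (simp add: position_def width_def)
        ultimately show ?thesis by simp
      qed
      then show "snd (ys' ! l) = snd (fst (?ts' ! l) (position P j), position P j = snd (?ts' ! l))"
        using l by (simp add: ts')
    qed
    then have "ys' = ?ys ?ts' j" using c(2) by (intro nth_equalityI) auto
    moreover have "source d' = goal d" using sc by simp
    ultimately show ?thesis using c(1) by blast
  qed
  obtain d' where d': "t (Suc i) 1 = Cell d' (?ys ?ts' 1)" "source d' = goal d"
    using next_cell[of 1] w by auto
  \<comment> \<open>So far every column may have its own transition; constraint \<open>1\<close>
    spreads that of column \<open>1\<close> along the row.\<close>
  have "t (Suc i) j = Cell d' (?ys ?ts' j)" if "1 \<le> j" "j < ?w" for j
    using that
  proof (induction j rule: dec_induct)
    case base
    then show ?case using d'(1) by simp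
  next
    case (step n)
    have "Suc i * ?w + Suc n = Suc i * ?w + n + distance ?w 1" by (simp add: distance_def)
    then have "compatible 1 (t (Suc i) n) (t (Suc i) (Suc n))"
      using i step.prems by (intro compatibleD[OF sol]) auto
    then show ?case
      using step next_cell[of "Suc n"] by (auto simp: compatible_def)
  qed
  then have "row_describes x P t (Suc i) d' ?ts'"
    unfolding row_describes_def
    using len' ts' head move by (fastforce simp del: nth_map nth_zip)
  then show ?thesis using step d'(2) by blast
qed

lemma tableau_imp_run:
  assumes sol: "tableau_solution x P t"
  shows "\<exists>ts. (tm_step E ^^ Suc P) (start_config x) (1, ts)"
proof -
  let ?w = "width x P"
  have "\<exists>d ts. (tm_step E ^^ i) (start_config x) (source d, ts) \<and> row_describes x P t i d ts" if "i \<le> Suc P" for i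
    using that
  proof (induction i)
    case 0
    let ?d = "((q0, replicate k None), (0, replicate k (None, 1)))"
    let ?ts = "snd (start_config x)"
    have "t 0 j = Cell ?d (map (\<lambda>l. (fst (?ts ! l) (position P j), position P j = snd (?ts ! l))) [0..<k])"
      if j: "1 \<le> j" "j < ?w" for j
    proof -
      have "admitted x P 0 j (t 0 j)" using sol j by (auto simp: tableau_solution_def)
      then have "t 0 j = init_cell (string_cells x (position P j)) (position P j = -1)"
        using j by (simp add: admitted_def)
      moreover have "(string_cells x (position P j), position P j = -1) # replicate (k - 1) (None, position P j = -1) =
          map (\<lambda>l. (fst (?ts ! l) (position P j), position P j = snd (?ts ! l))) [0..<k]"
        using k_pos by (intro nth_equalityI) (auto simp: init_cell_nth start_config_tapes)
      ultimately show ?thesis by (simp add: init_cell_def)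
    qed
    then have "row_describes x P t 0 ?d ?ts"
      by (simp add: row_describes_def start_config_tapes)
    moreover have "(tm_step E ^^ 0) (start_config x) (source ?d, ?ts)"
      by (simp add: start_config_def)
    ultimately show ?case by blast
  next
    case (Suc i)
    then obtain d ts where IH: "(tm_step E ^^ i) (start_config x) (source d, ts)" "row_describes x P t i d ts"
      by auto
    from row_describes_step[OF sol _ IH(2)] Suc.prems obtain d' where
      "tm_step E (source d, ts) (source d', map2 act_tape (acts d) ts)"
      "row_describes x P t (Suc i) d' (map2 act_tape (acts d) ts)"
      by auto
    then show ?case using relpowp_Suc_I[OF IH(1)] by blast
  qed
  then obtain d ts where "(tm_step E ^^ Suc P) (start_config x) (source d, ts)" "row_describes x P t (Suc P) d ts"
    by blast
  moreover have "source d = 1"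
  proof -
    have "1 < ?w" by (simp add: width_def)
    then have "t (Suc P) 1 = Cell d (map (\<lambda>l. (fst (ts ! l) (position P 1), position P 1 = snd (ts ! l))) [0..<k])"
      "admitted x P (Suc P) 1 (t (Suc P) 1)"
      using \<open>row_describes x P t (Suc P) d ts\<close> admittedD[OF sol, of "Suc P" 1] by (simp_all add: row_describes_def)
    then show ?thesis by (simp add: admitted_def)
  qed
  ultimately show ?thesis by metis
qed

lemma run_imp_tableau:
  assumes run: "(tm_step E ^^ Suc P) (start_config x) (1, us)" and x: "Some ` set x \<subseteq> \<Gamma>"
  shows "\<exists>t. tableau_solution x P t"
proof -
  let ?w = "width x P"
  obtain C where C: "C 0 = start_config x" "C (Suc P) = (1, us)"
    "\<And>i. i < Suc P \<Longrightarrow> tm_step E (C i) (C (Suc i))"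
    using run unfolding relpowp_fun_conv by blast
  let ?T = "\<lambda>i l. snd (C i) ! l"
  have inv: "length (snd (C i)) = k \<and> (\<forall>l<k. range (fst (?T i l)) \<subseteq> \<Gamma>)" if "i \<le> Suc P" for i
    using that
  proof (induction i)
    case 0
    have "string_cells x p \<in> \<Gamma>" for p
    proof -
      have "Some (x ! nat p) \<in> \<Gamma>" if "0 \<le> p" "p < int (length x)"
        using x that by (auto simp: image_subset_iff)
      then show ?thesis using None_\<Gamma> by (simp add: string_cells_def)
    qed
    then show ?case using C(1) None_\<Gamma> by (auto simp: start_config_tapes)
  next
    case (Suc i)
    then obtain as where as: "((fst (C i), map read_tape (snd (C i))), (fst (C (Suc i)), as)) \<in> E"
      "snd (C (Suc i)) = map2 act_tape as (snd (C i))"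
      using C(3)[of i] by (auto simp: tm_step_def)
    have "length as = k" "\<forall>l<k. fst (as ! l) \<in> \<Gamma>" using wf[OF as(1)] by auto
    moreover have "range (fst (map2 act_tape as (snd (C i)) ! l)) \<subseteq> \<Gamma>" if l: "l < k" for l
    proof -
      have "range (fst (?T i l)) \<subseteq> \<Gamma>" "length (snd (C i)) = k" using Suc l by auto
      then show ?thesis
        using map2_act_nth[of as "snd (C i)" l] \<open>length as = k\<close> \<open>\<forall>l<k. fst (as ! l) \<in> \<Gamma>\<close> l by auto
    qed
    ultimately show ?case using as(2) Suc by simp
  qed
  have "\<exists>d. d \<in> E \<and> fst d = (fst (C i), map read_tape (snd (C i))) \<and>
     (i \<le> P \<longrightarrow> C (Suc i) = (goal d, map2 act_tape (acts d) (snd (C i))))" if "i \<le> Suc P" for i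
  proof (cases "i \<le> P")
    case True
    then obtain as where "((fst (C i), map read_tape (snd (C i))), (fst (C (Suc i)), as)) \<in> E"
      "snd (C (Suc i)) = map2 act_tape as (snd (C i))"
      using C(3)[of i] by (auto simp: tm_step_def)
    then show ?thesis by (metis fst_conv prod.collapse snd_conv)
  next
    \<comment> \<open>The last row has no successor configuration; its transition is an idling one,
      available because the state is accepting.\<close>
    case False
    then have i: "i = Suc P" using that by simp
    have rd: "read_tape (?T i l) \<in> \<Gamma>" if "l < k" for l
    proof -
      have "range (fst (?T i l)) \<subseteq> \<Gamma>" using inv[of i] i that by simp
      then show ?thesis by (cases "?T i l") auto
    qed
    have "set (map read_tape (snd (C i))) \<subseteq> \<Gamma>"
    proof (intro subsetI)
      fix a assume "a \<in> set (map read_tape (snd (C i)))"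
      then obtain u where u: "u \<in> set (snd (C i))" "a = read_tape u" by (auto simp only: set_map)
      from u(1) obtain l where "l < k" "u = ?T i l"
        using inv[of i] i by (auto simp only: in_set_conv_nth le_refl)
      then show "a \<in> \<Gamma>" using rd u(2) by simp
    qed
    then obtain d where "d \<in> E" "fst d = (1, map read_tape (snd (C i)))"
      using idle[of "map read_tape (snd (C i))"] inv[of i] i by auto
    then show ?thesis using i C(2) by (intro exI[of _ d]) simp
  qed
  then obtain d where d: "\<And>i. i \<le> Suc P \<Longrightarrow> d i \<in> E \<and> fst (d i) = (fst (C i), map read_tape (snd (C i))) \<and>
     (i \<le> P \<longrightarrow> C (Suc i) = (goal (d i), map2 act_tape (acts (d i)) (snd (C i))))"
    by metis
  have d0: "d 0 = ((q0, replicate k None), (0, replicate k (None, 1)))"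
    using start[of "d 0"] d[of 0] C(1) by (simp add: start_config_def)
  have move: "snd (acts (d i) ! l) \<in> {-1, 0, 1}" and act_in: "fst (acts (d i) ! l) \<in> \<Gamma>" and lens: "length (acts (d i)) = k"
    if "i \<le> Suc P" "l < k" for i l
    using wf[of "d i"] d[OF that(1)] that(2) by auto
  have next_tape: "?T (Suc i) l = ((fst (?T i l))(snd (?T i l) := fst (acts (d i) ! l)), snd (?T i l) + snd (acts (d i) ! l))"
    if "i \<le> P" "l < k" for i l
    using d[of i] inv[of i] lens[of i l] that map2_act_nth[of "acts (d i)" "snd (C i)" l] by simp
  have heads: "- int i \<le> snd (?T (Suc i) l) \<and> snd (?T (Suc i) l) \<le> int i" if "i \<le> P" "l < k" for i l
    using that
  proof (induction i)
    case 0
    then show ?case using next_tape[of 0 l] C(1) d0 by (simp add: start_config_tapes)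
  next
    case (Suc i)
    then show ?case using next_tape[of "Suc i" l] move[of "Suc i" l] by auto
  qed
  have head0: "snd (?T 0 l) = -1" if "l < k" for l
    using C(1) that by (simp add: start_config_tapes)
  define ys where "ys i j = map (\<lambda>l. (fst (?T i l) (position P j), position P j = snd (?T i l))) [0..<k]" for i j
  define t where "t i j = (if j = 0 then Border else Cell (d i) (ys i j))" for i j
  have ys_nth: "ys i j ! l = (fst (?T i l) (position P j), position P j = snd (?T i l))" "length (ys i j) = k"
    if "l < k" for i j l using that by (simp_all add: ys_def)
  have len_ys: "length (ys i j) = k" for i j by (simp add: ys_def)
  have no_head_left: "\<not> snd (ys i 1 ! l)" if "1 \<le> i" "i \<le> Suc P" "l < k" for i l
    using heads[of "i - 1" l] that by (cases i) (auto simp: ys_nth position_def)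
  have no_head_right: "\<not> snd (ys i (?w - 1) ! l)" if "i \<le> Suc P" "l < k" for i l
    using heads[of "i - 1" l] head0[of l] that
    by (cases i) (auto simp: ys_nth position_def width_def)
  have step_cells: "step_compatible m (t i j) (t (Suc i) j')"
    if i: "i \<le> P" and m: "int j' = int j + m" "m \<in> {-1, 0, 1}" for i j j' m
  proof (cases "j' = 0")
    case True
    then show ?thesis by (cases "t i j") (simp_all add: t_def)
  next
    case j': False
    show ?thesis
    proof (cases "j = 0")
      case True
      then have "j' = 1" using m j' by auto
      then show ?thesis using True no_head_left[of "Suc i"] i by (simp add: t_def len_ys)
    next
      case False
      have "source (d (Suc i)) = goal (d i)" using d[of i] d[of "Suc i"] i by simp
      moreover have "position P j' = position P j + m" using m(1) by (simp add: position_def)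
      ultimately show ?thesis
        using False j' i by (auto simp: t_def len_ys ys_nth next_tape)
    qed
  qed
  have "tableau_solution x P t"
    unfolding tableau_solution_def
  proof (intro allI impI conjI)
    fix i j assume ij: "i < P + 2" "j < ?w"
    then have i: "i \<le> Suc P" by simp
    have "fst (?T i l) p \<in> \<Gamma>" if "l < k" for l p
      using inv[OF i] that by (meson rangeI subsetD)
    then have "fst ` set (ys i j) \<subseteq> \<Gamma>" by (auto simp: ys_def)
    moreover have "fst (ys i j ! l) = reads (d i) ! l" if "l < k" "snd (ys i j ! l)" for l
      using that d[OF i] inv[OF i] by (cases "?T i l") (auto simp: ys_nth)
    moreover have "d i \<in> E" using d[OF i] by simp
    ultimately have "Cell (d i) (ys i j) \<in> cells" using len_ys unfolding cells_def by blast
    then show "t i j \<in> cells" by (simp add: t_def cells_def)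
    show "admitted x P i j (t i j)"
    proof -
      have "source (d (Suc P)) = 1" using d[of "Suc P"] C(2) by simp
      moreover have "Cell (d 0) (ys 0 j) = init_cell (string_cells x (position P j)) (position P j = -1)"
      proof -
        have "ys 0 j = (string_cells x (position P j), position P j = -1) # replicate (k - 1) (None, position P j = -1)"
          using k_pos C(1) by (intro nth_equalityI)
            (auto simp: len_ys ys_nth init_cell_nth start_config_tapes)
        then show ?thesis by (simp add: init_cell_def d0)
      qed
      ultimately show ?thesis by (auto simp: admitted_def t_def)
    qed
    fix c i' j' assume c: "1 \<le> c" "c \<le> 4" and ij': "i' < P + 2" "j' < ?w"
      and eq: "i' * ?w + j' = i * ?w + j + distance ?w c"
    have w: "4 \<le> ?w" by (simp add: width_def)
    have split: "i' = a \<and> j' = b" if "i * ?w + j + distance ?w c = a * ?w + b" "b < ?w" for a b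
    proof -
      have eq': "i' * ?w + j' = a * ?w + b" using eq that(1) by simp
      from arg_cong[OF eq', of "\<lambda>n. n div ?w"] arg_cong[OF eq', of "\<lambda>n. n mod ?w"] that(2) ij'(2)
      show ?thesis by simp
    qed
    show "compatible c (t i j) (t i' j')"
    proof (cases "c = 1")
      case True
      show ?thesis
      proof (cases "Suc j < ?w")
        case True
        then have "i' = i \<and> j' = Suc j" using split[of i "Suc j"] \<open>c = 1\<close> by (simp add: distance_def)
        then show ?thesis using \<open>c = 1\<close> by (simp add: compatible_def t_def)
      next
        case False
        \<comment> \<open>The neighbour of the last cell is the border of the next row, compatible
          with everything.\<close>
        then have "Suc j = ?w" using ij(2) by simp
        then have "i' = Suc i \<and> j' = 0" using split[of "Suc i" 0] \<open>c = 1\<close> w by (simp add: distance_def)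
        then show ?thesis using \<open>c = 1\<close> by (cases "t i j") (simp_all add: compatible_def t_def)
      qed
    next
      case False
      define m where "m = int c - 3"
      have m: "m \<in> {-1, 0, 1}" using c False by (auto simp: m_def)
      have dist: "int (distance ?w c) = int ?w + m" using False c w by (simp add: distance_def m_def)
      have comp: "compatible c = step_compatible m" using False by (simp add: compatible_def m_def)
      consider "0 \<le> int j + m" "int j + m < ?w" | "int j + m = -1" | "int j + m = ?w"
        using m ij(2) by fastforce
      then show ?thesis
      proof cases
        case 1
        have "int (i * ?w + j + distance ?w c) = int (Suc i * ?w + nat (int j + m))"
          using 1(1) dist by simp
        then have "i' = Suc i \<and> j' = nat (int j + m)"
          using split[of "Suc i" "nat (int j + m)"] 1 by (simp only: of_nat_eq_iff)
        then show ?thesis using step_cells[of i j' j m] ij'(1) 1(1) m comp by auto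
      next
        case 2
        \<comment> \<open>The pair formed by a border cell and the last cell of its own row, where
          no head ever arrives.\<close>
        then have j: "j = 0" "m = -1" using m by auto
        have "int (i * ?w + j + distance ?w c) = int (i * ?w + (?w - 1))"
          using dist j w by simp
        then have "i' = i \<and> j' = ?w - 1"
          using split[of i "?w - 1"] w by (simp only: of_nat_eq_iff)
        then show ?thesis
          using j no_head_right[of i] i w comp by (simp add: t_def len_ys)
      next
        case 3
        \<comment> \<open>From the last column one step down and to the right leads to the border
          cell two rows below, which is compatible with everything.\<close>
        have "int (i * ?w + j + distance ?w c) = int ((i + 2) * ?w + 0)"
          using dist 3 by (simp add: algebra_simps)
        then have "j' = 0"
          using split[of "i + 2" 0] w by (simp only: of_nat_eq_iff)
        then show ?thesis using comp by (cases "t i j") (simp_all add: t_def)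
      qed
    qed
  qed
  then show ?thesis by blast
qed

theorem tableau_iff_run:
  assumes "Some ` set x \<subseteq> \<Gamma>"
  shows "(\<exists>t. tableau_solution x P t) \<longleftrightarrow> (\<exists>ts. (tm_step E ^^ Suc P) (start_config x) (1, ts))"
  using tableau_imp_run run_imp_tableau[OF _ assms] by blast

end

section \<open>Normal form of a nondeterministic machine\<close>

lemma tape_step_\<Gamma>:
  assumes "length as = k" "\<forall>l<k. fst (as ! l) \<in> \<Gamma>" "length ts = k" "\<forall>l<k. range (fst (ts ! l)) \<subseteq> \<Gamma>"
  shows "length (map2 act_tape as ts) = k \<and> (\<forall>l<k. range (fst (map2 act_tape as ts ! l)) \<subseteq> \<Gamma>)"
proof (intro conjI allI impI)
  fix l assume l: "l < k"
  then have "fst (ts ! l) p \<in> \<Gamma>" for p using assms by blast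
  then show "range (fst (map2 act_tape as ts ! l)) \<subseteq> \<Gamma>"
    using map2_act_nth[of as ts l] assms l by auto
qed (use assms in simp)

lemma np_tableau:
  assumes "in_NP s L"
  obtains k E \<Gamma> q0 p where "tableau k E \<Gamma> q0" "\<And>x. x \<in> lists {..<s} \<Longrightarrow> Some ` set x \<subseteq> \<Gamma>"
    "\<And>x. x \<in> lists {..<s} \<Longrightarrow> x \<in> L \<longleftrightarrow>
       (\<exists>ts. (tm_step E ^^ Suc (poly p (length x))) (tableau.start_config k q0 x) (1, ts))"
proof -
  obtain k \<delta> p where tm: "turing_machine k \<delta>"
    and L: "\<And>x. x \<in> lists {..<s} \<Longrightarrow> x \<in> L \<longleftrightarrow>
           (\<exists>n \<le> poly p (length x). \<exists>ts. (tm_step \<delta> ^^ n) (tm_init k x) (1, ts))"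
    using assms unfolding in_NP_def by blast
  have k: "1 \<le> k" and fin: "finite \<delta>" using tm by (auto simp: turing_machine_def)
  have wf': "length (reads d) = k" "length (acts d) = k" "\<forall>l<k. snd (acts d ! l) \<in> {-1, 0, 1}" if d: "d \<in> \<delta>" for d
  proof -
    have *: "length (reads d) = k \<and> length (acts d) = k \<and> (\<forall>a\<in>set (acts d). snd a \<in> {-1, 0, 1})"
      using tm d unfolding turing_machine_def by (force simp: case_prod_unfold)
    then show "length (reads d) = k" "length (acts d) = k" "\<forall>l<k. snd (acts d ! l) \<in> {-1, 0, 1}"
      by (auto dest: nth_mem)
  qed
  \<comment> \<open>The blank, the input letters and all symbols that the machine can write: every
    symbol occurring in a run lies here.\<close>
  define \<Gamma> where "\<Gamma> = insert None (Some ` {..<s} \<union> (\<Union>d\<in>\<delta>. fst ` set (acts d)))"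
  have finite_\<Gamma>: "finite \<Gamma>" using fin by (simp add: \<Gamma>_def)
  obtain q0 where q0: "q0 \<notin> {0, 1} \<union> (\<lambda>d. source d) ` \<delta> \<union> (\<lambda>d. goal d) ` \<delta>"
    using ex_new_if_finite[of "{0, 1} \<union> (\<lambda>d. source d) ` \<delta> \<union> (\<lambda>d. goal d) ` \<delta>"] fin infinite_UNIV_nat by blast
  define Idle where "Idle = (\<lambda>rs. ((1::nat, rs), (1::nat, map (\<lambda>r. (r, 0::int)) rs))) ` {rs. set rs \<subseteq> \<Gamma> \<and> length rs = k}"
  define E where "E = \<delta> \<union> Idle \<union> {((q0, replicate k None), (0, replicate k (None, 1)))}"
  have Idle: "\<exists>rs. length rs = k \<and> set rs \<subseteq> \<Gamma> \<and> d = ((1, rs), (1, map (\<lambda>r. (r, 0)) rs))" if "d \<in> Idle" for d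
    using that by (auto simp: Idle_def)
  have IdleI: "((1, rs), (1, map (\<lambda>r. (r, 0)) rs)) \<in> E" if "length rs = k" "set rs \<subseteq> \<Gamma>" for rs
    using that by (simp add: E_def Idle_def)
  interpret tableau k E \<Gamma> q0
  proof
    show "1 \<le> k" by (rule k)
    show "finite E" using fin finite_lists_length_eq[OF finite_\<Gamma>, of k] by (simp add: E_def Idle_def)
    show "finite \<Gamma>" by (rule finite_\<Gamma>)
    show "None \<in> \<Gamma>" by (simp add: \<Gamma>_def)
    show "length (reads d) = k \<and> length (acts d) = k \<and>
      (\<forall>l<k. fst (acts d ! l) \<in> \<Gamma> \<and> snd (acts d ! l) \<in> {-1, 0, 1})" if "d \<in> E" for d
    proof -
      consider "d \<in> \<delta>" | "d \<in> Idle" | "d = ((q0, replicate k None), (0, replicate k (None, 1)))"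
        using \<open>d \<in> E\<close> by (auto simp: E_def)
      then show ?thesis
      proof cases
        case 1
        then have "fst ` set (acts d) \<subseteq> \<Gamma>" by (auto simp: \<Gamma>_def)
        then show ?thesis using wf'[OF 1] nth_mem by fastforce
      next
        case 2
        then obtain rs where "length rs = k" "set rs \<subseteq> \<Gamma>" "d = ((1, rs), (1, map (\<lambda>r. (r, 0)) rs))"
          using Idle by blast
        then show ?thesis using nth_mem by fastforce
      qed (simp add: \<Gamma>_def)
    qed
    show "d \<in> E \<longleftrightarrow> d = ((q0, replicate k None), (0, replicate k (None, 1)))" if "source d = q0" for d
    proof -
      have "d \<notin> \<delta>" using q0 that by auto
      moreover have "d \<notin> Idle" using q0 that by (auto simp: Idle_def)
      ultimately show ?thesis by (auto simp: E_def)
    qed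
    show "\<exists>d\<in>E. fst d = (1, rs)" if "length rs = k" "set rs \<subseteq> \<Gamma>" for rs
      by (rule bexI[OF _ IdleI[OF that]]) simp
  qed
  let ?good = "\<lambda>ts :: tape list. length ts = k \<and> (\<forall>l<k. range (fst (ts ! l)) \<subseteq> \<Gamma>)"
  have step_good: "?good (snd c')" if st: "tm_step \<delta> c c'" and g: "?good (snd c)" for c c'
  proof -
    obtain as where as: "((fst c, map read_tape (snd c)), (fst c', as)) \<in> \<delta>" "snd c' = map2 act_tape as (snd c)"
      using st by (auto simp: tm_step_def)
    have "length as = k" "\<forall>l<k. fst (as ! l) \<in> \<Gamma>"
      using wf[of "((fst c, map read_tape (snd c)), (fst c', as))"] as(1) by (simp_all add: E_def)
    then show ?thesis using tape_step_\<Gamma> g as(2) by metis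
  qed
  have mono: "tm_step E c c'" if "tm_step \<delta> c c'" for c c'
    using that by (auto simp: tm_step_def E_def)
  have idle_step: "tm_step E (1, ts) (1, ts)" if g: "?good ts" for ts
  proof -
    have "read_tape t \<in> \<Gamma>" if t: "t \<in> set ts" for t
    proof -
      obtain l where l: "l < length ts" "ts ! l = t"
        using t by (auto simp only: in_set_conv_nth)
      have "\<forall>l<length ts. range (fst (ts ! l)) \<subseteq> \<Gamma>" using g by simp
      with l(1) have "range (fst (ts ! l)) \<subseteq> \<Gamma>" by blast
      then have "fst t (snd t) \<in> \<Gamma>" unfolding l(2) by (rule subsetD) (rule rangeI)
      then show ?thesis by (simp only: read_tape_def')
    qed
    then have "((1, map read_tape ts), (1, map (\<lambda>r. (r, 0)) (map read_tape ts))) \<in> E"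
      using g by (intro IdleI) (simp_all add: image_subset_iff)
    moreover have "map2 act_tape (map (\<lambda>r. (r, 0)) (map read_tape ts)) ts = ts"
      by (rule keep_tapes[unfolded keep_def])
    ultimately show ?thesis
      unfolding tm_step_def by (intro exI[of _ "map (\<lambda>r. (r, 0)) (map read_tape ts)"]) simp
  qed
  \<comment> \<open>Shorter runs are padded by idling in the accepting state.\<close>
  have fwd: "(tm_step E ^^ P) c (1, ts)" if "(tm_step \<delta> ^^ n) c (1, ts)" "n \<le> P" "?good (snd c)" for n P c ts
    using that
  proof (induction n arbitrary: c P)
    case 0
    then have "c = (1, ts)" by simp
    moreover have "(tm_step E ^^ P) (1, ts) (1, ts)"
    proof (induction P)
      case (Suc P)
      then show ?case using idle_step[of ts] 0 relpowp_Suc_I by fastforce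
    qed simp
    ultimately show ?case by simp
  next
    case (Suc n)
    obtain c' where c': "tm_step \<delta> c c'" "(tm_step \<delta> ^^ n) c' (1, ts)"
      using relpowp_Suc_D2[OF Suc.prems(1)] by blast
    obtain P' where P': "P = Suc P'" "n \<le> P'" using Suc.prems(2) by (cases P) auto
    have "(tm_step E ^^ P') c' (1, ts)"
      using Suc.IH[OF c'(2) P'(2) step_good[OF c'(1) Suc.prems(3)]] .
    then show ?case unfolding P'(1) by (rule relpowp_Suc_I2[of "tm_step E", OF mono[OF c'(1)]])
  qed
  have bwd: "\<exists>n\<le>P. (tm_step \<delta> ^^ n) c (1, ts)" if "(tm_step E ^^ P) c (1, ts)" "fst c \<noteq> q0" for P c ts
    using that
  proof (induction P arbitrary: c)
    case (Suc P)
    obtain c' where c': "tm_step E c c'" "(tm_step E ^^ P) c' (1, ts)"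
      using relpowp_Suc_D2[OF Suc.prems(1)] by blast
    obtain as where as: "((fst c, map read_tape (snd c)), (fst c', as)) \<in> E" "snd c' = map2 act_tape as (snd c)"
      using c'(1) by (auto simp: tm_step_def)
    show ?case
    proof (cases "((fst c, map read_tape (snd c)), (fst c', as)) \<in> \<delta>")
      case True
      then have "fst c' \<noteq> q0" using q0 by force
      then obtain n where "n \<le> P" "(tm_step \<delta> ^^ n) c' (1, ts)" using Suc.IH[OF c'(2)] by blast
      moreover have "tm_step \<delta> c c'" using True as(2) by (auto simp: tm_step_def)
      ultimately show ?thesis using relpowp_Suc_I2[of "tm_step \<delta>"] by (meson Suc_le_mono)
    next
      case False
      then have "((fst c, map read_tape (snd c)), (fst c', as)) \<in> Idle"
        using as(1) Suc.prems(2) by (auto simp: E_def)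
      then have "fst c = fst c'" "as = map (\<lambda>r. (r, 0)) (map read_tape (snd c))"
        by (auto simp: Idle_def)
      moreover have "map2 act_tape (map (\<lambda>r. (r, 0)) (map read_tape ts)) ts = ts" for ts
        by (rule keep_tapes[unfolded keep_def])
      ultimately have "c' = c" using as(2) by (simp add: prod_eq_iff)
      then show ?thesis using Suc.IH[OF c'(2)] Suc.prems(2) le_Suc_eq by blast
    qed
  qed auto
  \<comment> \<open>The heads start on the blank at \<open>-1\<close>; the step out of
    \<open>q0\<close> rewrites that blank and moves all heads to \<open>0\<close>, which gives
    \<open>tm_init\<close>.\<close>
  have first: "tm_step E (start_config x) c \<longleftrightarrow> c = tm_init k x" for x c
  proof -
    have init: "snd (tm_init k x) = map2 act_tape (replicate k (None, 1)) (snd (start_config x))"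
    proof (rule nth_equalityI)
      show "length (snd (tm_init k x)) = length (map2 act_tape (replicate k (None, 1)) (snd (start_config x)))"
        using k by (simp add: tm_init_def start_config_tapes)
      fix l assume "l < length (snd (tm_init k x))"
      then have l: "l < k" using k by (simp add: tm_init_def)
      have "(string_cells x)(-1 := None) = string_cells x" by (auto simp: string_cells_def)
      then show "snd (tm_init k x) ! l = map2 act_tape (replicate k (None, 1)) (snd (start_config x)) ! l"
        using l map2_act_nth[of "replicate k (None, 1)" "snd (start_config x)" l]
        by (auto simp: start_config_tapes tm_init_def nth_Cons')
    qed
    have reads0: "map read_tape (snd (start_config x)) = replicate k None"
      by (rule nth_equalityI) (auto simp: start_config_tapes string_cells_def)
    have "tm_step E (start_config x) c \<longleftrightarrow> (\<exists>as. ((q0, replicate k None), (fst c, as)) \<in> E \<and>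
        snd c = map2 act_tape as (snd (start_config x)))"
      unfolding tm_step_def reads0 by (simp add: start_config_def)
    also have "\<dots> \<longleftrightarrow> fst c = 0 \<and> snd c = map2 act_tape (replicate k (None, 1)) (snd (start_config x))"
      using start by auto
    also have "\<dots> \<longleftrightarrow> c = tm_init k x"
      unfolding init[symmetric] by (auto simp: prod_eq_iff tm_init_def)
    finally show ?thesis .
  qed
  have init_good: "?good (snd (tm_init k x))" if "x \<in> lists {..<s}" for x
  proof -
    have "string_cells x i \<in> \<Gamma>" for i
    proof -
      have "x ! nat i < s" if "0 \<le> i" "i < int (length x)"
        using \<open>x \<in> lists {..<s}\<close> that nth_mem[of "nat i" x] by fastforce
      then show ?thesis by (auto simp: string_cells_def \<Gamma>_def)
    qed
    then show ?thesis using k None_\<Gamma> by (auto simp: tm_init_def nth_Cons')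
  qed
  show ?thesis
  proof (rule that[of k E \<Gamma> q0 p])
    show "tableau k E \<Gamma> q0" by (rule tableau_axioms)
    fix x assume x: "x \<in> lists {..<s}"
    show "Some ` set x \<subseteq> \<Gamma>" using x by (auto simp: \<Gamma>_def)
    have "(\<exists>ts. (tm_step E ^^ Suc (poly p (length x))) (start_config x) (1, ts)) \<longleftrightarrow>
        (\<exists>ts. (tm_step E ^^ poly p (length x)) (tm_init k x) (1, ts))"
      using first by (metis relpowp_Suc_D2 relpowp_Suc_I2)
    also have "\<dots> \<longleftrightarrow> (\<exists>n \<le> poly p (length x). \<exists>ts. (tm_step \<delta> ^^ n) (tm_init k x) (1, ts))"
    proof -
      have "fst (tm_init k x) \<noteq> q0" using q0 by (simp add: tm_init_def)
      then show ?thesis using bwd fwd init_good[OF x] by meson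
    qed
    finally show "x \<in> L \<longleftrightarrow> (\<exists>ts. (tm_step E ^^ Suc (poly p (length x))) (start_config x) (1, ts))"
      using L[OF x] by simp
  qed
qed

section \<open>The shape of the equations\<close>

lemma concat_map_blocks:
  "concat (map h [0..<m * b]) = concat (map (\<lambda>g. concat (map (\<lambda>i. h (g * b + i)) [0..<b])) [0..<m])"
proof (induction m)
  case (Suc m)
  have "[0..<Suc m * b] = [0..<m * b] @ map (\<lambda>i. m * b + i) [0..<b]"
    using upt_add_eq_append[of 0 "m * b" b] map_add_upt[of "m * b" b] by (simp add: add.commute)
  then show ?case using Suc by (simp add: comp_def)
qed simp

lemma concat_map_const:
  assumes "\<And>i. i < n \<Longrightarrow> h i = z"
  shows "concat (map h [0..<n]) = concat (replicate n z)"
proof -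
  have "map h [0..<n] = replicate n z" using assms by (intro nth_equalityI) auto
  then show ?thesis by simp
qed

lemma concat_map_upt_add:
  "concat (map h [0..<m + n]) = concat (map h [0..<m]) @ concat (map (\<lambda>i. h (m + i)) [0..<n])"
proof -
  have "map h [m..<m + n] = map (\<lambda>i. h (m + i)) [0..<n]" by (rule nth_equalityI) auto
  then show ?thesis using upt_add_eq_append[of 0 m n] by simp
qed

lemma concat_replicate_add:
  "concat (replicate (m + n) z) = concat (replicate m z) @ concat (replicate n z)"
  by (simp add: replicate_add)

lemma concat_replicate_mult:
  "concat (replicate (m * n) z) = concat (replicate m (concat (replicate n z)))"
  by (induction m) (simp_all add: concat_replicate_add)

section \<open>Bit strings of the target and the tiles\<close>

definition bits :: "nat \<Rightarrow> nat \<Rightarrow> (nat \<Rightarrow> nat \<Rightarrow> bool) \<Rightarrow> bool list" where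
  "bits K n Q = concat (map (\<lambda>m. map (Q m) [0..<K]) [0..<n])"

lemma length_bits: "length (bits K n Q) = n * K"
  by (simp add: bits_def length_concat comp_def sum_list_triv)

lemma ones_bits:
  assumes "0 < K"
  shows "ones (bits K n Q) = block_set K n Q"
proof -
  have "concat (map (\<lambda>i. [Q (i div K) (i mod K)]) [0..<n * K]) = bits K n Q"
    unfolding concat_map_blocks bits_def
    by (intro arg_cong[where f = concat] map_cong refl) (auto simp: concat_map_singleton intro!: map_cong)
  then have "bits K n Q = map (\<lambda>i. Q (i div K) (i mod K)) [0..<n * K]"
    by (simp add: concat_map_singleton)
  then show ?thesis by (auto simp: ones_def block_set_def)
qed

context csp
begin

definition block_bits :: "(nat \<Rightarrow> bool) \<Rightarrow> bool list" where
  "block_bits A = map (\<lambda>p. p < Lc \<or> Lc < p \<and> p \<le> Lc + q \<and> A (p - Lc - 1) \<or> Lc + q < p \<and> p \<le> Lc + Lp) [0..<K]"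

definition tail_bits :: "bool list" where
  "tail_bits = map (\<lambda>p. Lc + q < p \<and> p \<le> Lc + Lp) [0..<K]"

definition own_bits :: "nat \<Rightarrow> bool list" where
  "own_bits \<tau> = map (\<lambda>p. p \<in> own_cells \<tau>) [0..<K]"

definition mark_bits :: "nat \<Rightarrow> nat \<Rightarrow> bool list" where
  "mark_bits \<tau> c = map (\<lambda>p. p = px c \<tau>) [0..<K]"

definition empty_bits :: "bool list" where
  "empty_bits = replicate K False"

lemma K_pos: "0 < K"
  by (simp add: K_def)

lemma target_bits:
  "bits K n_blocks target_at =
     concat (map (\<lambda>n. block_bits (Al n)) [0..<N]) @ concat (replicate D tail_bits) @
     concat (replicate M (block_bits (\<lambda>_. True) @ concat (replicate D tail_bits)))"
proof -
  let ?h = "\<lambda>m. map (target_at m) [0..<K]"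
  have board: "?h m = block_bits (Al m)" if "m < N" for m
    using that by (auto simp: block_bits_def target_at_def core_def)
  have tail: "?h m = tail_bits" if "\<not> core m" for m
    using that by (auto simp: tail_bits_def target_at_def core_def)
  have spare: "?h m = block_bits (\<lambda>_. True)" if "\<not> m < N" "core m" for m
    using that by (auto simp: block_bits_def target_at_def)
  have "n_blocks = N + (D + M * Suc D)" by (simp add: n_blocks_def)
  then have "bits K n_blocks target_at = concat (map ?h [0..<N]) @
      concat (map (\<lambda>i. ?h (N + i)) [0..<D]) @ concat (map (\<lambda>i. ?h (N + (D + i))) [0..<M * Suc D])"
    unfolding bits_def by (simp only: concat_map_upt_add)
  also have "concat (map ?h [0..<N]) = concat (map (\<lambda>n. block_bits (Al n)) [0..<N])"
    using board by (intro arg_cong[where f = concat] map_cong) auto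
  also have "concat (map (\<lambda>i. ?h (N + i)) [0..<D]) = concat (replicate D tail_bits)"
    by (rule concat_map_const) (rule tail, auto simp: core_def)
  also have "concat (map (\<lambda>i. ?h (N + (D + i))) [0..<M * Suc D]) =
      concat (map (\<lambda>g. concat (map (\<lambda>i. ?h (N + (D + (g * Suc D + i)))) [0..<Suc D])) [0..<M])"
    by (rule concat_map_blocks)
  also have "\<dots> = concat (replicate M (block_bits (\<lambda>_. True) @ concat (replicate D tail_bits)))"
  proof (rule concat_map_const)
    fix g
    have core: "core (N + (D + (g * Suc D + i))) \<longleftrightarrow> i = 0" if "i < Suc D" for i
    proof -
      have "N + (D + (g * Suc D + i)) - (N + D) = i + g * Suc D" by simp
      then have "(N + (D + (g * Suc D + i)) - (N + D)) mod Suc D = i"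
        using that by (simp only: mod_mult_self1 mod_less)
      then show ?thesis by (simp add: core_def del: mult_Suc_right)
    qed
    have "concat (map (\<lambda>i. ?h (N + (D + (g * Suc D + i)))) [0..<1 + D]) =
        ?h (N + (D + (g * Suc D + 0))) @ concat (map (\<lambda>i. ?h (N + (D + (g * Suc D + (1 + i))))) [0..<D])"
      unfolding concat_map_upt_add by simp
    also have "?h (N + (D + (g * Suc D + 0))) = block_bits (\<lambda>_. True)"
      using core[of 0] by (intro spare) auto
    also have "concat (map (\<lambda>i. ?h (N + (D + (g * Suc D + (1 + i))))) [0..<D]) = concat (replicate D tail_bits)"
    proof (rule concat_map_const, rule tail)
      fix i assume "i < D"
      then show "\<not> core (N + (D + (g * Suc D + (1 + i))))" using core[of "1 + i"] by simp
    qed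
    finally show "concat (map (\<lambda>i. ?h (N + (D + (g * Suc D + i)))) [0..<Suc D]) =
        block_bits (\<lambda>_. True) @ concat (replicate D tail_bits)"
      by (simp only: plus_1_eq_Suc)
  qed
  finally show ?thesis .
qed

lemma tile_bits:
  assumes \<tau>: "\<tau> < q" and r: "r = 4" and dist: "\<Delta> = distance w" and D: "D = w + 1" and w: "w = v + 3" "0 < v"
  shows "bits K (Suc D) (tile_at \<tau>) = own_bits \<tau> @ mark_bits \<tau> 1 @ concat (replicate v empty_bits) @
    mark_bits \<tau> 2 @ mark_bits \<tau> 3 @ mark_bits \<tau> 4"
proof -
  let ?h = "\<lambda>m. map (tile_at \<tau> m) [0..<K]"
  have \<Delta>c: "\<Delta> 1 = 1" "\<Delta> (Suc 0) = 1" "\<Delta> 2 = v + 2" "\<Delta> 3 = v + 3" "\<Delta> 4 = v + 4"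
    using w by (simp_all add: dist distance_def)
  have c4: "1 \<le> c \<and> c \<le> r \<longleftrightarrow> c \<in> {1, 2, 3, 4}" for c using r by auto
  have own: "?h 0 = own_bits \<tau>"
  proof -
    have "\<Delta> c \<noteq> 0" if "1 \<le> c" "c \<le> r" for c using \<Delta>[OF that] by simp
    then have "tile_at \<tau> 0 p \<longleftrightarrow> p \<in> own_cells \<tau>" for p
      unfolding tile_at_def own_cells_def by fastforce
    then show ?thesis by (simp add: own_bits_def)
  qed
  have other: "tile_at \<tau> m p \<longleftrightarrow> (\<exists>c\<in>{1, 2, 3, 4}. p = px c \<tau> \<and> m = \<Delta> c)" if "m \<noteq> 0" for m p
  proof -
    have "tile_at \<tau> m p \<longleftrightarrow> (\<exists>c. (1 \<le> c \<and> c \<le> r) \<and> p = px c \<tau> \<and> m = \<Delta> c)"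
      using that \<tau> unfolding tile_at_def by auto
    then show ?thesis unfolding c4 Bex_def .
  qed
  have mark: "?h (\<Delta> c) = mark_bits \<tau> c" if "c \<in> {1, 2, 3, 4}" for c
  proof -
    have "\<Delta> c \<noteq> 0" using that \<Delta>c by auto
    have "tile_at \<tau> (\<Delta> c) p \<longleftrightarrow> p = px c \<tau>" for p
      unfolding other[OF \<open>\<Delta> c \<noteq> 0\<close>] using that \<Delta>c w(2) by auto
    then show ?thesis by (simp add: mark_bits_def)
  qed
  have empty: "?h (2 + i) = empty_bits" if "i < v" for i
  proof -
    have "\<not> tile_at \<tau> (2 + i) p" for p
      using other[of "2 + i"] \<Delta>c that by auto
    then show ?thesis unfolding empty_bits_def by (intro nth_equalityI) auto
  qed
  have "Suc D = 1 + (1 + (v + (1 + (1 + 1))))" using D w by simp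
  then have "bits K (Suc D) (tile_at \<tau>) = concat (map ?h [0..<1 + (1 + (v + (1 + (1 + 1))))])"
    by (simp only: bits_def)
  also have "\<dots> = ?h 0 @ ?h 1 @ concat (map (\<lambda>i. ?h (1 + (1 + i))) [0..<v]) @ ?h (v + 2) @ ?h (v + 3) @ ?h (v + 4)"
    unfolding concat_map_upt_add by (simp add: numeral_eq_Suc)
  also have "concat (map (\<lambda>i. ?h (1 + (1 + i))) [0..<v]) = concat (replicate v empty_bits)"
    using empty by (intro concat_map_const) (simp add: numeral_2_eq_2)
  finally show ?thesis
    using own mark[of 1] mark[of 2] mark[of 3] mark[of 4] \<Delta>c by simp
qed

end

context tableau
begin

definition admitted_values :: "nat list \<Rightarrow> nat \<Rightarrow> nat \<Rightarrow> nat \<Rightarrow> bool" where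
  "admitted_values x P n v = admitted x P (n div width x P) (n mod width x P) (cell_list ! v)"

definition "border_values v = (cell_list ! v = Border)"
definition "init_values a h v = (cell_list ! v = init_cell a h)"
definition "inner_values v = (cell_list ! v \<noteq> Border)"
definition "final_values v = (cell_list ! v \<noteq> Border \<and> (\<forall>d ys. cell_list ! v = Cell d ys \<longrightarrow> source d = 1))"

text \<open>Keeping \<open>g\<close> arbitrary makes one decomposition serve twice: for the blocks
  of the target, and for the fillers that depend on how many values a variable admits.\<close>

lemma admitted_rows:
  "concat (map (\<lambda>n. g (admitted_values x P n)) [0..<(P + 2) * width x P]) =
    (g border_values @ concat (replicate P (g (init_values None False))) @ g (init_values None True) @
       concat (map (\<lambda>a. g (init_values (Some a) False)) x) @ concat (replicate (P + 2) (g (init_values None False)))) @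
    concat (replicate P (g border_values @ concat (replicate (2 * P + length x + 3) (g inner_values)))) @
    g border_values @ concat (replicate (2 * P + length x + 3) (g final_values))"
proof -
  let ?w = "width x P"
  let ?g = "\<lambda>i j. g (\<lambda>v. admitted x P i j (cell_list ! v))"
  let ?row = "\<lambda>i. concat (map (?g i) [0..<?w])"
  have "concat (map (\<lambda>n. g (admitted_values x P n)) [0..<(P + 2) * ?w]) = concat (map ?row [0..<P + 2])"
    unfolding concat_map_blocks
    by (intro arg_cong[where f = concat] map_cong refl) (auto simp: admitted_values_def[abs_def] intro!: map_cong)
  also have "P + 2 = 1 + (P + 1)" by simp
  also have "concat (map ?row [0..<1 + (P + 1)]) = ?row 0 @ concat (map (\<lambda>i. ?row (1 + i)) [0..<P]) @ ?row (1 + P)"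
    unfolding concat_map_upt_add by simp
  also have "concat (map (\<lambda>i. ?row (1 + i)) [0..<P]) =
     concat (replicate P (g border_values @ concat (replicate (2 * P + length x + 3) (g inner_values))))"
  proof (rule concat_map_const)
    fix i assume "i < P"
    have "?w = 1 + (2 * P + length x + 3)" by (simp add: width_def)
    then have "?row (1 + i) = ?g (1 + i) 0 @ concat (map (\<lambda>j. ?g (1 + i) (1 + j)) [0..<2 * P + length x + 3])"
      by (simp only: concat_map_upt_add) simp
    also have "?g (1 + i) 0 = g border_values" by (simp add: border_values_def[abs_def] admitted_def)
    also have "concat (map (\<lambda>j. ?g (1 + i) (1 + j)) [0..<2 * P + length x + 3]) =
        concat (replicate (2 * P + length x + 3) (g inner_values))"
      using \<open>i < P\<close> by (intro concat_map_const) (simp add: inner_values_def[abs_def] admitted_def)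
    finally show "?row (1 + i) = g border_values @ concat (replicate (2 * P + length x + 3) (g inner_values))" .
  qed
  also have "?row (1 + P) = g border_values @ concat (replicate (2 * P + length x + 3) (g final_values))"
  proof -
    have "?w = 1 + (2 * P + length x + 3)" by (simp add: width_def)
    then have "?row (1 + P) = ?g (1 + P) 0 @ concat (map (\<lambda>j. ?g (1 + P) (1 + j)) [0..<2 * P + length x + 3])"
      by (simp only: concat_map_upt_add) simp
    also have "?g (1 + P) 0 = g border_values" by (simp add: border_values_def[abs_def] admitted_def)
    also have "concat (map (\<lambda>j. ?g (1 + P) (1 + j)) [0..<2 * P + length x + 3]) =
        concat (replicate (2 * P + length x + 3) (g final_values))"
      by (intro concat_map_const) (simp add: final_values_def[abs_def] admitted_def)
    finally show ?thesis .
  qed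
  also have "?row 0 = g border_values @ concat (replicate P (g (init_values None False))) @ g (init_values None True) @
       concat (map (\<lambda>a. g (init_values (Some a) False)) x) @ concat (replicate (P + 2) (g (init_values None False)))"
  proof -
    have g0: "?g 0 j = g (init_values (string_cells x (position P j)) (position P j = -1))" if "0 < j" for j
      using that by (simp add: init_values_def[abs_def] admitted_def)
    have "?w = 1 + (P + (1 + (length x + (P + 2))))" by (simp add: width_def)
    then have "?row 0 = concat (map (?g 0) [0..<1 + (P + (1 + (length x + (P + 2))))])" by (simp only:)
    also have "\<dots> = ?g 0 0 @ concat (map (\<lambda>j. ?g 0 (1 + j)) [0..<P]) @ ?g 0 (1 + P) @
        concat (map (\<lambda>j. ?g 0 (1 + (P + (1 + j)))) [0..<length x]) @
        concat (map (\<lambda>j. ?g 0 (1 + (P + (1 + (length x + j))))) [0..<P + 2])"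
      by (simp only: concat_map_upt_add) simp
    also have "?g 0 0 = g border_values" by (simp add: border_values_def[abs_def] admitted_def)
    also have "concat (map (\<lambda>j. ?g 0 (1 + j)) [0..<P]) = concat (replicate P (g (init_values None False)))"
      by (rule concat_map_const) (simp add: g0 string_cells_def position_def)
    also have "?g 0 (1 + P) = g (init_values None True)"
      by (simp add: g0 string_cells_def position_def)
    also have "map (\<lambda>j. ?g 0 (1 + (P + (1 + j)))) [0..<length x] = map (\<lambda>a. g (init_values (Some a) False)) x"
      by (intro nth_equalityI) (auto simp: g0 string_cells_def position_def)
    also have "concat (map (\<lambda>j. ?g 0 (1 + (P + (1 + (length x + j))))) [0..<P + 2]) =
        concat (replicate (P + 2) (g (init_values None False)))"
      by (rule concat_map_const) (simp add: g0 string_cells_def position_def)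
    finally show ?thesis .
  qed
  finally show ?thesis by simp
qed

end

section \<open>Emitting repeated strings\<close>

text \<open>Numbers usable as loop bounds, with the tapes in \<open>U\<close> as counters. The body
  must avoid \<open>U\<close>, whose heads are moving. Closure under sums and products yields all
  the counts of the reduction.\<close>

definition repeatable ::
  "nat \<Rightarrow> nat \<Rightarrow> (nat list \<Rightarrow> nat list) list \<Rightarrow> nat \<Rightarrow> nat set \<Rightarrow> (nat list \<Rightarrow> nat) \<Rightarrow> bool" where
  "repeatable s S fs out U g \<longleftrightarrow> out \<notin> U \<and>
     (\<forall>V z. emittable s S fs out V z \<longrightarrow> out \<notin> V \<longrightarrow> U \<inter> V = {} \<longrightarrow>
        emittable s S fs out (U \<union> V) (\<lambda>x. concat (replicate (g x) (z x))))"

lemma repeatableD: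
  assumes "repeatable s S fs out U g" "emittable s S fs out V z" "out \<notin> V" "U \<inter> V = {}"
  shows "emittable s S fs out (U \<union> V) (\<lambda>x. concat (replicate (g x) (z x)))"
  using assms by (simp add: repeatable_def)

lemma repeatable_const: "repeatable s S fs out {} (\<lambda>_. c)"
  unfolding repeatable_def
proof (intro conjI allI impI)
  fix V z assume z: "emittable s S fs out V z" "out \<notin> V"
  have "emittable s S fs out V (\<lambda>x. concat (replicate c (z x)))"
  proof (induction c)
    case 0
    then show ?case using emittable_mono[OF emittable_Nil] by simp
  next
    case (Suc c)
    then show ?case using emittable_append[OF z(1) Suc z(2) z(2)] by simp
  qed
  then show "emittable s S fs out ({} \<union> V) (\<lambda>x. concat (replicate c (z x)))" by simp
qed simp

lemma repeatable_add:
  assumes "repeatable s S fs out U g" "repeatable s S fs out V h"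
  shows "repeatable s S fs out (U \<union> V) (\<lambda>x. g x + h x)"
  unfolding repeatable_def
proof (intro conjI allI impI)
  show out: "out \<notin> U \<union> V" using assms by (simp add: repeatable_def)
  fix Y z assume z: "emittable s S fs out Y z" "out \<notin> Y" "(U \<union> V) \<inter> Y = {}"
  have "emittable s S fs out ((U \<union> Y) \<union> (V \<union> Y)) (\<lambda>x. concat (replicate (g x) (z x)) @ concat (replicate (h x) (z x)))"
    using assms z out by (intro emittable_append repeatableD) auto
  moreover have "(U \<union> Y) \<union> (V \<union> Y) = U \<union> V \<union> Y" by blast
  ultimately show "emittable s S fs out (U \<union> V \<union> Y) (\<lambda>x. concat (replicate (g x + h x) (z x)))"
    by (simp only: concat_replicate_add)
qed

text \<open>The loops are nested here, hence disjoint counters; for a sum they run one after the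
  other and may share them.\<close>

lemma repeatable_mult:
  assumes "repeatable s S fs out U g" "repeatable s S fs out V h" "U \<inter> V = {}"
  shows "repeatable s S fs out (U \<union> V) (\<lambda>x. g x * h x)"
  unfolding repeatable_def
proof (intro conjI allI impI)
  show out: "out \<notin> U \<union> V" using assms by (simp add: repeatable_def)
  fix Y z assume z: "emittable s S fs out Y z" "out \<notin> Y" "(U \<union> V) \<inter> Y = {}"
  have "emittable s S fs out (U \<union> (V \<union> Y)) (\<lambda>x. concat (replicate (g x) (concat (replicate (h x) (z x)))))"
    using assms z out by (intro repeatableD) auto
  then show "emittable s S fs out (U \<union> V \<union> Y) (\<lambda>x. concat (replicate (g x * h x) (z x)))"
    by (simp only: concat_replicate_mult Un_assoc)
qed

lemma repeatable_tape:
  assumes "pipeline s S fs" "s \<le> S" "l < length fs"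
  shows "repeatable s S fs (length fs) {l} (\<lambda>x. length ((fs ! l) x))"
  unfolding repeatable_def
proof (intro conjI allI impI)
  obtain p where p: "\<And>x. x \<in> lists {..<s} \<Longrightarrow> length ((fs ! l) x) \<le> poly p (length x)"
    using pipeline_bound[OF assms(1,3,2)] by blast
  fix V z assume z: "emittable s S fs (length fs) V z" "length fs \<notin> V" "{l} \<inter> V = {}"
  have "emittable s S fs (length fs) (insert l V) (\<lambda>x. concat (replicate (length ((fs ! l) x)) (z x)))"
    by (rule emittable_repeat[where q = p]) (use z assms p in auto)
  then show "emittable s S fs (length fs) ({l} \<union> V) (\<lambda>x. concat (replicate (length ((fs ! l) x)) (z x)))"
    by simp
qed (use assms in simp)

lemma emittable_concat_map:
  assumes "\<And>a. a \<in> set as \<Longrightarrow> emittable s S fs out U (z a)" "out \<notin> U"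
  shows "emittable s S fs out U (\<lambda>x. concat (map (\<lambda>a. z a x) as))"
  using assms(1)
proof (induction as)
  case Nil
  then show ?case using emittable_mono[OF emittable_Nil] by simp
next
  case (Cons a as)
  have "emittable s S fs out (U \<union> U) (\<lambda>x. z a x @ concat (map (\<lambda>a. z a x) as))"
    using Cons assms(2) by (intro emittable_append) auto
  then show ?case by simp
qed

definition unary :: "(nat list \<Rightarrow> nat) \<Rightarrow> nat list \<Rightarrow> nat list" where
  "unary g x = replicate (g x) 0"

lemma length_unary [simp]: "length (unary g x) = g x"
  by (simp add: unary_def)

lemma pipeline_snoc_unary:
  assumes "pipeline s S fs" "0 < S" "repeatable s S fs (length fs) U g" "U \<subseteq> {..<length fs}"
  shows "pipeline s S (fs @ [unary g])"
proof (rule pipeline_snoc[OF assms(1)])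
  have "emittable s S fs (length fs) (U \<union> {}) (\<lambda>x. concat (replicate (g x) [0]))"
    using assms by (intro repeatableD[OF _ emittable_symbol]) auto
  moreover have "concat (replicate n [0]) = replicate n (0 :: nat)" for n by (induction n) auto
  ultimately show "emittable s S fs (length fs) {..<length fs} (unary g)"
    using emittable_mono assms(4) by (auto simp: unary_def[abs_def])
qed

text \<open>Horner's scheme: each coefficient adds one tape, whose content is computed from the
  previous value and the length of the input.\<close>

lemma pipeline_poly:
  fixes p :: "nat poly"
  assumes "pipeline s S fs" "s \<le> S" "0 < S" "1 < length fs" "fs ! 1 = unary length"
  shows "\<exists>gs. pipeline s S (fs @ gs) \<and> gs \<noteq> [] \<and> last gs = unary (\<lambda>x. poly p (length x))"
proof (induction p)
  case 0
  have "pipeline s S (fs @ [unary (\<lambda>_. 0)])"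
    using assms repeatable_const by (intro pipeline_snoc_unary) auto
  then show ?case by (intro exI[of _ "[unary (\<lambda>_. 0)]"]) simp
next
  case (pCons a p)
  then obtain gs where gs: "pipeline s S (fs @ gs)" "gs \<noteq> []" "last gs = unary (\<lambda>x. poly p (length x))"
    by blast
  let ?fs = "fs @ gs"
  let ?l = "length ?fs - 1"
  have l: "1 < ?l" "?l < length ?fs" using assms(4) gs(2) by (cases gs; simp)+
  have "?fs ! ?l = unary (\<lambda>x. poly p (length x))"
    using gs(2,3) last_conv_nth[of ?fs] by simp
  then have 1: "repeatable s S ?fs (length ?fs) {?l} (\<lambda>x. poly p (length x))"
    using repeatable_tape[OF gs(1) assms(2) l(2)] by simp
  have "?fs ! 1 = unary length" using assms(4,5) by (simp add: nth_append)
  then have 2: "repeatable s S ?fs (length ?fs) {1} length"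
    using repeatable_tape[OF gs(1) assms(2), of 1] assms(4) by simp
  have "repeatable s S ?fs (length ?fs) ({} \<union> ({1} \<union> {?l})) (\<lambda>x. a + length x * poly p (length x))"
    using l(1) by (intro repeatable_add repeatable_const repeatable_mult 1 2) auto
  then have "pipeline s S (?fs @ [unary (\<lambda>x. a + length x * poly p (length x))])"
    using gs(1) assms(3) l by (intro pipeline_snoc_unary) auto
  then show ?case
    by (intro exI[of _ "gs @ [unary (\<lambda>x. a + length x * poly p (length x))]"]) simp
qed

text \<open>Besides the input, three copies of \<open>p (length x)\<close> and one of \<open>length x\<close> serve as loop
  counters, so that loops over them can be nested.\<close>

lemma pipeline_counters:
  fixes p :: "nat poly"
  assumes "s \<le> S" "0 < S"
  obtains fs l where "pipeline s S fs" "length fs = l + 3" "1 < l" "fs ! 0 = id" "fs ! 1 = unary length"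
    "\<And>i. i < 3 \<Longrightarrow> fs ! (l + i) = unary (\<lambda>x. poly p (length x))"
proof -
  let ?P = "unary (\<lambda>x. poly p (length x))"
  have 0: "pipeline s S [id]" by (simp add: pipeline_def)
  have "pipeline s S ([id] @ [unary length])"
    using repeatable_tape[OF 0 assms(1), of 0] assms(2) by (intro pipeline_snoc_unary[OF 0]) auto
  from pipeline_poly[OF this assms, of p] obtain gs where
    gs: "pipeline s S (([id] @ [unary length]) @ gs)" "gs \<noteq> []" "last gs = ?P"
    by auto
  define hs where "hs = ([id] @ [unary length]) @ gs"
  define l where "l = length hs - 1"
  have hs: "pipeline s S hs" "hs ! 0 = id" "hs ! 1 = unary length" "1 < l" "length hs = Suc l" "hs ! l = ?P"
    using gs last_conv_nth[of hs] by (cases gs; auto simp: hs_def l_def)+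
  have rep: "repeatable s S (hs @ ks) (length (hs @ ks)) {l} (\<lambda>x. poly p (length x))" if "pipeline s S (hs @ ks)" for ks
    using repeatable_tape[OF that assms(1), of l] hs(5,6) by (simp add: nth_append)
  have 1: "pipeline s S (hs @ [?P])"
    using rep[of "[]"] hs(1,5) assms(2) by (intro pipeline_snoc_unary) auto
  have "pipeline s S ((hs @ [?P]) @ [?P])"
    using rep[OF 1] hs(5) assms(2) by (intro pipeline_snoc_unary[OF 1]) auto
  then show ?thesis
  proof (rule that[of "(hs @ [?P]) @ [?P]" l])
    fix i :: nat assume "i < 3"
    then have "i \<in> {0, 1, 2}" by auto
    then show "((hs @ [?P]) @ [?P]) ! (l + i) = ?P" using hs(5,6) by (auto simp: nth_append)
  qed (use hs in \<open>auto simp: nth_append\<close>)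
qed

lemma repeatable_mono:
  assumes "repeatable s S fs out U g" "U \<subseteq> V" "out \<notin> V"
  shows "repeatable s S fs out V g"
  unfolding repeatable_def
proof (intro conjI allI impI)
  fix Y z assume z: "emittable s S fs out Y z" "out \<notin> Y" "V \<inter> Y = {}"
  have "emittable s S fs out (U \<union> Y) (\<lambda>x. concat (replicate (g x) (z x)))"
    using assms z by (intro repeatableD) auto
  then show "emittable s S fs out (V \<union> Y) (\<lambda>x. concat (replicate (g x) (z x)))"
    by (rule emittable_mono) (use assms(2) in auto)
qed (rule assms(3))

lemma emittable_replicate:
  assumes "repeatable s S fs out V g" "emittable s S fs out U z" "V \<inter> U = {}" "out \<notin> U" "V \<union> U \<subseteq> Y"
  shows "emittable s S fs out Y (\<lambda>x. concat (replicate (g x) (z x)))"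
  using emittable_mono[OF repeatableD[OF assms(1,2,4,3)] assms(5)] .

lemma emittable_append_same:
  assumes "emittable s S fs out U z1" "emittable s S fs out U z2" "out \<notin> U"
  shows "emittable s S fs out U (\<lambda>x. z1 x @ z2 x)"
  using emittable_append[OF assms(1,2,3,3)] by simp

lemma emittable_const_any:
  assumes "set w \<subseteq> {..<S}"
  shows "emittable s S fs out U (\<lambda>x. w)"
  using emittable_mono[OF emittable_const[OF assms]] by simp

lemma repeatable_add_const: "repeatable s S fs out U g \<Longrightarrow> repeatable s S fs out U (\<lambda>x. g x + c)"
  using repeatable_add[OF _ repeatable_const[of s S fs out c], of U g] by simp

lemma repeatable_mult_const:
  "repeatable s S fs out U g \<Longrightarrow> repeatable s S fs out U (\<lambda>x. g x * c)"
  "repeatable s S fs out U g \<Longrightarrow> repeatable s S fs out U (\<lambda>x. c * g x)"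
  using repeatable_mult[OF _ repeatable_const[of s S fs out c], of U g] by (simp_all add: mult.commute)

section \<open>The reduction\<close>

definition walk :: "nat \<Rightarrow> nat \<Rightarrow> bool list \<Rightarrow> nat list" where
  "walk a b bs = concat (map (\<lambda>h. (if h then [a] else []) @ [b]) bs)"

lemma walk_append: "walk a b (xs @ ys) = walk a b xs @ walk a b ys"
  by (simp add: walk_def)

lemma walk_concat: "walk a b (concat xss) = concat (map (walk a b) xss)"
  by (induction xss) (simp_all add: walk_append, simp add: walk_def)

lemma set_walk: "set (walk a b bs) \<subseteq> {a, b}"
  by (auto simp: walk_def split: if_splits)

lemma concat_replicate_singleton: "concat (replicate n [c]) = replicate n c"
  by (induction n) auto

lemma letter_codes_tile_word:
  "map letter_code (tile_word i e j bs) =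
     walk (letter_code (i, e)) (letter_code (j, False)) bs @ concat (replicate (length bs) [letter_code (j, True)])"
proof -
  have "map letter_code (concat (map (\<lambda>b. (if b then [(i, e)] else []) @ [(j, False)]) bs)) =
      walk (letter_code (i, e)) (letter_code (j, False)) bs"
    unfolding walk_def map_concat map_map comp_def
    by (intro arg_cong[where f = concat] map_cong refl) auto
  then show ?thesis by (simp add: tile_word_def concat_replicate_singleton)
qed

lemma encode_words_alphabet:
  assumes "set ws \<subseteq> words_over r"
  shows "encode_words ws \<in> lists {..<2 * r + 1}"
proof -
  have "letter_code a < 2 * r + 1" if "a \<in> {..<r} \<times> UNIV" for a
    using that by (cases a; cases "snd a") auto
  then have "set (encode_words [w]) \<subseteq> {..<2 * r + 1}" if "w \<in> words_over r" for w
    using that unfolding encode_words_def words_over_def by auto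
  moreover have "set (encode_words ws) = (\<Union>w\<in>set ws. set (encode_words [w]))"
    by (simp add: encode_words_def)
  ultimately have "set (encode_words ws) \<subseteq> {..<2 * r + 1}" using assms by blast
  then show ?thesis by (simp add: lists_eq_set)
qed

lemma tileable_encoding:
  assumes "in_NP s L" "s \<le> S" and letters: "2 * i + 2 < S" "2 * j + 2 < S"
  obtains tb bss where
    "polytime_computable s (\<lambda>x. encode_words (tile_word i True j (tb x) # map (tile_word i False j) (bss x)))"
    "\<And>x. x \<in> lists {..<s} \<Longrightarrow> (\<Sum>b\<leftarrow>bss x. card (ones b)) = card (ones (tb x))"
    "\<And>x. x \<in> lists {..<s} \<Longrightarrow> x \<in> L \<longleftrightarrow> tileable (ones (tb x)) (map ones (bss x))"
proof -
  obtain k E \<Gamma> q0 p where tab: "tableau k E \<Gamma> q0" and \<Gamma>: "\<And>x. x \<in> lists {..<s} \<Longrightarrow> Some ` set x \<subseteq> \<Gamma>"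
    and L: "\<And>x. x \<in> lists {..<s} \<Longrightarrow> x \<in> L \<longleftrightarrow>
       (\<exists>ts. (tm_step E ^^ Suc (poly p (length x))) (tableau.start_config k q0 x) (1, ts))"
    using np_tableau[OF assms(1)] by metis
  interpret tableau k E \<Gamma> q0 by (rule tab)
  have S: "0 < S" using letters by simp
  obtain fs l where fs: "pipeline s S fs" "length fs = l + 3" "1 < l" "fs ! 0 = id" "fs ! 1 = unary length"
    "\<And>i. i < 3 \<Longrightarrow> fs ! (l + i) = unary (\<lambda>x. poly p (length x))"
    using pipeline_counters[OF assms(2) S, of p] by metis

  define q where "q = length cell_list"
  define R where "R c v v' = compatible c (cell_list ! v) (cell_list ! v')" for c v v'
  define P where "P x = poly p (length x)" for x :: "nat list"
  define w where "w x = width x (P x)" for x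
  define N where "N x = (P x + 2) * w x" for x
  define D where "D x = w x + 1" for x
  define Al where "Al x = admitted_values x (P x)" for x
  define K where "K = csp.K q 4"
  define nb where "nb x = csp.n_blocks q (D x) (N x)" for x
  define tb where "tb x = bits K (nb x) (csp.target_at q 4 (D x) (N x) (Al x))" for x
  define tl where "tl x \<tau> = bits K (Suc (D x)) (csp.tile_at q 4 (distance (w x)) R \<tau>)" for x \<tau>
  define nf where "nf x = csp.n_fillers q 4 (D x) R (N x) (Al x)" for x
  define bss where "bss x = map (\<lambda>j. tl x (j mod q)) [0..<N x * q] @ replicate (nf x) [True]" for x
  \<comment> \<open>The number of empty blocks in a tile; the row width is
    \<open>v x + 3\<close>.\<close>
  define v where "v x = 2 * P x + length x + 1" for x
  have wv: "w x = v x + 3" "0 < v x" for x by (simp_all add: w_def v_def width_def)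
  have "Border \<in> set cell_list" by (simp add: set_cell_list cells_def)
  then have q: "0 < q" by (auto simp: q_def)
  have csp: "csp q 4 (D x) (distance (w x))" for x
    using q wv[of x] by unfold_locales (auto simp: distance_def D_def)
  have K: "0 < K" using csp.K_pos[OF csp] by (simp add: K_def)

  have size: "(\<Sum>b\<leftarrow>bss x. card (ones b)) = card (ones (tb x))"
    and tileable: "tileable (ones (tb x)) (map ones (bss x)) \<longleftrightarrow>
       (\<exists>ts. (tm_step E ^^ Suc (P x)) (start_config x) (1, ts))" if x: "x \<in> lists {..<s}" for x
  proof -
    interpret C: csp q 4 "D x" "distance (w x)" R "N x" "Al x" by (rule csp)
    have target: "ones (tb x) = C.target"
      unfolding tb_def nb_def ones_bits[OF K] by (simp add: C.target_def K_def)
    have "ones (tl x \<tau>) = C.tile \<tau>" for \<tau>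
      unfolding tl_def ones_bits[OF K] by (simp add: C.tile_def K_def)
    moreover have "ones [True] = {0}" by (auto simp: ones_def)
    ultimately have tiles: "map ones (bss x) = C.tiles @ replicate (nf x) {0}"
      by (simp add: bss_def C.tiles_def)
    have "(\<Sum>b\<leftarrow>bss x. card (ones b)) = sum_list (map card (map ones (bss x)))"
      by (simp add: comp_def)
    also have "\<dots> = card C.target"
      unfolding tiles using C.size_tiles by (simp add: nf_def sum_list_replicate)
    finally show "(\<Sum>b\<leftarrow>bss x. card (ones b)) = card (ones (tb x))" by (simp add: target)
    have "tileable (ones (tb x)) (map ones (bss x)) \<longleftrightarrow> (\<exists>s. C.satisfies s)"
      unfolding target tiles
      by (rule C.satisfiable_iff_tileable) (use C.size_tiles in \<open>simp add: nf_def\<close>)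
    also have "\<dots> \<longleftrightarrow> (\<exists>t. tableau_solution x (P x) t)"
      unfolding tableau_solution_iff C.satisfies_def
      unfolding N_def w_def q_def R_def Al_def admitted_values_def ..
    also have "\<dots> \<longleftrightarrow> (\<exists>ts. (tm_step E ^^ Suc (P x)) (start_config x) (1, ts))"
      by (rule tableau_iff_run[OF \<Gamma>[OF x]])
    finally show "tileable (ones (tb x)) (map ones (bss x)) \<longleftrightarrow>
       (\<exists>ts. (tm_step E ^^ Suc (P x)) (start_config x) (1, ts))" .
  qed

  let ?out = "length fs"
  let ?em = "emittable s S fs ?out"
  let ?rep = "repeatable s S fs ?out"
  let ?All = "{0, 1, l, l + 1, l + 2}"
  have out: "?out \<notin> ?All" using fs(2,3) by auto
  have repP: "?rep {l + i} P" if "i < 3" for i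
    using repeatable_tape[OF fs(1) assms(2), of "l + i"] fs(2) fs(6)[OF that] that by (simp add: P_def[abs_def])
  have repP0: "?rep {l} P" using repP[of 0] by simp
  have rep0: "?rep {0} length" and rep1: "?rep {1} length"
    using repeatable_tape[OF fs(1) assms(2), of 0] repeatable_tape[OF fs(1) assms(2), of 1] fs by auto
  have v_rep: "?rep ({l + i} \<union> {t}) v" if "i < 3" "?rep {t} length" for i t
    unfolding v_def[abs_def]
    by (rule repeatable_add_const[OF repeatable_add[OF repeatable_mult_const(2)[OF repP[OF that(1)]] that(2)]])
  \<comment> \<open>The row width is provided twice, from disjoint counters. \<open>N\<close> uses
    \<open>{l, 0, l + 1}\<close> and \<open>D\<close> uses \<open>{1, l + 2}\<close>, so loops over
    \<open>D\<close> can be nested inside loops over \<open>N\<close>.\<close>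
  have repv0: "?rep {0, l + 1} v"
    using v_rep[OF _ rep0, of 1] by (simp add: insert_commute)
  have repv1: "?rep {1, l + 2} v"
    using v_rep[OF _ rep1, of 2] by (simp add: insert_commute)
  have repD: "?rep {1, l + 2} D"
  proof -
    have "D = (\<lambda>x. v x + 4)" by (rule ext) (simp add: D_def wv)
    then show ?thesis using repeatable_add_const[OF repv1, of 4] by (simp only:)
  qed
  have repN: "?rep {l, 0, l + 1} N"
  proof -
    have "?rep ({l} \<union> {0, l + 1}) (\<lambda>x. (P x + 2) * (v x + 3))"
      by (rule repeatable_mult[OF repeatable_add_const[OF repP0] repeatable_add_const[OF repv0]])
        (use fs(3) in simp)
    moreover have "N = (\<lambda>x. (P x + 2) * (v x + 3))" by (rule ext) (simp add: N_def wv)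
    moreover have "{l} \<union> {0, l + 1} = {l, 0, l + 1}" by blast
    ultimately show ?thesis by (simp only:)
  qed
  have repM: "?rep {l, 0, l + 1} (\<lambda>x. csp.M q (N x))"
    using repeatable_mult_const(2)[OF repN, of "q - 1"] by (simp only: csp.M_def[OF csp])
  have repSD: "?rep {1, l + 2} (\<lambda>x. Suc (D x))"
    using repeatable_add_const[OF repD, of 1] by simp
  have repnb: "?rep ?All nb"
  proof -
    have "?rep ?All (\<lambda>x. Suc (D x) * csp.M q (N x))"
      by (rule repeatable_mono[OF repeatable_mult[OF repSD repM]]) (use fs(3) out in auto)
    moreover have "?rep ?All N" "?rep ?All D"
      by (rule repeatable_mono[OF repN], use out in auto, rule repeatable_mono[OF repD], use out in auto)
    ultimately have "?rep ((?All \<union> ?All) \<union> ?All) (\<lambda>x. N x + D x + Suc (D x) * csp.M q (N x))"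
      by (intro repeatable_add)
    moreover have "nb = (\<lambda>x. N x + D x + Suc (D x) * csp.M q (N x))"
      by (rule ext) (simp only: nb_def csp.n_blocks_def[OF csp])
    ultimately show ?thesis by (simp only: Un_absorb)
  qed

  have rows: "?em {0, l, l + 1} (\<lambda>x. concat (map (\<lambda>n. g (Al x n)) [0..<N x]))"
    if g: "\<And>A. set (g A) \<subseteq> {..<S}" for g
  proof -
    let ?U = "{0, l, l + 1}"
    have o: "?out \<notin> ?U" using out by auto
    have c: "?em U (\<lambda>_. g A)" for U A using g by (rule emittable_const_any)
    \<comment> \<open>Only here does the output depend on the letters of the input; everything else
      depends on its length.\<close>
    have scan: "?em ?U (\<lambda>x. concat (map (\<lambda>a. g (init_values (Some a) False)) x))"
    proof -
      have bound: "(\<exists>r. \<forall>x\<in>lists {..<s}. length ((fs ! 0) x) \<le> poly r (length x)) \<and>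
          (\<forall>x\<in>lists {..<s}. set ((fs ! 0) x) \<subseteq> {..<S})"
        by (rule pipeline_bound[OF fs(1) _ assms(2)]) (use fs(2) in simp)
      then obtain r where r: "\<forall>x\<in>lists {..<s}. length ((fs ! 0) x) \<le> poly r (length x)" by blast
      have "?em {0} (\<lambda>x. concat (map (\<lambda>a. g (init_values (Some a) False)) ((fs ! 0) x)))"
      proof (rule emittable_scan[where q = r])
        show "0 < ?out" using fs(2) by simp
      qed (use g r bound in blast)+
      then have "?em {0} (\<lambda>x. concat (map (\<lambda>a. g (init_values (Some a) False)) x))"
        by (simp only: fs(4) id_apply)
      then show ?thesis by (rule emittable_mono) simp
    qed
    have repP2: "?rep {l} (\<lambda>x. P x + 2)" by (rule repeatable_add_const[OF repP0])
    have repw: "?rep {0, l + 1} (\<lambda>x. v x + 2)" by (rule repeatable_add_const[OF repv0])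
    have inner: "?em {0, l + 1} (\<lambda>x. g A @ concat (replicate (v x + 2) (g A')))" for A A'
      using o by (intro emittable_append_same c emittable_replicate[OF repw c[of "{}"]]) auto
    have "?em ?U (\<lambda>x.
      (g border_values @ concat (replicate (P x) (g (init_values None False))) @ g (init_values None True) @
         concat (map (\<lambda>a. g (init_values (Some a) False)) x) @ concat (replicate (P x + 2) (g (init_values None False)))) @
      concat (replicate (P x) (g border_values @ concat (replicate (v x + 2) (g inner_values)))) @
      g border_values @ concat (replicate (v x + 2) (g final_values)))"
      by (intro emittable_append_same c scan o emittable_replicate[OF repP0 c[of "{}"]]
          emittable_replicate[OF repP2 c[of "{}"]] emittable_replicate[OF repP0 inner]
          emittable_replicate[OF repw c[of "{}"]]) (use fs(3) out in auto)
    moreover have "concat (map (\<lambda>n. g (Al x n)) [0..<N x]) =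
      (g border_values @ concat (replicate (P x) (g (init_values None False))) @ g (init_values None True) @
         concat (map (\<lambda>a. g (init_values (Some a) False)) x) @ concat (replicate (P x + 2) (g (init_values None False)))) @
      concat (replicate (P x) (g border_values @ concat (replicate (v x + 2) (g inner_values)))) @
      g border_values @ concat (replicate (v x + 2) (g final_values))" for x
    proof -
      have "2 * P x + length x + 3 = v x + 2" by (simp add: v_def)
      from admitted_rows[of g x "P x", unfolded this] show ?thesis unfolding Al_def N_def w_def .
    qed
    ultimately show ?thesis by (simp only:)
  qed

  let ?a = "\<lambda>e. letter_code (i, e)" and ?b = "letter_code (j, False)" and ?b' = "letter_code (j, True)"
  have ws: "set (walk (?a e) ?b bs) \<subseteq> {..<S}" for e bs
    using set_walk[of "?a e" ?b bs] letters by (cases e) auto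
  have cw: "?em U (\<lambda>_. walk (?a e) ?b bs)" for U e bs by (rule emittable_const_any[OF ws])
  have cs: "?em U (\<lambda>_. [?b'])" "?em U (\<lambda>_. [0])" for U
    using letters by (auto intro!: emittable_const_any)

  have target_em: "?em ?All (\<lambda>x. walk (?a True) ?b (tb x))"
  proof -
    let ?g = "\<lambda>A. walk (?a True) ?b (csp.block_bits q 4 A)" and ?t = "walk (?a True) ?b (csp.tail_bits q 4)"
    have "?em ?All (\<lambda>x. concat (map (\<lambda>n. ?g (Al x n)) [0..<N x]) @ concat (replicate (D x) ?t) @
       concat (replicate (csp.M q (N x)) (?g (\<lambda>_. True) @ concat (replicate (D x) ?t))))"
    proof (intro emittable_append_same out)
      show "?em ?All (\<lambda>x. concat (map (\<lambda>n. ?g (Al x n)) [0..<N x]))"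
        by (rule emittable_mono[OF rows[OF ws]]) auto
      show "?em ?All (\<lambda>x. concat (replicate (D x) ?t))"
        by (rule emittable_replicate[OF repD cw[of "{}"]]) auto
      have "?em {1, l + 2} (\<lambda>x. ?g (\<lambda>_. True) @ concat (replicate (D x) ?t))"
        using out by (intro emittable_append_same cw emittable_replicate[OF repD cw[of "{}"]]) auto
      then show "?em ?All (\<lambda>x. concat (replicate (csp.M q (N x)) (?g (\<lambda>_. True) @ concat (replicate (D x) ?t))))"
        by (rule emittable_replicate[OF repM]) (use fs(3) out in auto)
    qed
    moreover have "walk (?a True) ?b (tb x) = concat (map (\<lambda>n. ?g (Al x n)) [0..<N x]) @ concat (replicate (D x) ?t) @
       concat (replicate (csp.M q (N x)) (?g (\<lambda>_. True) @ concat (replicate (D x) ?t)))" for x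
      unfolding tb_def K_def nb_def csp.target_bits[OF csp]
      by (simp only: walk_append walk_concat map_map map_replicate comp_def)
    ultimately show ?thesis by (simp only:)
  qed

  have tile_em: "?em {1, l + 2} (\<lambda>x. walk (?a False) ?b (tl x \<tau>) @ concat (replicate (length (tl x \<tau>)) [?b']) @ [0])"
    if "\<tau> < q" for \<tau>
  proof -
    let ?W = "walk (?a False) ?b"
    have "?em {1, l + 2} (\<lambda>x. (?W (csp.own_bits q 4 R \<tau>) @ ?W (csp.mark_bits q 4 \<tau> 1) @
        concat (replicate (v x) (?W (csp.empty_bits q 4))) @ ?W (csp.mark_bits q 4 \<tau> 2) @
        ?W (csp.mark_bits q 4 \<tau> 3) @ ?W (csp.mark_bits q 4 \<tau> 4)) @
        concat (replicate (Suc (D x) * K) [?b']) @ [0])"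
      using out by (intro emittable_append_same cw cs emittable_replicate[OF repv1 cw[of "{}"]]
          emittable_replicate[OF repeatable_mult_const(1)[OF repSD] cs(1)[of "{}"]]) auto
    moreover have "tl x \<tau> = csp.own_bits q 4 R \<tau> @ csp.mark_bits q 4 \<tau> 1 @
        concat (replicate (v x) (csp.empty_bits q 4)) @ csp.mark_bits q 4 \<tau> 2 @
        csp.mark_bits q 4 \<tau> 3 @ csp.mark_bits q 4 \<tau> 4" for x
      unfolding tl_def K_def
      by (rule csp.tile_bits[OF csp that refl refl _ wv]) (simp add: D_def)
    moreover have "length (tl x \<tau>) = Suc (D x) * K" for x by (simp add: tl_def length_bits)
    ultimately show ?thesis
      by (simp only: walk_append walk_concat map_replicate)
  qed

  let ?F = "\<lambda>x \<tau>. walk (?a False) ?b (tl x \<tau>) @ concat (replicate (length (tl x \<tau>)) [?b']) @ [0]"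
  let ?f = "walk (?a False) ?b [True] @ concat (replicate (length [True]) [?b']) @ [0]"
  have tiles_em: "?em ?All (\<lambda>x. concat (map (\<lambda>j. ?F x (j mod q)) [0..<N x * q]))"
  proof -
    have "?em {1, l + 2} (\<lambda>x. concat (map (\<lambda>\<tau>. ?F x \<tau>) [0..<q]))"
      using out by (intro emittable_concat_map tile_em) auto
    then have "?em ?All (\<lambda>x. concat (replicate (N x) (concat (map (\<lambda>\<tau>. ?F x \<tau>) [0..<q]))))"
      by (rule emittable_replicate[OF repN]) (use fs(3) out in auto)
    moreover have "concat (map (\<lambda>j. ?F x (j mod q)) [0..<N x * q]) =
        concat (replicate (N x) (concat (map (\<lambda>\<tau>. ?F x \<tau>) [0..<q])))" for x
      unfolding concat_map_blocks
      by (rule concat_map_const, intro arg_cong[where f = concat] map_cong refl) simp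
    ultimately show ?thesis by (simp only:)
  qed

  have fillers_em: "?em ?All (\<lambda>x. concat (replicate (nf x) ?f))"
  proof -
    let ?al = "\<lambda>A. card {v. v < q \<and> A v}"
    have f: "set ?f \<subseteq> {..<S}" using ws[of False "[True]"] letters by auto
    then have fe: "?em U (\<lambda>_. ?f)" for U by (rule emittable_const_any)
    have g: "set (concat (replicate (?al A) ?f)) \<subseteq> {..<S}" for A using f by auto
    have 1: "?em ?All (\<lambda>x. concat (map (\<lambda>n. concat (replicate (?al (Al x n)) ?f)) [0..<N x]))"
      by (rule emittable_mono[OF rows[OF g]]) auto
    have r2: "?rep {l, 0, l + 1} (\<lambda>x. N x * csp.C0 q 4 R)"
      by (rule repeatable_mult_const(1)[OF repN])
    have r3: "?rep ({l, 0, l + 1} \<union> {1, l + 2}) (\<lambda>x. N x * ((q - 1) * csp.X q 4 * D x))"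
      using fs(3) by (intro repeatable_mult[OF repN repeatable_mult_const(2)[OF repD]]) auto
    have r4: "?rep {1, l + 2} (\<lambda>x. D x * csp.X q 4)"
      by (rule repeatable_mult_const(1)[OF repD])
    have "?em ?All (\<lambda>x. concat (map (\<lambda>n. concat (replicate (?al (Al x n)) ?f)) [0..<N x]) @
        concat (replicate (N x * csp.C0 q 4 R) ?f) @
        concat (replicate (N x * ((q - 1) * csp.X q 4 * D x)) ?f) @ concat (replicate (D x * csp.X q 4) ?f))"
      by (intro emittable_append_same 1 out emittable_replicate[OF r2 fe[of "{}"]]
          emittable_replicate[OF r3 fe[of "{}"]] emittable_replicate[OF r4 fe[of "{}"]]) auto
    moreover have "concat (replicate (nf x) ?f) =
        concat (map (\<lambda>n. concat (replicate (?al (Al x n)) ?f)) [0..<N x]) @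
        concat (replicate (N x * csp.C0 q 4 R) ?f) @
        concat (replicate (N x * ((q - 1) * csp.X q 4 * D x)) ?f) @ concat (replicate (D x * csp.X q 4) ?f)" for x
    proof -
      have "concat (replicate (\<Sum>n<m. h n) ?f) = concat (map (\<lambda>n. concat (replicate (h n) ?f)) [0..<m])" for h m
        by (induction m) (simp_all only: sum.lessThan_Suc concat_replicate_add upt_Suc_append[OF le0] map_append
            concat_append list.map concat.simps append_Nil2 lessThan_0 sum.empty replicate_0 upt_0)
      then show ?thesis
        unfolding nf_def csp.n_fillers_def[OF csp] by (simp only: concat_replicate_add append_assoc)
    qed
    ultimately show ?thesis by (simp only:)
  qed

  let ?f = "\<lambda>x. encode_words (tile_word i True j (tb x) # map (tile_word i False j) (bss x))"
  have "?em ?All ?f"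
  proof -
    have "?em ?All (\<lambda>x. (walk (?a True) ?b (tb x) @ concat (replicate (nb x * K) [?b']) @ [0]) @
        concat (map (\<lambda>j. ?F x (j mod q)) [0..<N x * q]) @
        concat (replicate (nf x) (walk (?a False) ?b [True] @ concat (replicate (length [True]) [?b']) @ [0])))"
      by (intro emittable_append_same target_em tiles_em fillers_em out cs
          emittable_replicate[OF repeatable_mult_const(1)[OF repnb] cs(1)[of "{}"]]) auto
    moreover have "?f x = (walk (?a True) ?b (tb x) @ concat (replicate (nb x * K) [?b']) @ [0]) @
        concat (map (\<lambda>j. ?F x (j mod q)) [0..<N x * q]) @
        concat (replicate (nf x) (walk (?a False) ?b [True] @ concat (replicate (length [True]) [?b']) @ [0]))" for x
    proof -
      have "length (tb x) = nb x * K" by (simp add: tb_def length_bits)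
      then show ?thesis
        unfolding encode_words_def bss_def list.map concat.simps letter_codes_tile_word
        by (simp only: map_append map_map comp_def map_replicate concat_append letter_codes_tile_word append_assoc)
    qed
    ultimately show ?thesis by (simp only:)
  qed
  then have "?em {..<?out} ?f" by (rule emittable_mono) (use fs(2,3) in auto)
  from pipeline_computable[OF pipeline_snoc[OF fs(1) this] assms(2)]
  have "polytime_computable s ?f" by simp
  then show ?thesis
    by (rule that) (use size tileable L in \<open>auto simp: P_def\<close>)
qed

theorem corollary5p2:
  fixes A :: "('a, 'm) monoid_scheme" and B :: "('b, 'n) monoid_scheme"
    and gA :: "'a list" and gB :: "'b list"
  assumes "comm_group A" and "comm_group B"
    and "set gA \<subseteq> carrier A" and "generate A (set gA) = carrier A"
    and "set gB \<subseteq> carrier B" and "generate B (set gB) = carrier B"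
    and "carrier A \<noteq> {\<one>\<^bsub>A\<^esub>}"
    and "infinite (carrier B)"
  shows "NP_hard (spherical_alphabet_size (wreath_gens A B gA gB))
           (spherical_problem (wreath A B) (wreath_gens A B gA gB))"
proof -
  interpret wreath_pair A B by (intro wreath_pair.intro assms(1,2))
  let ?gs = "wreath_gens A B gA gB"
  obtain i where i: "i < length gA" "gA ! i \<noteq> \<one>\<^bsub>A\<^esub>"
    by (rule A.nontrivial_generator[OF assms(4,7)])
  obtain j where j: "j < length gB" "inj (\<lambda>n::int. gB ! j [^]\<^bsub>B\<^esub> n)"
    by (rule B.infinite_order_generator[OF assms(5,6,8)])
  let ?j = "length gA + j"
  show ?thesis
    unfolding NP_hard_def
  proof (intro conjI allI impI)
    show "spherical_problem W ?gs \<subseteq> lists {..<spherical_alphabet_size ?gs}"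
      by (rule spherical_problem_alphabet)
    fix s L assume "in_NP s L"
    then obtain tb bss where red:
      "polytime_computable s (\<lambda>x. encode_words (tile_word i True ?j (tb x) # map (tile_word i False ?j) (bss x)))"
      "\<And>x. x \<in> lists {..<s} \<Longrightarrow> (\<Sum>b\<leftarrow>bss x. card (ones b)) = card (ones (tb x))"
      "\<And>x. x \<in> lists {..<s} \<Longrightarrow> x \<in> L \<longleftrightarrow> tileable (ones (tb x)) (map ones (bss x))"
      \<comment> \<open>The tape alphabet has to exceed \<open>s\<close> as well as the largest
        letter codes occurring, \<open>2 * i + 2\<close> and \<open>2 * ?j + 2\<close>.\<close>
      using tileable_encoding[of s L "s + 2 * i + 2 * ?j + 3" i ?j] by auto
    let ?f = "\<lambda>x. encode_words (tile_word i True ?j (tb x) # map (tile_word i False ?j) (bss x))"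
    have "?f x \<in> lists {..<spherical_alphabet_size ?gs}" for x
    proof -
      have "length ?gs = length gA + length gB" by (simp add: wreath_gens_def)
      then have "tile_word i e ?j bs \<in> words_over (length ?gs)" for e bs
        using i(1) j(1) by (intro tile_word_over) auto
      then have "set (tile_word i True ?j (tb x) # map (tile_word i False ?j) (bss x)) \<subseteq> words_over (length ?gs)"
        by auto
      then show ?thesis by (rule encode_words_alphabet)
    qed
    moreover have "x \<in> L \<longleftrightarrow> ?f x \<in> spherical_problem W ?gs" if "x \<in> lists {..<s}" for x
      unfolding red(3)[OF that]
      by (rule spherical_problem_tiles[OF assms(3,5) i(1) j(1) i(2) j(2) red(2)[OF that], symmetric])
    ultimately show "polytime_reducible s L (spherical_alphabet_size ?gs) (spherical_problem W ?gs)"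
      unfolding polytime_reducible_def using red(1) by blast
  qed
qed

end
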